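(* Let $f:(\mathbb{C}^n,0)\to(\mathbb{C},0)$ be a semiquasihomogeneous function of type $(1;l_1,\ldots,l_n)$. Put $w_i:=1/l_i$ for $i=1,\ldots,n$. Then $$\mathcal{L}_0(f)=\max_{1\leqslant i\leqslant n}(w_i-1).$$
   Context: All functions are germs of holomorphic functions $(\mathbb{C}^n,0)\to(\mathbb{C},0)$. Such a germ $f$ is an (isolated) singularity if it has an isolated critical point at $0$. For real weights $l=(l_1,\ldots,l_n)$ the weighted degree of a monomial $z^a=z_1^{a_1}\cdots z_n^{a_n}$ is $\deg_l(z^a):=a_1l_1+\cdots+a_nl_n$. A germ $f$ is weakly quasihomogeneous of type $(d;l_1,\ldots,l_n)$, where $d\in\mathbb{R}_{>0}$ and $l\in\mathbb{R}^n$, if every monomial appearing in its expansion with non-zero coefficient has weighted degree $d$. A germ $f$ is semiquasihomogeneous of type $(d;l_1,\ldots,l_n)$ if $d,l_1,\ldots,l_n\in\mathbb{Q}$, $d>0$, $l_1/d,\ldots,l_n/d\in(0,1/2]$, and $f=f_0+f'$, where $f_0$ (the principal part of $f$) is a weakly quasihomogeneous isolated singularity of type $(d;l_1,\ldots,l_n)$, $\operatorname{ord} f'>1$ (usual order at $0$, with $\operatorname{ord} 0=\infty$), and every monomial appearing in the expansion of $f'$ with non-zero coefficient has weighted degree greater than $d$. For a holomorphic map-germ $F:(\mathbb{C}^n,0)\to(\mathbb{C}^m,0)$ the Łojasiewicz exponent is $$l_0(F):=\inf\{q\in\mathbb{Q}_{>0}: C_1\|z\|^q\leqslant\|F(z)\|\text{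 for some }C_1>0\text{ and all }z\text{ with }\|z\|\text{ sufficiently small}\}.$$ For a singularity $f$, $\mathcal{L}_0(f):=l_0\left(\frac{\partial f}{\partial z_1},\ldots,\frac{\partial f}{\partial z_n}\right)$. *)

theory Defs
  imports "HOL-Analysis.Analysis"
begin

text \<open>
  Germs at the origin are represented by total functions on \<^typ>\<open>complex ^ 'n\<close>; every notion
  below depends only on the values in a neighbourhood of the origin. A holomorphic germ is one
  that is the sum of a convergent power series near the origin. The sum over all multi-indices is
  unconditional (\<^const>\<open>has_sum\<close>), hence absolutely convergent.
\<close>

definition monom_at :: "('n::finite \<Rightarrow> nat) \<Rightarrow> complex ^ 'n \<Rightarrow> complex" where
  "monom_at a z = (\<Prod>i\<in>UNIV. z $ i ^ a i)"

definition has_expansion :: "(complex ^ 'n::finite \<Rightarrow> complex) \<Rightarrow> (('n \<Rightarrow> nat) \<Rightarrow> complex) \<Rightarrow> bool" where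
  "has_expansion f c \<longleftrightarrow> (\<forall>\<^sub>F z in nhds 0. ((\<lambda>a. c a * monom_at a z) has_sum f z) UNIV)"

definition holomorphic_germ :: "(complex ^ 'n::finite \<Rightarrow> complex) \<Rightarrow> bool" where
  "holomorphic_germ f \<longleftrightarrow> f 0 = 0 \<and> (\<exists>c. has_expansion f c)"

text \<open>
  The exponents of the monomials with non-zero coefficient in the expansion of \<open>f\<close>. The expansion
  of a holomorphic germ exists and is unique, so the quantifier over \<open>c\<close> involves no choice.
\<close>

definition appearing :: "(complex ^ 'n::finite \<Rightarrow> complex) \<Rightarrow> ('n \<Rightarrow> nat) set" where
  "appearing f = {a. \<exists>c. has_expansion f c \<and> c a \<noteq> 0}"

definition germ_ord :: "(complex ^ 'n::finite \<Rightarrow> complex) \<Rightarrow> enat" where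
  "germ_ord f = (INF a\<in>appearing f. enat (\<Sum>i\<in>UNIV. a i))"

definition weighted_deg :: "real ^ 'n::finite \<Rightarrow> ('n \<Rightarrow> nat) \<Rightarrow> real" where
  "weighted_deg l a = (\<Sum>i\<in>UNIV. real (a i) * l $ i)"

definition partial :: "'n::finite \<Rightarrow> (complex ^ 'n \<Rightarrow> complex) \<Rightarrow> complex ^ 'n \<Rightarrow> complex" where
  "partial i f z = deriv (\<lambda>t. f (z + axis i t)) 0"

definition gradient :: "(complex ^ 'n::finite \<Rightarrow> complex) \<Rightarrow> complex ^ 'n \<Rightarrow> complex ^ 'n" where
  "gradient f z = (\<chi> i. partial i f z)"

definition isolated_singularity :: "(complex ^ 'n::finite \<Rightarrow> complex) \<Rightarrow> bool" where
  "isolated_singularity f \<longleftrightarrow>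
     holomorphic_germ f \<and> gradient f 0 = 0 \<and> (\<forall>\<^sub>F z in at 0. gradient f z \<noteq> 0)"

definition weakly_quasihomogeneous ::
    "(complex ^ 'n::finite \<Rightarrow> complex) \<Rightarrow> real \<Rightarrow> real ^ 'n \<Rightarrow> bool" where
  "weakly_quasihomogeneous f d l \<longleftrightarrow>
     holomorphic_germ f \<and> d > 0 \<and> (\<forall>a\<in>appearing f. weighted_deg l a = d)"

definition semiquasihomogeneous ::
    "(complex ^ 'n::finite \<Rightarrow> complex) \<Rightarrow> real \<Rightarrow> real ^ 'n \<Rightarrow> bool" where
  "semiquasihomogeneous f d l \<longleftrightarrow>
     holomorphic_germ f \<and>
     d \<in> \<rat> \<and> (\<forall>i. l $ i \<in> \<rat>) \<and> d > 0 \<and> (\<forall>i. l $ i / d \<in> {0<..1/2}) \<and>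
     (\<exists>f0 f'. (\<forall>\<^sub>F z in nhds 0. f z = f0 z + f' z) \<and>
        weakly_quasihomogeneous f0 d l \<and> isolated_singularity f0 \<and>
        holomorphic_germ f' \<and> germ_ord f' > 1 \<and>
        (\<forall>a\<in>appearing f'. weighted_deg l a > d))"

text \<open>
  The infimum is taken in the extended reals, so that it is infinite when no exponent is
  admissible.
\<close>

definition lojasiewicz_map :: "(complex ^ 'n::finite \<Rightarrow> complex ^ 'm::finite) \<Rightarrow> ereal" where
  "lojasiewicz_map F =
     (INF q\<in>{q::real. q \<in> \<rat> \<and> q > 0 \<and>
        (\<exists>C>0. \<forall>\<^sub>F z in nhds 0. C * norm z powr q \<le> norm (F z))}. ereal q)"

definition lojasiewicz_exponent :: "(complex ^ 'n::finite \<Rightarrow> complex) \<Rightarrow> ereal" where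
  "lojasiewicz_exponent f = lojasiewicz_map (gradient f)"

end

theory Submission
  imports Defs "HOL-Complex_Analysis.Residue_Theorem"
begin

text \<open>
  Let \<open>F\<close> be the principal part and \<open>l\<^sub>0\<close> the smallest weight. By quasihomogeneity and compactness of a
  weighted unit sphere, a point \<open>s\<cdot>x\<close> (weighted scaling) with \<open>x\<close> on that sphere satisfies
  \<open>|\<partial>\<^sub>j F(s\<cdot>x)| \<ge> c s^(1 - l\<^sub>j)\<close> for some \<open>j\<close>, while the remainder is of smaller order; since
  \<open>|s\<cdot>x| = O(s^l\<^sub>0)\<close>, the exponent is at most \<open>(1 - l\<^sub>0) / l\<^sub>0\<close>.

  Equality requires points on which every partial derivative is as small as \<open>s^(1 - l\<^sub>0)\<close> but
  the coordinate \<open>x\<^sub>0\<close> is as large as \<open>s^l\<^sub>0\<close>. If \<open>l\<^sub>0 = 1/2\<close>, all weights are equal and any ray does.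
  Otherwise such points lie on the polar curve \<open>\<partial>\<^sub>j f = 0\<close> for \<open>j \<noteq> 0\<close>, and what must be shown is that the
  polar curve of \<open>F\<close> is not contained in \<open>x\<^sub>0 = 0\<close>. The gradient of \<open>F\<close> is a finite branched cover
  \<open>y\<close>. Restrict it to a generic line parallel to the axis \<open>y\<^sub>0\<close>, with coordinate \<open>t\<close>. There the
  Legendre transform \<open>z = \<Sum>\<^sub>i (1 - l\<^sub>i) x\<^sub>i y\<^sub>i\<close> has \<open>dz/dt = x\<^sub>0\<close>. If \<open>x\<^sub>0\<close> vanished on the polar
  curve, then \<open>z = o(t^(1 / (1 - l\<^sub>0)))\<close>, and comparing growth orders in
  \<open>z - (1 - l\<^sub>0) t dz/dt = \<Sum>\<^sub>j\<^sub>\<noteq>\<^sub>0 (1 - l\<^sub>j) x\<^sub>j y\<^sub>j\<close> gives \<open>z = O(t^\<theta>)\<close> with \<open>\<theta> < 1\<close>, because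
  \<open>l\<^sub>0 + l\<^sub>j < 1\<close>. Hence \<open>x\<^sub>0 \<rightarrow> 0\<close> along the line, the power sums of \<open>x\<^sub>0\<close> over the fibres
  are entire and vanish at infinity, so \<open>x\<^sub>0 = 0\<close> identically, a contradiction. The points found for \<open>F\<close> survive
  the perturbation to \<open>f\<close> because finite covers are open.
\<close>

subsection \<open>Polynomial functions\<close>

text \<open>The obstacle on the polar curve is a resonance. Under weighted scaling \<open>z\<close>
  has weight 1 and \<open>t\<close> has weight \<open>1 - l0\<close>, and the operator taking
  \<open>z\<close> to \<open>z - (1 - l0) t dz/dt\<close> annihilates the power
  \<open>t^(1/(1 - l0))\<close>, which is exactly the growth that scaling alone permits. The
  comparison of growth orders is therefore empty unless \<open>z\<close> is strictly smaller; this
  is what the vanishing of \<open>x0\<close> supplies, because rescaled fibres accumulate on the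
  polar curve and \<open>z\<close> is zero there. Functions on the fibres are multivalued in
  \<open>t\<close>, so growth is measured on power sums over the fibre: these are single valued,
  bounded near the finitely many branch values, and hence extend to entire functions. That the
  gradient is a finite branched cover needs an argument of its own: its components have to be
  algebraically independent, which rests on the symmetry of the Hessian and on the fact that a
  proper map is not constant on a line. For \<open>f\<close> no such global information is at hand.
  It is rescaled to \<open>F\<close> plus a small polynomial, and solutions are followed inside a
  fixed bounded region only.\<close>

text \<open>Polynomials in several variables are represented by the functions they define; the index of
  \<open>mpdeg\<close> is an upper bound for the degree.\<close>

inductive mpdeg :: "nat \<Rightarrow> (complex ^ 'n::finite \<Rightarrow> complex) \<Rightarrow> bool" where
  const: "mpdeg d (\<lambda>x. c)"
| shift: "mpdeg d p \<Longrightarrow> mpdeg (Suc d) (\<lambda>x. x $ i * p x)"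
| add: "mpdeg d p \<Longrightarrow> mpdeg d q \<Longrightarrow> mpdeg d (\<lambda>x. p x + q x)"

definition mpoly :: "(complex ^ 'n::finite \<Rightarrow> complex) \<Rightarrow> bool" where
  "mpoly p \<longleftrightarrow> (\<exists>d. mpdeg d p)"

lemma mpdeg_mono: "mpdeg d p \<Longrightarrow> d \<le> e \<Longrightarrow> mpdeg e p"
proof (induction arbitrary: e rule: mpdeg.induct)
  case (shift d p i)
  then obtain e' where "e = Suc e'" "d \<le> e'" by (metis Suc_le_D Suc_le_mono)
  with shift show ?case by (auto intro: mpdeg.shift)
qed (auto intro: mpdeg.intros)

lemma mpdeg_scale: "mpdeg d p \<Longrightarrow> mpdeg d (\<lambda>x. c * p x)"
proof (induction rule: mpdeg.induct)
  case (shift d p i)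
  have "(\<lambda>x. c * (x $ i * p x)) = (\<lambda>x. x $ i * (c * p x))" by (auto simp: algebra_simps)
  with shift show ?case by (auto intro: mpdeg.shift)
qed (auto intro: mpdeg.intros simp: distrib_left)

lemma mpdeg_mult: "mpdeg d p \<Longrightarrow> mpdeg e q \<Longrightarrow> mpdeg (d + e) (\<lambda>x. p x * q x)"
proof (induction rule: mpdeg.induct)
  case (const d c)
  then show ?case using mpdeg_scale mpdeg_mono le_add2 by blast
next
  case (shift d p i)
  then show ?case using mpdeg.shift[of "d + e" "\<lambda>x. p x * q x" i] by (simp add: mult.assoc)
qed (auto intro: mpdeg.intros simp: distrib_right)

lemma mpdeg_power: "mpdeg d p \<Longrightarrow> mpdeg (k * d) (\<lambda>x. p x ^ k)"
  by (induction k) (auto intro: mpdeg.const mpdeg_mult)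

lemma mpdeg_prod:
  assumes "finite A" "\<And>a. a \<in> A \<Longrightarrow> mpdeg (d a) (p a)"
  shows "mpdeg (\<Sum>a\<in>A. d a) (\<lambda>x. \<Prod>a\<in>A. p a x)"
  using assms by (induction A rule: finite_induct) (auto intro: mpdeg.const mpdeg_mult)

lemma mpoly_const: "mpoly (\<lambda>x. c)"
  unfolding mpoly_def by (blast intro: mpdeg.const)

lemma mpoly_add: "mpoly p \<Longrightarrow> mpoly q \<Longrightarrow> mpoly (\<lambda>x. p x + q x)"
  unfolding mpoly_def by (metis mpdeg.add mpdeg_mono max.cobounded1 max.cobounded2)

lemma mpoly_mult: "mpoly p \<Longrightarrow> mpoly q \<Longrightarrow> mpoly (\<lambda>x. p x * q x)"
  unfolding mpoly_def by (blast intro: mpdeg_mult)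

lemma mpoly_coord: "mpoly (\<lambda>x. x $ i)"
  unfolding mpoly_def using mpdeg.shift[OF mpdeg.const[of 0 1], of i] by auto

lemma mpoly_induct [consumes 1, case_names const shift add]:
  assumes "mpoly p" "\<And>c. P (\<lambda>x. c)"
    "\<And>p i. mpoly p \<Longrightarrow> P p \<Longrightarrow> P (\<lambda>x. x $ i * p x)"
    "\<And>p q. mpoly p \<Longrightarrow> mpoly q \<Longrightarrow> P p \<Longrightarrow> P q \<Longrightarrow> P (\<lambda>x. p x + q x)"
  shows "P p"
proof -
  obtain d where "mpdeg d p" using assms(1) mpoly_def by auto
  then show ?thesis
  proof (induction rule: mpdeg.induct)
    case (const d c)
    show ?case by (rule assms(2))
  next
    case (shift d p i)
    then show ?case using assms(3)[of p i] mpoly_def by auto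
  next
    case (add d p q)
    then show ?case using assms(4)[of p q] mpoly_def by auto
  qed
qed

lemma mpoly_sum:
  "(\<And>a. a \<in> A \<Longrightarrow> mpoly (p a)) \<Longrightarrow> mpoly (\<lambda>x. \<Sum>a\<in>A. p a x)"
  by (induction A rule: infinite_finite_induct) (simp_all add: mpoly_const mpoly_add)

lemma mpoly_prod:
  "(\<And>a. a \<in> A \<Longrightarrow> mpoly (p a)) \<Longrightarrow> mpoly (\<lambda>x. \<Prod>a\<in>A. p a x)"
  by (induction A rule: infinite_finite_induct) (simp_all add: mpoly_const mpoly_mult)

lemma mpoly_power: "mpoly p \<Longrightarrow> mpoly (\<lambda>x. p x ^ k)"
  by (induction k) (simp_all add: mpoly_const mpoly_mult)

lemma mpoly_monom: "mpoly (monom_at a)"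
  unfolding monom_at_def[abs_def] by (intro mpoly_prod mpoly_power mpoly_coord)

lemma mpoly_compose:
  assumes "mpoly R" "\<And>i. mpoly (\<lambda>x. y x $ i)"
  shows "mpoly (\<lambda>x. R (y x))"
  using assms(1)
  by (induction rule: mpoly_induct) (simp_all add: mpoly_const mpoly_add mpoly_mult assms(2))

lemma mpoly_continuous:
  assumes "mpoly p" shows "continuous_on S p"
  using assms by (induction rule: mpoly_induct) (auto intro!: continuous_on_add continuous_on_mult continuous_on_component continuous_on_id)

section \<open>Partial derivatives of polynomials\<close>

lemma has_derivative_vec_lambda:
  fixes f :: "'a::real_normed_vector \<Rightarrow> complex ^ 'n::finite"
  assumes "\<And>i. ((\<lambda>x. f x $ i) has_derivative (\<lambda>v. f' v $ i)) (at x)"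
  shows "(f has_derivative f') (at x)"
proof (subst has_derivative_componentwise_within, rule ballI)
  fix b :: "complex ^ 'n" assume "b \<in> Basis"
  then obtain i c where b: "b = axis i c" by (auto simp: Basis_vec_def)
  show "((\<lambda>x. f x \<bullet> b) has_derivative (\<lambda>v. f' v \<bullet> b)) (at x)"
    unfolding b inner_axis by (intro has_derivative_inner_left assms)
qed

lemma partial_eqI:
  fixes x :: "complex ^ 'n::finite"
  assumes "(p has_derivative (\<lambda>v. \<Sum>i\<in>UNIV. p' i * v $ i)) (at x)"
  shows "partial i p x = p' i"
proof -
  have sumax: "(\<Sum>j\<in>UNIV. p' j * axis i t $ j) = p' i * t" for t
    by (subst sum.remove[of _ i]) (auto simp: axis_def)
  have lin: "bounded_linear (axis i :: complex \<Rightarrow> complex ^ 'n)"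
    by (intro linear_conv_bounded_linear[THEN iffD1] linearI) (auto simp: vec_eq_iff axis_def)
  have "((\<lambda>t. x + axis i t) has_derivative axis i) (at 0)"
    using bounded_linear_imp_has_derivative[OF lin] by (auto intro!: derivative_eq_intros)
  moreover have "(p has_derivative (\<lambda>v. \<Sum>i\<in>UNIV. p' i * v $ i)) (at (x + axis i 0))"
  proof -
    have "axis i 0 = (0 :: complex ^ 'n)" by (simp add: vec_eq_iff axis_def)
    then show ?thesis using assms by (simp only: add_0_right)
  qed
  ultimately have "((\<lambda>t. p (x + axis i t)) has_derivative (\<lambda>t. \<Sum>j\<in>UNIV. p' j * axis i t $ j)) (at 0)"
    by (rule has_derivative_compose)
  then have "((\<lambda>t. p (x + axis i t)) has_field_derivative p' i) (at 0)"
    unfolding sumax has_field_derivative_def by simp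
  then show ?thesis unfolding partial_def by (rule DERIV_imp_deriv)
qed

lemma mpoly_derivative_ex:
  assumes "mpoly p"
  shows "\<exists>p'. (\<forall>i. mpoly (p' i)) \<and> (\<forall>x. (p has_derivative (\<lambda>v. \<Sum>i\<in>UNIV. p' i x * v $ i)) (at x))"
  using assms
proof (induction rule: mpoly_induct)
  case (const c)
  show ?case by (rule exI[of _ "\<lambda>i x. 0"]) (simp add: mpoly_const)
next
  case (shift p j)
  then obtain p' where p': "\<And>i. mpoly (p' i)" "\<And>x. (p has_derivative (\<lambda>v. \<Sum>i\<in>UNIV. p' i x * v $ i)) (at x)"
    by auto
  have "((\<lambda>x. x $ j * p x) has_derivative
      (\<lambda>v. \<Sum>i\<in>UNIV. ((if i = j then p x else 0) + x $ j * p' i x) * v $ i)) (at x)" for x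
  proof -
    have "((\<lambda>x. x $ j * p x) has_derivative
      (\<lambda>v. x $ j * (\<Sum>i\<in>UNIV. p' i x * v $ i) + v $ j * p x)) (at x)"
      by (intro has_derivative_mult p' bounded_linear_imp_has_derivative bounded_linear_vec_nth)
    also have "(\<lambda>v. x $ j * (\<Sum>i\<in>UNIV. p' i x * v $ i) + v $ j * p x)
       = (\<lambda>v. \<Sum>i\<in>UNIV. ((if i = j then p x else 0) + x $ j * p' i x) * v $ i)"
    proof
      fix v :: "complex ^ 'a"
      have "(\<Sum>i\<in>UNIV. (if i = j then p x else 0) * v $ i) = v $ j * p x"
        by (subst sum.remove[of _ j]) auto
      then show "x $ j * (\<Sum>i\<in>UNIV. p' i x * v $ i) + v $ j * p x
        = (\<Sum>i\<in>UNIV. ((if i = j then p x else 0) + x $ j * p' i x) * v $ i)"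
        by (simp add: distrib_right sum.distrib sum_distrib_left mult.assoc)
    qed
    finally show ?thesis .
  qed
  moreover have "mpoly (\<lambda>x. (if i = j then p x else 0) + x $ j * p' i x)" for i
    using shift(1) p'(1) by (cases "i = j") (simp_all add: mpoly_add mpoly_mult mpoly_coord)
  ultimately show ?case by (intro exI[of _ "\<lambda>i x. (if i = j then p x else 0) + x $ j * p' i x"]) auto
next
  case (add p q)
  then obtain p' q' where p': "\<And>i. mpoly (p' i)" "\<And>x. (p has_derivative (\<lambda>v. \<Sum>i\<in>UNIV. p' i x * v $ i)) (at x)"
    and q': "\<And>i. mpoly (q' i)" "\<And>x. (q has_derivative (\<lambda>v. \<Sum>i\<in>UNIV. q' i x * v $ i)) (at x)"
    by auto
  show ?case
  proof (intro exI[of _ "\<lambda>i x. p' i x + q' i x"] conjI allI)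
    show "mpoly (\<lambda>x. p' i x + q' i x)" for i
      by (rule mpoly_add[OF p'(1) q'(1)])
    show "((\<lambda>x. p x + q x) has_derivative (\<lambda>v. \<Sum>i\<in>UNIV. (p' i x + q' i x) * v $ i)) (at x)" for x
      using has_derivative_add[OF p'(2) q'(2)] by (simp add: distrib_right sum.distrib)
  qed
qed

lemma mpoly_partial: "mpoly p \<Longrightarrow> mpoly (partial i p)"
  and mpoly_has_derivative:
    "mpoly p \<Longrightarrow> (p has_derivative (\<lambda>v. \<Sum>i\<in>UNIV. partial i p x * v $ i)) (at x)"
proof -
  assume "mpoly p"
  then obtain p' where p': "\<And>i. mpoly (p' i)" "\<And>x. (p has_derivative (\<lambda>v. \<Sum>i\<in>UNIV. p' i x * v $ i)) (at x)"
    using mpoly_derivative_ex by blast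
  have eq: "partial i p = p' i" for i using partial_eqI[OF p'(2)] by blast
  show "mpoly (partial i p)" using p' eq by simp
  show "(p has_derivative (\<lambda>v. \<Sum>i\<in>UNIV. partial i p x * v $ i)) (at x)" using p' eq by simp
qed

lemma partial_const [simp]: "partial i (\<lambda>x. c) = (\<lambda>x. 0)"
  by (auto simp: partial_def)

lemma partial_add:
  "mpoly p \<Longrightarrow> mpoly q \<Longrightarrow> partial i (\<lambda>x. p x + q x) = (\<lambda>x. partial i p x + partial i q x)"
  by (intro ext partial_eqI[of _ "\<lambda>i. partial i p _ + partial i q _"])
    (use has_derivative_add[OF mpoly_has_derivative mpoly_has_derivative] in \<open>auto simp: distrib_right sum.distrib\<close>)

lemma partial_diff:
  "mpoly p \<Longrightarrow> mpoly q \<Longrightarrow> partial i (\<lambda>x. p x - q x) = (\<lambda>x. partial i p x - partial i q x)"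
  by (intro ext partial_eqI[of _ "\<lambda>i. partial i p _ - partial i q _"])
    (use has_derivative_diff[OF mpoly_has_derivative mpoly_has_derivative] in \<open>auto simp: left_diff_distrib sum_subtractf\<close>)

lemma partial_mult:
  "mpoly p \<Longrightarrow> mpoly q \<Longrightarrow> partial i (\<lambda>x. p x * q x) = (\<lambda>x. partial i p x * q x + p x * partial i q x)"
proof (intro ext partial_eqI[of _ "\<lambda>i. partial i p _ * q _ + p _ * partial i q _"])
  fix x assume "mpoly p" "mpoly q"
  from has_derivative_mult[OF this[THEN mpoly_has_derivative], of x]
  show "((\<lambda>x. p x * q x) has_derivative
       (\<lambda>v. \<Sum>i\<in>UNIV. (partial i p x * q x + p x * partial i q x) * v $ i)) (at x)"
    by (simp add: distrib_right sum.distrib sum_distrib_left sum_distrib_right algebra_simps)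
qed

lemma partial_coord: "partial i (\<lambda>x. x $ j) = (\<lambda>x. if i = j then 1 else 0)"
proof (intro ext partial_eqI[of _ "\<lambda>i. if i = j then 1 else 0"])
  fix x :: "complex ^ 'a"
  have "(\<lambda>v::complex^'a. \<Sum>i\<in>UNIV. (if i = j then 1 else 0) * v $ i) = (\<lambda>v. v $ j)"
    by (rule ext, subst sum.remove[of _ j]) auto
  then show "((\<lambda>x. x $ j) has_derivative (\<lambda>v. \<Sum>i\<in>UNIV. (if i = j then 1 else 0) * v $ i)) (at x)"
    by (auto intro!: bounded_linear_imp_has_derivative bounded_linear_vec_nth)
qed

lemma partial_scale:
  "mpoly p \<Longrightarrow> partial i (\<lambda>x. c * p x) = (\<lambda>x. c * partial i p x)"
  using partial_mult[OF mpoly_const, of p i c] by simp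

lemma partial_sum:
  assumes "finite A" "\<And>a. a \<in> A \<Longrightarrow> mpoly (p a)"
  shows "partial i (\<lambda>x. \<Sum>a\<in>A. p a x) = (\<lambda>x. \<Sum>a\<in>A. partial i (p a) x)"
  using assms
  by (induction A rule: finite_induct) (auto simp: partial_add mpoly_sum)

lemma partial_commute: "mpoly p \<Longrightarrow> partial i (partial j p) = partial j (partial i p)"
proof (induction rule: mpoly_induct)
  case (shift p k)
  then show ?case
    by (cases "i = k"; cases "j = k")
      (simp_all add: partial_mult mpoly_coord mpoly_const partial_coord partial_add mpoly_partial mpoly_mult fun_eq_iff)
qed (simp_all add: partial_add mpoly_partial)

lemma mpoly_compose_has_derivative:
  assumes "mpoly R" "\<And>i. mpoly (\<lambda>x. y x $ i)"
  shows "partial k (\<lambda>x. R (y x)) x = (\<Sum>i\<in>UNIV. partial i R (y x) * partial k (\<lambda>x. y x $ i) x)"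
proof (rule partial_eqI[of _ "\<lambda>k. \<Sum>i\<in>UNIV. partial i R (y x) * partial k (\<lambda>x. y x $ i) x"])
  have y: "(y has_derivative (\<lambda>v. \<chi> i. \<Sum>k\<in>UNIV. partial k (\<lambda>x. y x $ i) x * v $ k)) (at x)"
    by (rule has_derivative_vec_lambda) (simp add: mpoly_has_derivative[OF assms(2)])
  have "((\<lambda>x. R (y x)) has_derivative (\<lambda>v. \<Sum>i\<in>UNIV. partial i R (y x) *
     ((\<chi> i. \<Sum>k\<in>UNIV. partial k (\<lambda>x. y x $ i) x * v $ k) $ i))) (at x)"
    by (rule has_derivative_compose[OF y mpoly_has_derivative[OF assms(1)]])
  also have "(\<lambda>v. \<Sum>i\<in>UNIV. partial i R (y x) * ((\<chi> i. \<Sum>k\<in>UNIV. partial k (\<lambda>x. y x $ i) x * v $ k) $ i))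
    = (\<lambda>v::complex^'b. \<Sum>k\<in>UNIV. (\<Sum>i\<in>UNIV. partial i R (y x) * partial k (\<lambda>x. y x $ i) x) * v $ k)"
    by (subst sum_distrib_right, subst sum.swap) (simp add: sum_distrib_left mult.assoc)
  finally show "((\<lambda>x. R (y x)) has_derivative \<dots>) (at x)" .
qed

section \<open>Restriction to lines and zero sets\<close>

lemma mpoly_line:
  assumes "mpoly p"
  shows "\<exists>q. \<forall>t. p (x + t *s v) = poly q t"
  using assms
proof (induction rule: mpoly_induct)
  case (const c)
  show ?case by (rule exI[of _ "[:c:]"]) auto
next
  case (shift p i)
  then obtain q where "\<forall>t. p (x + t *s v) = poly q t" by auto
  then show ?case by (intro exI[of _ "[:x $ i, v $ i:] * q"]) (auto simp: algebra_simps)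
next
  case (add p q)
  then obtain a b where "\<forall>t. p (x + t *s v) = poly a t" "\<forall>t. q (x + t *s v) = poly b t" by auto
  then show ?case by (intro exI[of _ "a + b"]) auto
qed

text \<open>On the complex line joining \<open>x\<close> to \<open>y\<close> both factors become
  non-zero polynomials in one variable, so their product has only finitely many roots there. This is
  the integral domain property for polynomial functions.\<close>

lemma mpoly_mult_nonzero:
  assumes "mpoly p" "mpoly q" "p x \<noteq> 0" "q y \<noteq> 0"
  shows "\<exists>z. p z * q z \<noteq> 0"
proof -
  obtain a where a: "\<And>t. p (x + t *s (y - x)) = poly a t" using mpoly_line[OF assms(1)] by blast
  obtain b where b: "\<And>t. q (x + t *s (y - x)) = poly b t" using mpoly_line[OF assms(2)] by blast
  have "poly a 0 \<noteq> 0" "poly b 1 \<noteq> 0" using assms a[of 0] b[of 1] by auto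
  then have "a * b \<noteq> 0" by auto
  then have "finite {t. poly (a * b) t = 0}" by (rule poly_roots_finite)
  then obtain t where "poly (a * b) t \<noteq> 0" using infinite_UNIV_char_0 ex_new_if_finite by blast
  then show ?thesis using a b by (metis poly_mult)
qed

lemma continuous_on_line: "continuous_on S (\<lambda>t::complex. (x :: complex ^ 'n::finite) + t *s v)"
proof -
  have "(\<lambda>t. x + t *s v) = (\<lambda>t. \<chi> i. x $ i + t * v $ i)" by (simp add: vec_eq_iff fun_eq_iff)
  moreover have "continuous_on S (\<lambda>t. \<chi> i. x $ i + t * v $ i)"
    by (intro continuous_on_vec_lambda continuous_intros)
  ultimately show ?thesis by (simp only:)
qed

text \<open>On the line from \<open>x\<close> towards \<open>y\<close> the zeros are finite in
  number, while the parameters that lead into \<open>U\<close> form a non-empty open, hence infinite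
  set. Generic points are chosen in this way.\<close>

lemma mpoly_nonzero_dense:
  assumes "mpoly p" "p y \<noteq> 0" "open U" "x \<in> U"
  shows "\<exists>z\<in>U. p z \<noteq> 0"
proof -
  obtain a where a: "\<And>t. p (x + t *s (y - x)) = poly a t" using mpoly_line[OF assms(1)] by blast
  have "poly a 1 \<noteq> 0" using assms a[of 1] by auto
  then have "a \<noteq> 0" by auto
  then have fin: "finite {t. poly a t = 0}" by (rule poly_roots_finite)
  have "open ((\<lambda>t::complex. x + t *s (y - x)) -` U)"
    by (rule open_vimage[OF assms(3) continuous_on_line])
  moreover have "0 \<in> (\<lambda>t::complex. x + t *s (y - x)) -` U" using assms(4) by simp
  ultimately have "infinite ((\<lambda>t::complex. x + t *s (y - x)) -` U)"
    using finite_imp_not_open by blast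
  with fin have "\<not> (\<lambda>t::complex. x + t *s (y - x)) -` U \<subseteq> {t. poly a t = 0}"
    using finite_subset by blast
  then obtain t where "x + t *s (y - x) \<in> U" "poly a t \<noteq> 0" by blast
  then show ?thesis using a by metis
qed

subsection \<open>Algebraic dependence and the discriminant\<close>

text \<open>Gaussian elimination by induction on the equations: equation \<open>a\<close> is solved
  for the unknown \<open>b0\<close> at its pivot, and what remains is a system with one equation and
  one unknown fewer.\<close>

lemma homogeneous_system_nontrivial:
  fixes M :: "'a \<Rightarrow> 'b \<Rightarrow> 'c::field"
  assumes "finite A" "finite B" "card A < card B"
  shows "\<exists>c. (\<exists>b\<in>B. c b \<noteq> 0) \<and> (\<forall>a\<in>A. (\<Sum>b\<in>B. M a b * c b) = 0)"
  using assms
proof (induction A arbitrary: B M rule: finite_induct)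
  case empty
  then have "B \<noteq> {}" by auto
  then show ?case by (intro exI[of _ "\<lambda>_. 1"]) auto
next
  case (insert a A)
  show ?case
  proof (cases "\<forall>b\<in>B. M a b = 0")
    case True
    from insert have "card A < card B" by simp
    from insert.IH[OF insert.prems(1) this, of M] True show ?thesis by auto
  next
    case False
    then obtain b0 where b0: "b0 \<in> B" "M a b0 \<noteq> 0" by auto
    define B' where "B' = B - {b0}"
    have B': "finite B'" "card A < card B'" "B = insert b0 B'" "b0 \<notin> B'"
      using insert b0 by (auto simp: B'_def)
    obtain c where c: "\<exists>b\<in>B'. c b \<noteq> 0"
      "\<And>a'. a' \<in> A \<Longrightarrow> (\<Sum>b\<in>B'. (M a' b - M a' b0 * M a b / M a b0) * c b) = 0"
      using insert.IH[OF B'(1,2), of "\<lambda>a' b. M a' b - M a' b0 * M a b / M a b0"] by auto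
    define s where "s = - (\<Sum>b\<in>B'. M a b * c b) / M a b0"
    have sum_B: "(\<Sum>b\<in>B. M a' b * (c(b0 := s)) b) = M a' b0 * s + (\<Sum>b\<in>B'. M a' b * c b)" for a'
      using B' by (simp add: sum.insert) (intro sum.cong, auto)
    have "(\<Sum>b\<in>B. M a' b * (c(b0 := s)) b) = 0" if "a' \<in> A" for a'
    proof -
      have "0 = (\<Sum>b\<in>B'. (M a' b - M a' b0 * M a b / M a b0) * c b)" using c(2) that by simp
      also have "\<dots> = (\<Sum>b\<in>B'. M a' b * c b - M a' b0 / M a b0 * (M a b * c b))"
        by (intro sum.cong) (auto simp: algebra_simps)
      also have "\<dots> = (\<Sum>b\<in>B'. M a' b * c b) + M a' b0 * s"
        by (simp add: sum_subtractf s_def sum_distrib_left sum_divide_distrib)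
      finally show ?thesis unfolding sum_B by (simp only: add.commute)
    qed
    moreover have "(\<Sum>b\<in>B. M a b * (c(b0 := s)) b) = 0" unfolding sum_B using b0 by (simp add: s_def)
    moreover have "\<exists>b\<in>B. (c(b0 := s)) b \<noteq> 0" using c(1) B' by (metis fun_upd_other insertCI)
    ultimately show ?thesis by (intro exI[of _ "c(b0 := s)"]) auto
  qed
qed

text \<open>Bounding each exponent separately, instead of their sum, makes the number of monomials
  an exact power.\<close>

definition exp_box :: "nat \<Rightarrow> ('n::finite \<Rightarrow> nat) set" where
  "exp_box d = {a. \<forall>i. a i \<le> d}"

lemma exp_box_eq_PiE: "exp_box d = PiE UNIV (\<lambda>_. {..d})"
  by (auto simp: exp_box_def PiE_def)

lemma finite_exp_box [simp]: "finite (exp_box d :: ('n::finite \<Rightarrow> nat) set)"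
  unfolding exp_box_eq_PiE by (intro finite_PiE) auto

lemma card_exp_box: "card (exp_box d :: ('n::finite \<Rightarrow> nat) set) = Suc d ^ CARD('n)"
  unfolding exp_box_eq_PiE by (subst card_PiE) auto

lemma monom_at_shift: "monom_at (a(i := Suc (a i))) x = x $ i * monom_at a x"
proof -
  have "monom_at (a(i := Suc (a i))) x = x $ i ^ Suc (a i) * (\<Prod>j\<in>UNIV - {i}. x $ j ^ a j)"
    unfolding monom_at_def by (subst prod.remove[of _ i]) (auto intro!: prod.cong)
  also have "\<dots> = x $ i * monom_at a x"
    unfolding monom_at_def by (subst (2) prod.remove[of _ i]) auto
  finally show ?thesis .
qed

lemma mpdeg_expand:
  "mpdeg d p \<Longrightarrow> \<exists>c. \<forall>x. p x = (\<Sum>a\<in>exp_box d. c a * monom_at a x)"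
proof (induction rule: mpdeg.induct)
  case (const d c)
  have z: "(\<lambda>_. 0) \<in> exp_box d" by (simp add: exp_box_def)
  show ?case
    by (rule exI[of _ "\<lambda>a. if a = (\<lambda>_. 0) then c else 0"])
      (simp add: sum.remove[OF _ z] monom_at_def)
next
  case (shift d p i)
  then obtain c where c: "\<And>x. p x = (\<Sum>a\<in>exp_box d. c a * monom_at a x)" by auto
  define h where "h a = a(i := Suc (a i))" for a :: "'a \<Rightarrow> nat"
  have inj: "inj_on h (exp_box d)"
  proof (rule inj_onI)
    fix a b assume ab: "h a = h b"
    show "a = b"
    proof
      fix j show "a j = b j" using fun_cong[OF ab, of j] by (cases "j = i") (auto simp: h_def)
    qed
  qed
  have sub: "h ` exp_box d \<subseteq> exp_box (Suc d)"
    by (auto simp: h_def exp_box_def le_SucI)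
  have "x $ i * p x = (\<Sum>b\<in>exp_box (Suc d).
      (if b \<in> h ` exp_box d then c (inv_into (exp_box d) h b) else 0) * monom_at b x)" for x
  proof -
    have "x $ i * p x = (\<Sum>a\<in>exp_box d. c a * monom_at (h a) x)"
      by (simp add: c h_def monom_at_shift sum_distrib_left algebra_simps)
    also have "\<dots> = (\<Sum>b\<in>h ` exp_box d. c (inv_into (exp_box d) h b) * monom_at b x)"
      by (subst sum.reindex[OF inj]) (simp add: inj)
    also have "\<dots> = (\<Sum>b\<in>exp_box (Suc d).
      (if b \<in> h ` exp_box d then c (inv_into (exp_box d) h b) else 0) * monom_at b x)"
      using sub by (intro sum.mono_neutral_cong_left) auto
    finally show ?thesis .
  qed
  then show ?case
    by (intro exI[of _ "\<lambda>b. if b \<in> h ` exp_box d then c (inv_into (exp_box d) h b) else 0"]) blast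
next
  case (add d p q)
  then obtain b c where "\<And>x. p x = (\<Sum>a\<in>exp_box d. b a * monom_at a x)"
    "\<And>x. q x = (\<Sum>a\<in>exp_box d. c a * monom_at a x)" by auto
  then show ?case
    by (intro exI[of _ "\<lambda>a. b a + c a"]) (auto simp: distrib_right sum.distrib)
qed

lemma base_digits_unique:
  fixes a b :: "nat \<Rightarrow> nat"
  assumes "\<And>k. a k < M" "\<And>k. b k < M" "(\<Sum>k<N. a k * M ^ k) = (\<Sum>k<N. b k * M ^ k)" "k < N"
  shows "a k = b k"
  using assms
proof (induction N arbitrary: a b k)
  case (Suc N)
  have shift: "(\<Sum>k<Suc N. c k * M ^ k) = c 0 + M * (\<Sum>k<N. c (Suc k) * M ^ k)" for c :: "nat \<Rightarrow> nat"
    by (subst sum.lessThan_Suc_shift) (simp add: sum_distrib_left algebra_simps)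
  have eq: "a 0 + M * (\<Sum>k<N. a (Suc k) * M ^ k) = b 0 + M * (\<Sum>k<N. b (Suc k) * M ^ k)"
    using Suc.prems(3) by (simp only: shift)
  have M: "M > 0" using Suc.prems(1)[of 0] by simp
  have 0: "a 0 = b 0" using arg_cong[OF eq, of "\<lambda>x. x mod M"] Suc.prems(1)[of 0] Suc.prems(2)[of 0] by simp
  then have "(\<Sum>k<N. a (Suc k) * M ^ k) = (\<Sum>k<N. b (Suc k) * M ^ k)" using eq M by simp
  then have "a (Suc k) = b (Suc k)" if "k < N" for k
    using Suc.IH[of "\<lambda>k. a (Suc k)" "\<lambda>k. b (Suc k)" k] Suc.prems(1,2) that by simp
  with 0 show ?case using Suc.prems(4) by (cases k) auto
qed simp

text \<open>Kronecker substitution \<open>x\<^sub>i = t ^ M ^ e i\<close> reduces independence to one variable.\<close>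

lemma monom_at_independent:
  fixes c :: "('n::finite \<Rightarrow> nat) \<Rightarrow> complex"
  assumes "finite A" "\<And>x. (\<Sum>a\<in>A. c a * monom_at a x) = 0" "a \<in> A"
  shows "c a = 0"
proof -
  obtain e :: "'n \<Rightarrow> nat" where e: "bij_betw e UNIV {..<CARD('n)}"
    using ex_bij_betw_finite_nat[of "UNIV :: 'n set"] by (auto simp: atLeast0LessThan)
  \<comment> \<open>The base exceeds every exponent that occurs in \<open>A\<close>, so exponent
    vectors are digit strings in base \<open>M\<close>.\<close>
  define M where "M = Suc (\<Sum>a\<in>A. \<Sum>i\<in>UNIV. a i)"
  have M: "a i < M" if "a \<in> A" for a i
  proof -
    have "a i \<le> (\<Sum>i\<in>UNIV. a i)" by (rule member_le_sum) auto
    also have "\<dots> \<le> (\<Sum>a\<in>A. \<Sum>i\<in>UNIV. a i)" using that assms(1) by (intro member_le_sum) auto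
    finally show ?thesis by (simp add: M_def)
  qed
  define \<phi> where "\<phi> a = (\<Sum>i\<in>UNIV. a i * M ^ e i)" for a :: "'n \<Rightarrow> nat"
  have \<phi>: "\<phi> a = (\<Sum>k<CARD('n). a (inv_into UNIV e k) * M ^ k)" for a
    unfolding \<phi>_def
    by (subst sum.reindex_bij_betw[OF e, symmetric])
      (use e in \<open>auto intro!: sum.cong simp: bij_betw_def\<close>)
  have inj: "inj_on \<phi> A"
  proof (rule inj_onI)
    fix a b assume ab: "a \<in> A" "b \<in> A" "\<phi> a = \<phi> b"
    show "a = b"
    proof
      fix i
      have "e i < CARD('n)" using e by (auto simp: bij_betw_def)
      then have "a (inv_into UNIV e (e i)) = b (inv_into UNIV e (e i))"
        using base_digits_unique[of "\<lambda>k. a (inv_into UNIV e k)" M "\<lambda>k. b (inv_into UNIV e k)"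
            "CARD('n)" "e i"] M ab \<phi> by auto
      then show "a i = b i" using e by (simp add: bij_betw_def)
    qed
  qed
  define q where "q = (\<Sum>a\<in>A. monom (c a) (\<phi> a))"
  have "poly q t = 0" for t
  proof -
    have "monom_at a (\<chi> i. t ^ M ^ e i) = t ^ \<phi> a" for a
      by (simp add: monom_at_def \<phi>_def power_sum power_mult[symmetric] mult.commute)
    then show ?thesis using assms(2)[of "\<chi> i. t ^ M ^ e i"] by (simp add: q_def poly_sum poly_monom)
  qed
  then have "q = 0" using poly_all_0_iff_0 by blast
  then have "0 = coeff q (\<phi> a)" by simp
  also have "\<dots> = (\<Sum>b\<in>A. if b = a then c b else 0)"
    unfolding q_def coeff_sum using inj assms(3) by (intro sum.cong) (auto simp: inj_on_def)
  also have "\<dots> = c a" using assms by simp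
  finally show ?thesis by simp
qed

section \<open>Algebraic relations of minimal degree\<close>

text \<open>Non-triviality asks for some \<open>R k\<close> that is non-zero as a polynomial on the
  target, not merely after composition with \<open>y\<close>. A relation with \<open>K = 0\<close>
  is thus a polynomial dependence among the components of \<open>y\<close> alone.\<close>

definition alg_relation ::
    "(complex ^ 'n::finite \<Rightarrow> complex ^ 'n) \<Rightarrow> (complex ^ 'n \<Rightarrow> complex) \<Rightarrow> nat \<Rightarrow>
     (nat \<Rightarrow> complex ^ 'n \<Rightarrow> complex) \<Rightarrow> bool" where
  "alg_relation y b K R \<longleftrightarrow> (\<forall>k. mpoly (R k)) \<and> (\<exists>k\<le>K. \<exists>Y. R k Y \<noteq> 0) \<and>
     (\<forall>x. (\<Sum>k\<le>K. R k (y x) * b x ^ k) = 0)"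

text \<open>Counting dimensions: there are \<open>(m + 1) ^ (n + 1)\<close> monomials of degree at most \<open>m\<close> in each of
  the \<open>n + 1\<close> functions, and they lie in a space of dimension \<open>O(m ^ n)\<close>.\<close>

lemma alg_relation_ex:
  fixes y :: "complex ^ 'n::finite \<Rightarrow> complex ^ 'n"
  assumes y: "\<And>i. mpoly (\<lambda>x. y x $ i)" and b: "mpoly b"
  shows "\<exists>K R. alg_relation y b K R"
proof -
  have "\<exists>d. mpdeg d (\<lambda>x. y x $ i)" for i using y mpoly_def by auto
  then obtain dy where dy: "\<And>i. mpdeg (dy i) (\<lambda>x. y x $ i)" by metis
  obtain db where db: "mpdeg db b" using b mpoly_def by auto
  define d where "d = db + (\<Sum>i\<in>UNIV. dy i)"
  have d: "mpdeg d (\<lambda>x. y x $ i)" "mpdeg d b" for i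
  proof -
    have "dy i \<le> (\<Sum>i\<in>UNIV. dy i)" by (rule member_le_sum) auto
    then show "mpdeg d (\<lambda>x. y x $ i)" using mpdeg_mono[OF dy] by (simp add: d_def)
    show "mpdeg d b" using mpdeg_mono[OF db] by (simp add: d_def)
  qed
  define n where "n = CARD('n)"
  \<comment> \<open>Chosen so that \<open>D + 1 \<le> (m + 1) * L\<close>. With
    \<open>m = L ^ n\<close> the box of size \<open>D\<close> has at most
    \<open>(m + 1) ^ n * L ^ n = (m + 1) ^ n * m\<close> monomials, fewer than the
    \<open>(m + 1) ^ (n + 1)\<close> products indexed by \<open>B\<close>.\<close>
  define L where "L = Suc (Suc n * d)"
  define m where "m = L ^ n"
  define D where "D = Suc n * m * d"
  define B where "B = (exp_box m :: ('n \<Rightarrow> nat) set) \<times> {..m}"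
  define p where "p = (\<lambda>(\<beta>, k) x. monom_at \<beta> (y x) * b x ^ k)"
  have deg: "mpdeg D (p \<beta>k)" if "\<beta>k \<in> B" for \<beta>k
  proof -
    obtain \<beta> k where \<beta>k: "\<beta>k = (\<beta>, k)" by force
    have "mpdeg ((\<Sum>i\<in>UNIV. \<beta> i * d) + k * d) (\<lambda>x. (\<Prod>i\<in>UNIV. y x $ i ^ \<beta> i) * b x ^ k)"
      by (intro mpdeg_mult mpdeg_prod mpdeg_power d) auto
    moreover have "(\<Sum>i\<in>UNIV. \<beta> i * d) + k * d \<le> D"
    proof -
      have "(\<Sum>i\<in>UNIV. \<beta> i * d) \<le> (\<Sum>i\<in>(UNIV :: 'n set). m * d)"
        using that by (intro sum_mono mult_right_mono) (auto simp: \<beta>k B_def exp_box_def)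
      moreover have "k * d \<le> m * d" using that by (auto simp: \<beta>k B_def)
      ultimately have "(\<Sum>i\<in>UNIV. \<beta> i * d) + k * d \<le> n * (m * d) + m * d"
        unfolding n_def by (intro add_mono) simp_all
      then show ?thesis by (simp add: D_def algebra_simps)
    qed
    ultimately show ?thesis
      unfolding p_def \<beta>k monom_at_def by (simp add: mpdeg_mono)
  qed
  then have "\<forall>\<beta>k\<in>B. \<exists>c. \<forall>x. p \<beta>k x = (\<Sum>a\<in>exp_box D. c a * monom_at a x)"
    using mpdeg_expand by blast
  then obtain C where C: "\<And>\<beta>k x. \<beta>k \<in> B \<Longrightarrow> p \<beta>k x = (\<Sum>a\<in>exp_box D. C \<beta>k a * monom_at a x)"
    by metis
  have "card (exp_box D :: ('n \<Rightarrow> nat) set) < card B"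
  proof -
    have "Suc D \<le> Suc m * L" by (simp add: D_def L_def algebra_simps)
    then have "Suc D ^ n \<le> (Suc m * L) ^ n" by (rule power_mono) simp
    also have "\<dots> = Suc m ^ n * m" by (simp only: power_mult_distrib m_def)
    also have "\<dots> < Suc m ^ n * Suc m" by simp
    also have "\<dots> = card B" by (simp only: B_def card_cartesian_product card_exp_box n_def card_atMost)
    finally show ?thesis by (simp only: card_exp_box n_def)
  qed
  then obtain c where c: "\<exists>\<beta>k\<in>B. c \<beta>k \<noteq> 0"
    "\<And>a. a \<in> exp_box D \<Longrightarrow> (\<Sum>\<beta>k\<in>B. C \<beta>k a * c \<beta>k) = 0"
    using homogeneous_system_nontrivial[of "exp_box D :: ('n \<Rightarrow> nat) set" B "\<lambda>a \<beta>k. C \<beta>k a"]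
    by (auto simp: B_def)
  define R where "R k Y = (\<Sum>\<beta>\<in>exp_box m. c (\<beta>, k) * monom_at \<beta> Y)" for k and Y :: "complex ^ 'n"
  have "mpoly (R k)" for k
    unfolding R_def[abs_def] by (intro mpoly_sum mpoly_mult mpoly_const mpoly_monom)
  moreover have "\<exists>k\<le>m. \<exists>Y. R k Y \<noteq> 0"
  proof -
    obtain \<beta> k where \<beta>k: "(\<beta>, k) \<in> B" "c (\<beta>, k) \<noteq> 0" using c(1) by auto
    then have "\<not> (\<forall>Y. R k Y = 0)"
      using monom_at_independent[of "exp_box m" "\<lambda>\<beta>. c (\<beta>, k)" \<beta>] by (auto simp: R_def B_def)
    then show ?thesis using \<beta>k by (auto simp: B_def)
  qed
  moreover have "(\<Sum>k\<le>m. R k (y x) * b x ^ k) = 0" for x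
  proof -
    have "(\<Sum>k\<le>m. R k (y x) * b x ^ k) = (\<Sum>k\<le>m. \<Sum>\<beta>\<in>exp_box m. c (\<beta>, k) * p (\<beta>, k) x)"
      by (simp add: R_def p_def sum_distrib_right mult.assoc)
    also have "\<dots> = (\<Sum>\<beta>k\<in>B. c \<beta>k * p \<beta>k x)"
      unfolding B_def by (subst sum.swap) (simp add: sum.cartesian_product)
    also have "\<dots> = (\<Sum>\<beta>k\<in>B. \<Sum>a\<in>exp_box D. c \<beta>k * (C \<beta>k a * monom_at a x))"
      by (simp add: C sum_distrib_left)
    also have "\<dots> = (\<Sum>a\<in>exp_box D. (\<Sum>\<beta>k\<in>B. C \<beta>k a * c \<beta>k) * monom_at a x)"
      by (subst sum.swap) (simp only: sum_distrib_right, simp only: mult_ac)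
    also have "\<dots> = 0" using c(2) by simp
    finally show ?thesis .
  qed
  ultimately show ?thesis unfolding alg_relation_def by blast
qed

lemma alg_relation_top_nonzero:
  assumes "alg_relation y b K R" "\<And>K' R'. K' < K \<Longrightarrow> \<not> alg_relation y b K' R'" "K > 0"
  shows "\<exists>Y. R K Y \<noteq> 0"
proof (rule ccontr)
  assume "\<not> ?thesis"
  then have z: "\<And>Y. R K Y = 0" by simp
  obtain K' where K: "K = Suc K'" using assms(3) gr0_conv_Suc by auto
  have "alg_relation y b K' R"
    unfolding alg_relation_def
  proof (intro conjI allI)
    show "mpoly (R k)" for k using assms(1) by (simp add: alg_relation_def)
    show "\<exists>k\<le>K'. \<exists>Y. R k Y \<noteq> 0" using assms(1) z unfolding alg_relation_def K
      by (metis le_Suc_eq)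
    show "(\<Sum>k\<le>K'. R k (y x) * b x ^ k) = 0" for x
      using assms(1) z by (simp add: alg_relation_def K)
  qed
  with assms(2) K show False by auto
qed

definition alg_indep :: "(complex ^ 'n::finite \<Rightarrow> complex ^ 'n) \<Rightarrow> bool" where
  "alg_indep y \<longleftrightarrow> (\<forall>R. mpoly R \<longrightarrow> (\<forall>x. R (y x) = 0) \<longrightarrow> (\<forall>Y. R Y = 0))"

definition jac :: "(complex ^ 'n::finite \<Rightarrow> complex ^ 'n) \<Rightarrow> complex ^ 'n \<Rightarrow> complex ^ 'n \<Rightarrow> complex ^ 'n" where
  "jac y x v = (\<chi> j. \<Sum>k\<in>UNIV. partial k (\<lambda>x. y x $ j) x * v $ k)"

lemma minimal_alg_relation:
  assumes "\<And>i. mpoly (\<lambda>x. y x $ i)" "mpoly b"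
  obtains K R where "alg_relation y b K R" "\<And>K' R'. K' < K \<Longrightarrow> \<not> alg_relation y b K' R'"
proof -
  define K where "K = (LEAST K. \<exists>R. alg_relation y b K R)"
  have "\<exists>R. alg_relation y b K R"
    unfolding K_def using alg_relation_ex[OF assms] by (rule LeastI_ex)
  moreover have "\<not> alg_relation y b K' R'" if "K' < K" for K' R'
    using not_less_Least[OF that[unfolded K_def]] by blast
  ultimately show ?thesis using that by blast
qed

text \<open>Differentiating a minimal relation \<open>\<Sum>\<^sub>k R\<^sub>k(y) x\<^sub>i ^ k = 0\<close> along a kernel vector \<open>v\<close> of the
  Jacobian leaves only \<open>v\<^sub>i\<close> times the derivative of the relation with respect to \<open>x\<^sub>i\<close>.\<close>

lemma separating_coordinate:
  fixes y :: "complex ^ 'n::finite \<Rightarrow> complex ^ 'n"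
  assumes y: "\<And>i. mpoly (\<lambda>x. y x $ i)" and ai: "alg_indep y"
  shows "\<exists>w. mpoly w \<and> (\<exists>x. w x \<noteq> 0) \<and> (\<forall>x v. w x \<noteq> 0 \<longrightarrow> jac y x v = 0 \<longrightarrow> v $ i = 0)"
proof -
  obtain K R where KR: "alg_relation y (\<lambda>x. x $ i) K R"
    and min: "\<And>K' R'. K' < K \<Longrightarrow> \<not> alg_relation y (\<lambda>x. x $ i) K' R'"
    using minimal_alg_relation[OF y mpoly_coord] by blast
  have R: "mpoly (R k)" and rel: "(\<Sum>k\<le>K. R k (y x) * x $ i ^ k) = 0" for k x
    using KR by (auto simp: alg_relation_def)
  have "K > 0"
  proof (rule ccontr)
    assume "\<not> K > 0"
    then have "R 0 (y x) = 0" for x using rel[of x] by simp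
    then have "R 0 Y = 0" for Y using ai R unfolding alg_indep_def by blast
    then show False using KR \<open>\<not> K > 0\<close> by (auto simp: alg_relation_def)
  qed
  then obtain K' where K: "K = Suc K'" using gr0_conv_Suc by auto
  obtain Y0 where Y0: "R K Y0 \<noteq> 0" using alg_relation_top_nonzero[OF KR min \<open>K > 0\<close>] by auto
  \<comment> \<open>\<open>w\<close> is the formal derivative of the minimal relation with respect
    to \<open>x $ i\<close>, with the components of \<open>y\<close> held fixed. If it vanished
    identically it would be a relation of degree \<open>K - 1\<close> whose top coefficient
    \<open>K * R K\<close> is non-zero, against minimality.\<close>
  define R' where "R' k Y = of_nat (Suc k) * R (Suc k) Y" for k Y
  define w where "w x = (\<Sum>k\<le>K'. R' k (y x) * x $ i ^ k)" for x
  have R': "mpoly (R' k)" for k unfolding R'_def[abs_def] by (intro mpoly_mult mpoly_const R)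
  have Ry: "mpoly (\<lambda>x. R k (y x))" for k by (rule mpoly_compose[OF R y])
  have "mpoly w" unfolding w_def[abs_def]
    by (intro mpoly_sum mpoly_mult mpoly_compose[OF R' y] mpoly_power mpoly_coord)
  moreover have "\<exists>x. w x \<noteq> 0"
  proof (rule ccontr)
    assume "\<not> ?thesis"
    moreover have "\<exists>k\<le>K'. \<exists>Y. R' k Y \<noteq> 0"
      using Y0 by (intro exI[of _ K']) (auto simp: R'_def K simp del: of_nat_Suc)
    ultimately have "alg_relation y (\<lambda>x. x $ i) K' R'"
      using R' by (auto simp: alg_relation_def w_def)
    then show False using min K by auto
  qed
  moreover have "v $ i = 0" if wx: "w x \<noteq> 0" and jv: "jac y x v = 0" for x v
  proof -
    have pow: "partial l (\<lambda>x. x $ i ^ k) x = (if l = i then of_nat k * x $ i ^ (k - 1) else 0)"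
      for l k and x :: "complex ^ 'n"
    proof (induction k)
      case (Suc k)
      have "partial l (\<lambda>x. x $ i ^ Suc k) x = (if l = i then x $ i ^ k else 0) + x $ i * partial l (\<lambda>x. x $ i ^ k) x"
        using partial_mult[OF mpoly_coord[of i] mpoly_power[OF mpoly_coord[of i], of k], of l]
        by (simp add: partial_coord)
      also have "\<dots> = (if l = i then of_nat (Suc k) * x $ i ^ k else 0)"
        using Suc by (cases k) (auto simp: algebra_simps)
      finally show ?case by simp
    qed simp
    have D0: "(\<Sum>k\<le>K. (\<Sum>m\<in>UNIV. partial m (R k) (y x) * partial l (\<lambda>x. y x $ m) x) * x $ i ^ k
         + R k (y x) * (if l = i then of_nat k * x $ i ^ (k - 1) else 0)) = 0" for l
    proof -
      have "(\<lambda>x. \<Sum>k\<le>K. R k (y x) * x $ i ^ k) = (\<lambda>x. 0)" using rel by simp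
      then have "0 = partial l (\<lambda>x. \<Sum>k\<le>K. R k (y x) * x $ i ^ k) x" by simp
      also have "\<dots> = (\<Sum>k\<le>K. partial l (\<lambda>x. R k (y x) * x $ i ^ k) x)"
        by (subst partial_sum) (auto intro!: mpoly_mult Ry mpoly_power mpoly_coord)
      also have "\<dots> = (\<Sum>k\<le>K. partial l (\<lambda>x. R k (y x)) x * x $ i ^ k + R k (y x) * partial l (\<lambda>x. x $ i ^ k) x)"
        by (simp add: partial_mult[OF Ry mpoly_power[OF mpoly_coord]])
      finally show ?thesis by (simp add: mpoly_compose_has_derivative[OF R y] pow)
    qed
    have jv': "(\<Sum>l\<in>UNIV. partial l (\<lambda>x. y x $ m) x * v $ l) = 0" for m
      using jv by (simp add: jac_def vec_eq_iff)
    have "0 = (\<Sum>l\<in>UNIV. (\<Sum>k\<le>K. (\<Sum>m\<in>UNIV. partial m (R k) (y x) * partial l (\<lambda>x. y x $ m) x) * x $ i ^ k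
         + R k (y x) * (if l = i then of_nat k * x $ i ^ (k - 1) else 0)) * v $ l)"
      by (simp add: D0)
    also have "\<dots> = (\<Sum>k\<le>K. \<Sum>l\<in>UNIV. ((\<Sum>m\<in>UNIV. partial m (R k) (y x) * partial l (\<lambda>x. y x $ m) x) * x $ i ^ k
         + R k (y x) * (if l = i then of_nat k * x $ i ^ (k - 1) else 0)) * v $ l)"
      unfolding sum_distrib_right by (rule sum.swap)
    also have "\<dots> = (\<Sum>k\<le>K. R k (y x) * of_nat k * x $ i ^ (k - 1) * v $ i)"
    proof (intro sum.cong refl)
      fix k
      have "(\<Sum>l\<in>UNIV. ((\<Sum>m\<in>UNIV. partial m (R k) (y x) * partial l (\<lambda>x. y x $ m) x) * x $ i ^ k
         + R k (y x) * (if l = i then of_nat k * x $ i ^ (k - 1) else 0)) * v $ l)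
        = (\<Sum>l\<in>UNIV. \<Sum>m\<in>UNIV. partial m (R k) (y x) * x $ i ^ k * (partial l (\<lambda>x. y x $ m) x * v $ l))
          + (\<Sum>l\<in>UNIV. R k (y x) * (if l = i then of_nat k * x $ i ^ (k - 1) else 0) * v $ l)"
        unfolding sum.distrib[symmetric]
        by (intro sum.cong refl) (simp only: distrib_right sum_distrib_right, simp only: mult_ac)
      also have "(\<Sum>l\<in>UNIV. \<Sum>m\<in>UNIV. partial m (R k) (y x) * x $ i ^ k * (partial l (\<lambda>x. y x $ m) x * v $ l))
         = (\<Sum>m\<in>UNIV. partial m (R k) (y x) * x $ i ^ k * (\<Sum>l\<in>UNIV. partial l (\<lambda>x. y x $ m) x * v $ l))"
        by (subst sum.swap) (simp add: sum_distrib_left)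
      also have "\<dots> = 0" by (simp add: jv')
      also have "(\<Sum>l\<in>UNIV. R k (y x) * (if l = i then of_nat k * x $ i ^ (k - 1) else 0) * v $ l)
         = R k (y x) * of_nat k * x $ i ^ (k - 1) * v $ i"
        by (subst sum.remove[of _ i]) auto
      finally show "(\<Sum>l\<in>UNIV. ((\<Sum>m\<in>UNIV. partial m (R k) (y x) * partial l (\<lambda>x. y x $ m) x) * x $ i ^ k
         + R k (y x) * (if l = i then of_nat k * x $ i ^ (k - 1) else 0)) * v $ l)
         = R k (y x) * of_nat k * x $ i ^ (k - 1) * v $ i" by simp
    qed
    also have "\<dots> = w x * v $ i"
      unfolding K sum.atMost_Suc_shift w_def R'_def by (simp add: sum_distrib_left sum_distrib_right mult_ac del: of_nat_Suc)
    finally show ?thesis using wx by simp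
  qed
  ultimately show ?thesis by blast
qed

lemma mpoly_prod_nonzero:
  assumes "finite A" "\<And>a. a \<in> A \<Longrightarrow> mpoly (w a)" "\<And>a. a \<in> A \<Longrightarrow> \<exists>x. w a x \<noteq> 0"
  shows "\<exists>x. (\<Prod>a\<in>A. w a x) \<noteq> 0"
  using assms
proof (induction A rule: finite_induct)
  case (insert a A)
  then obtain x z where "w a x \<noteq> 0" "(\<Prod>a\<in>A. w a z) \<noteq> 0" by (metis insertI1 insertI2)
  then show ?case
    using mpoly_mult_nonzero[of "w a" "\<lambda>z. \<Prod>a\<in>A. w a z"] insert by (auto simp: mpoly_prod)
qed simp

text \<open>The product \<open>W\<close> of the separating polynomials detects injectivity of the
  Jacobian, but it lives on the source. It is transferred to the target by the constant term
  \<open>R 0\<close> of a minimal relation for \<open>W\<close>: where \<open>W\<close> is zero the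
  relation collapses to \<open>R 0 (y x) = 0\<close>.\<close>

lemma discriminant_ex:
  fixes y :: "complex ^ 'n::finite \<Rightarrow> complex ^ 'n"
  assumes y: "\<And>i. mpoly (\<lambda>x. y x $ i)" and ai: "alg_indep y"
  shows "\<exists>\<Delta>. mpoly \<Delta> \<and> (\<exists>x. \<Delta> (y x) \<noteq> 0) \<and> (\<forall>x v. \<Delta> (y x) \<noteq> 0 \<longrightarrow> jac y x v = 0 \<longrightarrow> v = 0)"
proof -
  obtain w where w: "\<And>i. mpoly (w i)" "\<And>i. \<exists>x. w i x \<noteq> 0"
    "\<And>i x v. w i x \<noteq> 0 \<Longrightarrow> jac y x v = 0 \<Longrightarrow> v $ i = 0"
    using separating_coordinate[OF y ai] by metis
  define W where "W x = (\<Prod>i\<in>UNIV. w i x)" for x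
  have W: "mpoly W" unfolding W_def[abs_def] by (intro mpoly_prod w)
  obtain x0 where x0: "W x0 \<noteq> 0"
    using mpoly_prod_nonzero[of UNIV w] w unfolding W_def by auto
  obtain K R where KR: "alg_relation y W K R"
    and min: "\<And>K' R'. K' < K \<Longrightarrow> \<not> alg_relation y W K' R'"
    using minimal_alg_relation[OF y W] by blast
  have R: "mpoly (R k)" and rel: "(\<Sum>k\<le>K. R k (y x) * W x ^ k) = 0" for k x
    using KR by (auto simp: alg_relation_def)
  \<comment> \<open>A relation without constant term is divisible by \<open>W\<close>; as
    \<open>W\<close> is not the zero polynomial, it could be cancelled and the degree would
    drop.\<close>
  have "\<exists>Y. R 0 Y \<noteq> 0"
  proof (rule ccontr)
    assume "\<not> ?thesis"
    then have z: "\<And>Y. R 0 Y = 0" by simp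
    have "K > 0" using KR z by (auto simp: alg_relation_def intro: gr0I)
    then obtain K' where K: "K = Suc K'" using gr0_conv_Suc by auto
    define g where "g x = (\<Sum>k\<le>K'. R (Suc k) (y x) * W x ^ k)" for x
    have g: "mpoly g" unfolding g_def[abs_def]
      by (intro mpoly_sum mpoly_mult mpoly_compose[OF R y] mpoly_power W)
    have "W x * g x = 0" for x
    proof -
      have "0 = (\<Sum>k\<le>K. R k (y x) * W x ^ k)" using rel by simp
      also have "\<dots> = W x * g x"
        unfolding K sum.atMost_Suc_shift g_def by (simp add: z sum_distrib_left mult_ac)
      finally show ?thesis by simp
    qed
    then have "g x = 0" for x using mpoly_mult_nonzero[OF W g x0] by blast
    then have "alg_relation y W K' (\<lambda>k. R (Suc k))"
      using KR z by (auto simp: alg_relation_def g_def K) (metis Suc_le_mono not0_implies_Suc)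
    then show False using min K by auto
  qed
  then have "\<exists>x. R 0 (y x) \<noteq> 0" using ai R unfolding alg_indep_def by blast
  moreover have "v = 0" if "R 0 (y x) \<noteq> 0" "jac y x v = 0" for x v
  proof -
    have "W x \<noteq> 0"
    proof
      assume "W x = 0"
      then have "(\<Sum>k\<le>K. R k (y x) * W x ^ k) = R 0 (y x)"
        by (subst sum.atMost_shift) simp
      with that rel show False by simp
    qed
    then have "w i x \<noteq> 0" for i by (auto simp: W_def)
    then have "v $ i = 0" for i by (rule w(3)) (rule that(2))
    then show ?thesis by (simp add: vec_eq_iff)
  qed
  ultimately show ?thesis using R by blast
qed

subsection \<open>Fibres and traces of polynomial maps\<close>

definition mpoly_map :: "(complex ^ 'n::finite \<Rightarrow> complex ^ 'n) \<Rightarrow> bool" where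
  "mpoly_map y \<longleftrightarrow> (\<forall>i. mpoly (\<lambda>x. y x $ i))"

definition regular_value :: "(complex ^ 'n::finite \<Rightarrow> complex ^ 'n) \<Rightarrow> complex ^ 'n \<Rightarrow> bool" where
  "regular_value y Y \<longleftrightarrow> (\<forall>x. y x = Y \<longrightarrow> (\<forall>v. jac y x v = 0 \<longrightarrow> v = 0))"

text \<open>The fibre is taken as a set, without multiplicities. The trace is used over regular
  values only; where a line meets the discriminant it is replaced by a holomorphic extension along
  that line.\<close>

definition tr :: "(complex ^ 'n::finite \<Rightarrow> complex ^ 'n) \<Rightarrow> (complex ^ 'n \<Rightarrow> complex) \<Rightarrow> complex ^ 'n \<Rightarrow> complex" where
  "tr y w Y = (\<Sum>x\<in>y -` {Y}. w x)"

lemma jac_scale: "jac y x (c *s v) = c *s jac y x v"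
  by (simp add: jac_def vec_eq_iff sum_distrib_left algebra_simps)

lemma jac_linear: "linear (jac y x)"
  by (rule linearI) (simp_all add: jac_def vec_eq_iff algebra_simps sum.distrib scaleR_sum_right)

lemma mpoly_map_has_derivative: "mpoly_map y \<Longrightarrow> (y has_derivative jac y x) (at x)"
  by (rule has_derivative_vec_lambda) (simp add: jac_def mpoly_map_def mpoly_has_derivative)

lemma mpoly_map_continuous: "mpoly_map y \<Longrightarrow> continuous_on S y"
  by (metis mpoly_map_has_derivative has_derivative_continuous continuous_at_imp_continuous_on)

lemma mpoly_map_continuous_jac:
  assumes "mpoly_map y" shows "continuous_on S (\<lambda>x. jac y x v)"
  unfolding jac_def
  by (intro continuous_on_vec_lambda continuous_on_sum continuous_on_mult continuous_on_const
      mpoly_continuous mpoly_partial) (use assms in \<open>auto simp: mpoly_map_def\<close>)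

section \<open>Local sections over regular values\<close>

text \<open>The inverse function theorem for the real derivative \<open>jac y x\<close>. The last
  clause records the derivative of the inverse as a right inverse of \<open>jac\<close>.\<close>

lemma local_inverse:
  fixes y :: "complex ^ 'n::finite \<Rightarrow> complex ^ 'n"
  assumes y: "mpoly_map y" and inj: "\<And>v. jac y x0 v = 0 \<Longrightarrow> v = 0" and W: "open W" "x0 \<in> W"
  shows "\<exists>U V g. open U \<and> U \<subseteq> W \<and> x0 \<in> U \<and> open V \<and> y x0 \<in> V \<and> homeomorphism U V y g \<and>
    (\<forall>Y\<in>V. \<exists>g'. (g has_derivative g') (at Y) \<and> (\<forall>v. jac y (g Y) (g' v) = v))"
proof -
  define f' where "f' x = Blinfun (jac y x)" for x
  have app: "blinfun_apply (f' x) = jac y x" for x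
    unfolding f'_def by (rule bounded_linear_Blinfun_apply)
      (rule linear_conv_bounded_linear[THEN iffD1, OF jac_linear])
  have "inj (jac y x0)"
    using linear_injective_0[OF jac_linear] inj by blast
  then obtain h where h: "linear h" "h \<circ> jac y x0 = id"
    using linear_injective_left_inverse[OF jac_linear] by blast
  define invf where "invf = Blinfun h"
  have apph: "blinfun_apply invf = h"
    unfolding invf_def using h(1) by (intro bounded_linear_Blinfun_apply) (rule linear_conv_bounded_linear[THEN iffD1])
  have inv: "invf o\<^sub>L f' x0 = id_blinfun"
    using h(2) by (intro blinfun_eqI) (simp add: app apph fun_eq_iff)
  have cont: "continuous_on W f'"
    by (rule continuous_on_blinfun_componentwise) (simp add: app mpoly_map_continuous_jac[OF y])
  obtain U V g g' where *: "open U" "U \<subseteq> W" "x0 \<in> U" "open V" "y x0 \<in> V" "homeomorphism U V y g"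
    "\<And>Y. Y \<in> V \<Longrightarrow> (g has_derivative (g' Y)) (at Y)"
    "\<And>Y. Y \<in> V \<Longrightarrow> g' Y = inv (blinfun_apply (f'(g Y)))"
    "\<And>Y. Y \<in> V \<Longrightarrow> bij (blinfun_apply (f'(g Y)))"
    using inverse_function_theorem[OF W(1) _ cont W(2) inv, of y thesis] mpoly_map_has_derivative[OF y]
    unfolding app by metis
  have "\<exists>g'. (g has_derivative g') (at Y) \<and> (\<forall>v. jac y (g Y) (g' v) = v)" if "Y \<in> V" for Y
    using *(7,8,9)[OF that] by (intro exI[of _ "g' Y"]) (simp add: app bij_is_surj surj_f_inv_f)
  then show ?thesis using *(1-6) by blast
qed

lemma fibre_compact:
  assumes "mpoly_map y" "\<And>B. bounded {x. norm (y x) \<le> B}"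
  shows "compact {x. norm (y x) \<le> B}" "compact (y -` {Y})"
proof -
  have "closed {x. norm (y x) \<le> B}"
    by (intro closed_Collect_le continuous_on_norm mpoly_map_continuous assms continuous_on_const)
  then show "compact {x. norm (y x) \<le> B}" using assms by (simp add: compact_eq_bounded_closed)
  have "closed (y -` {Y})"
    using mpoly_map_continuous[OF assms(1), of UNIV] by (intro closed_vimage) auto
  moreover have "bounded (y -` {Y})" by (rule bounded_subset[OF assms(2)[of "norm Y"]]) auto
  ultimately show "compact (y -` {Y})" by (simp add: compact_eq_bounded_closed)
qed

text \<open>Properness makes the fibre compact, local injectivity of \<open>y\<close> makes it
  discrete.\<close>

lemma regular_fibre_finite:
  assumes "mpoly_map y" "\<And>B. bounded {x. norm (y x) \<le> B}" "regular_value y Y"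
  shows "finite (y -` {Y})"
proof -
  have "\<exists>U. open U \<and> x \<in> U \<and> inj_on y U" if x: "x \<in> y -` {Y}" for x
  proof -
    have reg: "\<And>v. jac y x v = 0 \<Longrightarrow> v = 0" using assms(3) x by (auto simp: regular_value_def)
    obtain U V g where "open U" "x \<in> U" "homeomorphism U V y g"
      using local_inverse[of y x UNIV, OF assms(1) reg open_UNIV UNIV_I] by blast
    then show ?thesis by (metis homeomorphism_def inj_on_inverseI)
  qed
  then obtain U where U: "\<And>x. x \<in> y -` {Y} \<Longrightarrow> open (U x) \<and> x \<in> U x \<and> inj_on y (U x)" by metis
  obtain C where C: "C \<subseteq> y -` {Y}" "finite C" "y -` {Y} \<subseteq> (\<Union>c\<in>C. U c)"
    using compactE_image[OF fibre_compact(2)[OF assms(1,2)], of "y -` {Y}" U Y] U by blast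
  have "y -` {Y} \<subseteq> C"
  proof
    fix x assume x: "x \<in> y -` {Y}"
    then obtain c where c: "c \<in> C" "x \<in> U c" using C by auto
    then have "y x = y c" "c \<in> U c" "inj_on y (U c)" using C U x by auto
    then show "x \<in> C" using c by (metis inj_onD)
  qed
  then show ?thesis using C finite_subset by blast
qed

lemma finite_separated:
  fixes S :: "'a::metric_space set"
  assumes "finite S" shows "\<exists>d>0. \<forall>x\<in>S. \<forall>z\<in>S. x \<noteq> z \<longrightarrow> d \<le> dist x z"
proof -
  define D where "D = insert 1 ((\<lambda>(x, z). dist x z) ` (S \<times> S - Id))"
  have "finite D" unfolding D_def using assms by blast
  moreover have "d > 0" if "d \<in> D" for d using that by (auto simp: D_def)
  ultimately have D: "finite D" "D \<noteq> {}" "\<And>d. d \<in> D \<Longrightarrow> d > 0" by (auto simp: D_def)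
  have "Min D > 0" using D by (subst Min_gr_iff) blast+
  moreover have "Min D \<le> dist x z" if "x \<in> S" "z \<in> S" "x \<noteq> z" for x z
    using that D(1) by (intro Min_le) (force simp: D_def)+
  ultimately show ?thesis by blast
qed

text \<open>The local sections \<open>\<sigma> x\<close>, one for each point \<open>x\<close> of the
  central fibre, exhaust the nearby fibres: they stay distinct because their ranges are disjoint,
  and nothing is missed because \<open>y\<close> is proper.\<close>

lemma regular_fibre_sheets:
  fixes y :: "complex ^ 'n::finite \<Rightarrow> complex ^ 'n"
  assumes y: "mpoly_map y" and bdd: "\<And>B. bounded {x. norm (y x) \<le> B}" and reg: "regular_value y Y0"
  shows "\<exists>e \<sigma>. e > 0 \<and> (\<forall>Y\<in>ball Y0 e. bij_betw (\<lambda>x. \<sigma> x Y) (y -` {Y0}) (y -` {Y})) \<and>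
    (\<forall>x\<in>y -` {Y0}. \<sigma> x Y0 = x \<and> (\<exists>\<sigma>'. (\<sigma> x has_derivative \<sigma>') (at Y0) \<and> (\<forall>v. jac y x (\<sigma>' v) = v)))"
proof -
  have fin: "finite (y -` {Y0})" by (rule regular_fibre_finite[OF y bdd reg])
  obtain d where d: "d > 0" "\<And>x z. x \<in> y -` {Y0} \<Longrightarrow> z \<in> y -` {Y0} \<Longrightarrow> x \<noteq> z \<Longrightarrow> d \<le> dist x z"
    using finite_separated[OF fin] by blast
  define Q where "Q x U V g \<longleftrightarrow> open U \<and> U \<subseteq> ball x (d/2) \<and> x \<in> U \<and> open V \<and> y x \<in> V \<and> homeomorphism U V y g \<and>
    (\<forall>Y\<in>V. \<exists>g'. (g has_derivative g') (at Y) \<and> (\<forall>v. jac y (g Y) (g' v) = v))" for x U V g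
  have "\<exists>U V g. Q x U V g" if x: "x \<in> y -` {Y0}" for x
  proof -
    have inj: "\<And>v. jac y x v = 0 \<Longrightarrow> v = 0" using reg x by (auto simp: regular_value_def)
    have "x \<in> ball x (d/2)" using d by simp
    from local_inverse[OF y inj open_ball this] show ?thesis unfolding Q_def .
  qed
  then have "\<forall>x\<in>y -` {Y0}. \<exists>U V g. Q x U V g" by blast
  from bchoice[OF this] obtain U where "\<forall>x\<in>y -` {Y0}. \<exists>V g. Q x (U x) V g" ..
  from bchoice[OF this] obtain V where "\<forall>x\<in>y -` {Y0}. \<exists>g. Q x (U x) (V x) g" ..
  from bchoice[OF this] obtain g where "\<forall>x\<in>y -` {Y0}. Q x (U x) (V x) (g x)" ..
  then have UVg: "\<And>x. x \<in> y -` {Y0} \<Longrightarrow> open (U x)"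
    "\<And>x. x \<in> y -` {Y0} \<Longrightarrow> U x \<subseteq> ball x (d/2)" "\<And>x. x \<in> y -` {Y0} \<Longrightarrow> x \<in> U x"
    "\<And>x. x \<in> y -` {Y0} \<Longrightarrow> open (V x)" "\<And>x. x \<in> y -` {Y0} \<Longrightarrow> y x \<in> V x"
    "\<And>x. x \<in> y -` {Y0} \<Longrightarrow> homeomorphism (U x) (V x) y (g x)"
    "\<And>x Y. x \<in> y -` {Y0} \<Longrightarrow> Y \<in> V x \<Longrightarrow> \<exists>g'. (g x has_derivative g') (at Y) \<and> (\<forall>v. jac y (g x Y) (g' v) = v)"
    unfolding Q_def by blast+
  \<comment> \<open>All points outside the chosen neighbourhoods that could map to within distance 1
    of \<open>Y0\<close>, which is why \<open>e \<le> 1\<close> is imposed below. The image of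
    \<open>K\<close> is compact and misses \<open>Y0\<close>, so fibres close to \<open>Y0\<close>
    have no point in \<open>K\<close>.\<close>
  define K where "K = {x. norm (y x) \<le> norm Y0 + 1} - (\<Union>x\<in>y -` {Y0}. U x)"
  have "compact K" unfolding K_def
    by (intro compact_diff fibre_compact(1)[OF y bdd] open_UN ballI UVg)
  then have "closed (y ` K)"
    by (intro compact_imp_closed compact_continuous_image mpoly_map_continuous y)
  then have "open ((\<Inter>x\<in>y -` {Y0}. V x) - y ` K)"
    using fin UVg(4) by (intro open_Diff open_INT) auto
  moreover have "Y0 \<in> (\<Inter>x\<in>y -` {Y0}. V x) - y ` K"
    using UVg(3,5) by (auto simp: K_def)
  ultimately obtain e0 where e0: "e0 > 0" "ball Y0 e0 \<subseteq> (\<Inter>x\<in>y -` {Y0}. V x) - y ` K"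
    by (rule openE)
  define e where "e = min e0 1"
  have e: "e > 0" "ball Y0 e \<subseteq> (\<Inter>x\<in>y -` {Y0}. V x) - y ` K" "e \<le> 1"
    using e0 subset_ball[of e e0 Y0] by (simp_all add: e_def)
  have "bij_betw (\<lambda>x. g x Y) (y -` {Y0}) (y -` {Y})" if Y: "Y \<in> ball Y0 e" for Y
  proof -
    have gU: "g x Y \<in> U x" "y (g x Y) = Y" if "x \<in> y -` {Y0}" for x
    proof -
      have "Y \<in> V x" using Y e that by auto
      with UVg(6)[OF that] show "g x Y \<in> U x" "y (g x Y) = Y"
        by (auto simp: homeomorphism_def)
    qed
    have "inj_on (\<lambda>x. g x Y) (y -` {Y0})"
    proof (rule inj_onI, rule ccontr)
      fix x z assume xz: "x \<in> y -` {Y0}" "z \<in> y -` {Y0}" "g x Y = g z Y" "x \<noteq> z"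
      have "g x Y \<in> ball x (d/2)" "g x Y \<in> ball z (d/2)" using gU UVg(2) xz by (metis subsetD)+
      then have "dist x z < d" by (meson dist_triangle_half_l mem_ball)
      with d(2)[OF xz(1,2,4)] show False by simp
    qed
    moreover have "(\<lambda>x. g x Y) ` (y -` {Y0}) = y -` {Y}"
    proof (intro equalityI subsetI)
      fix z assume "z \<in> y -` {Y}"
      then have z: "y z = Y" by simp
      have "norm Y \<le> norm Y0 + 1" using Y e(3) norm_triangle_ineq2[of Y Y0] by (simp add: dist_norm norm_minus_commute)
      moreover have "z \<notin> K" using e(2) Y z by auto
      ultimately obtain x where x: "x \<in> y -` {Y0}" "z \<in> U x" using z by (auto simp: K_def)
      then have "z = g x Y" using UVg(6)[OF x(1)] z by (auto simp: homeomorphism_def)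
      then show "z \<in> (\<lambda>x. g x Y) ` (y -` {Y0})" using x by auto
    qed (use gU in auto)
    ultimately show ?thesis by (simp add: bij_betw_def)
  qed
  moreover have g0: "g x Y0 = x" if "x \<in> y -` {Y0}" for x
    using UVg(3,6)[OF that] that by (auto simp: homeomorphism_def)
  moreover have "\<exists>\<sigma>'. (g x has_derivative \<sigma>') (at Y0) \<and> (\<forall>v. jac y x (\<sigma>' v) = v)"
    if x: "x \<in> y -` {Y0}" for x
  proof -
    have "Y0 \<in> V x" using UVg(5)[OF x] x by simp
    from UVg(7)[OF x this] show ?thesis by (simp add: g0[OF x])
  qed
  ultimately show ?thesis using e(1) by (intro exI[of _ e] exI[of _ g]) blast
qed

lemma regular_fibre_card:
  assumes "mpoly_map y" "\<And>B. bounded {x. norm (y x) \<le> B}" "regular_value y Y0"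
  shows "\<forall>\<^sub>F Y in nhds Y0. card (y -` {Y}) = card (y -` {Y0})"
proof -
  obtain e \<sigma> where e: "e > 0" "\<And>Y. Y \<in> ball Y0 e \<Longrightarrow> bij_betw (\<lambda>x. \<sigma> x Y) (y -` {Y0}) (y -` {Y})"
    using regular_fibre_sheets[OF assms] by metis
  then have "\<forall>\<^sub>F Y in nhds Y0. Y \<in> ball Y0 e" by (intro eventually_nhds_in_open) auto
  then show ?thesis by eventually_elim (metis bij_betw_same_card e(2))
qed

lemma tr_differentiable:
  fixes y :: "complex ^ 'n::finite \<Rightarrow> complex ^ 'n"
  assumes y: "mpoly_map y" and bdd: "\<And>B. bounded {x. norm (y x) \<le> B}" and reg: "regular_value y Y0"
    and w: "mpoly w"
  shows "isCont (tr y w) Y0"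
    and "(\<And>x. x \<in> y -` {Y0} \<Longrightarrow> jac y x (\<xi> x) = v) \<Longrightarrow>
      ((\<lambda>t. tr y w (Y0 + t *s v)) has_field_derivative (\<Sum>x\<in>y -` {Y0}. \<Sum>k\<in>UNIV. partial k w x * \<xi> x $ k)) (at 0)"
proof -
  obtain e \<sigma> where e: "e > 0" "\<And>Y. Y \<in> ball Y0 e \<Longrightarrow> bij_betw (\<lambda>x. \<sigma> x Y) (y -` {Y0}) (y -` {Y})"
    and \<sigma>0: "\<And>x. x \<in> y -` {Y0} \<Longrightarrow> \<sigma> x Y0 = x"
    and \<sigma>': "\<And>x. x \<in> y -` {Y0} \<Longrightarrow> \<exists>\<sigma>'. (\<sigma> x has_derivative \<sigma>') (at Y0) \<and> (\<forall>v. jac y x (\<sigma>' v) = v)"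
    using regular_fibre_sheets[OF y bdd reg] by blast
  have ev: "\<forall>\<^sub>F Y in nhds Y0. tr y w Y = (\<Sum>x\<in>y -` {Y0}. w (\<sigma> x Y))"
  proof -
    have "\<forall>\<^sub>F Y in nhds Y0. Y \<in> ball Y0 e" using e by (intro eventually_nhds_in_open) auto
    then show ?thesis
      by eventually_elim (unfold tr_def, rule sum.reindex_bij_betw[symmetric], rule e(2))
  qed
  have "isCont (\<lambda>Y. \<Sum>x\<in>y -` {Y0}. w (\<sigma> x Y)) Y0"
  proof (intro continuous_sum)
    fix x assume "x \<in> y -` {Y0}"
    then have "isCont (\<sigma> x) Y0" using \<sigma>' has_derivative_continuous by blast
    moreover have "isCont w (\<sigma> x Y0)" using mpoly_continuous[OF w, of UNIV] by (simp add: continuous_on_eq_continuous_at)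
    ultimately show "isCont (\<lambda>Y. w (\<sigma> x Y)) Y0" by (rule isCont_o2)
  qed
  then show "isCont (tr y w) Y0" using isCont_cong[OF ev] by simp
  assume \<xi>: "\<And>x. x \<in> y -` {Y0} \<Longrightarrow> jac y x (\<xi> x) = v"
  have D: "((\<lambda>t. Y0 + t *s v) has_derivative (\<lambda>t. t *s v)) (at (0::complex))"
    by (rule has_derivative_vec_lambda) (auto intro!: derivative_eq_intros)
  have "((\<lambda>t. w (\<sigma> x (Y0 + t *s v))) has_field_derivative (\<Sum>k\<in>UNIV. partial k w x * \<xi> x $ k)) (at 0)"
    if x: "x \<in> y -` {Y0}" for x
  proof -
    obtain s' where s': "(\<sigma> x has_derivative s') (at Y0)" "\<And>v. jac y x (s' v) = v" using \<sigma>'[OF x] by blast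
    have inj: "u = u'" if "jac y x u = jac y x u'" for u u'
    proof -
      have "jac y x (u - u') = 0" by (simp only: linear_diff[OF jac_linear] that diff_self)
      then have "u - u' = 0" using reg x unfolding regular_value_def by blast
      then show ?thesis by simp
    qed
    \<comment> \<open>The inverse function theorem yields a real derivative only. It is complex
      linear along \<open>v\<close> because \<open>jac y x\<close> is injective and sends both sides
      to \<open>t *s v\<close>.\<close>
    have eq: "s' (t *s v) = t *s \<xi> x" for t
      by (rule inj) (simp add: s' jac_scale \<xi>[OF x])
    have "((\<lambda>t. \<sigma> x (Y0 + t *s v)) has_derivative (\<lambda>t. s' (t *s v))) (at 0)"
      by (rule has_derivative_compose[OF D]) (simp add: s')
    then have "((\<lambda>t. w (\<sigma> x (Y0 + t *s v))) has_derivative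
       (\<lambda>t. \<Sum>k\<in>UNIV. partial k w (\<sigma> x (Y0 + 0 *s v)) * s' (t *s v) $ k)) (at 0)"
      by (rule has_derivative_compose[OF _ mpoly_has_derivative[OF w]])
    also have "(\<lambda>t. \<Sum>k\<in>UNIV. partial k w (\<sigma> x (Y0 + 0 *s v)) * s' (t *s v) $ k)
       = (*) (\<Sum>k\<in>UNIV. partial k w x * \<xi> x $ k)"
      by (auto simp: eq \<sigma>0[OF x] sum_distrib_right sum_distrib_left mult_ac)
    finally show ?thesis by (simp add: has_field_derivative_def)
  qed
  then have D2: "((\<lambda>t. \<Sum>x\<in>y -` {Y0}. w (\<sigma> x (Y0 + t *s v))) has_field_derivative
      (\<Sum>x\<in>y -` {Y0}. \<Sum>k\<in>UNIV. partial k w x * \<xi> x $ k)) (at 0)"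
    by (rule DERIV_sum)
  have evt: "\<forall>\<^sub>F t in nhds 0. tr y w (Y0 + t *s v) = (\<Sum>x\<in>y -` {Y0}. w (\<sigma> x (Y0 + t *s v)))"
  proof -
    have "isCont (\<lambda>t. Y0 + t *s v) 0" using has_derivative_continuous[OF D] .
    then have "filterlim (\<lambda>t. Y0 + t *s v) (nhds Y0) (nhds 0)"
      by (simp add: isCont_def tendsto_nhds_iff)
    then show ?thesis using ev by (rule filterlim_iff[THEN iffD1, rule_format])
  qed
  show "((\<lambda>t. tr y w (Y0 + t *s v)) has_field_derivative
      (\<Sum>x\<in>y -` {Y0}. \<Sum>k\<in>UNIV. partial k w x * \<xi> x $ k)) (at 0)"
    using D2 DERIV_cong_ev[OF refl evt refl] by simp
qed

section \<open>Power sums\<close>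

lemma sum_poly_eq_power_sums:
  fixes P :: "complex poly"
  shows "(\<Sum>a\<in>A. poly P (f a)) = (\<Sum>k\<le>degree P. coeff P k * (\<Sum>a\<in>A. f a ^ k))"
  unfolding poly_altdef sum_distrib_left by (rule sum.swap)

text \<open>A polynomial that vanishes at 0 and at all values of \<open>f\<close> other than
  \<open>f x\<close> sums over \<open>A\<close> to a non-zero multiple of its value at
  \<open>f x\<close>. The root at 0 removes the power sum of order 0, which counts \<open>A\<close>;
  the degree stays within \<open>card A\<close> because \<open>f x\<close> is left out of the
  roots.\<close>

lemma power_sums_zero:
  fixes f :: "'a \<Rightarrow> complex"
  assumes A: "finite A" and ps: "\<And>k. k \<in> {1..card A} \<Longrightarrow> (\<Sum>a\<in>A. f a ^ k) = 0" and x: "x \<in> A"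
  shows "f x = 0"
proof (rule ccontr)
  assume fx: "f x \<noteq> 0"
  define V where "V = f ` A - {f x, 0}"
  define P where "P = [:0, 1:] * (\<Prod>v\<in>V. [:- v, 1:])"
  have V: "finite V" using A by (simp add: V_def)
  have "card V \<le> card (f ` A - {f x})" using A by (intro card_mono) (auto simp: V_def)
  also have "\<dots> = card (f ` A) - 1" using A x by (simp add: card_Diff_singleton)
  finally have cV: "Suc (card V) \<le> card A"
    using card_image_le[OF A, of f] A x by (metis Suc_leI card_gt_0_iff diff_Suc_1 empty_iff le_trans
        less_imp_diff_less linorder_not_le not_less_eq_eq Suc_pred diff_le_mono image_is_empty finite_imageI)
  have "degree P \<le> degree [:0, 1::complex:] + degree (\<Prod>v\<in>V. [:- v, 1:])"
    unfolding P_def by (rule degree_mult_le)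
  also have "degree (\<Prod>v\<in>V. [:- v, 1:]) \<le> (\<Sum>v\<in>V. degree [:- v, 1:])"
    using degree_prod_sum_le[OF V, of "\<lambda>v. [:- v, 1:]"] by (simp add: o_def)
  finally have deg: "degree P \<le> card A" using cV by simp
  have c0: "coeff P 0 = 0" by (simp add: P_def)
  have "(\<Sum>a\<in>A. poly P (f a)) = 0"
    unfolding sum_poly_eq_power_sums
  proof (intro sum.neutral ballI)
    fix k assume "k \<in> {..degree P}"
    then show "coeff P k * (\<Sum>a\<in>A. f a ^ k) = 0"
      using c0 ps[of k] deg by (cases "k = 0") auto
  qed
  moreover have "(\<Sum>a\<in>A. poly P (f a)) = (\<Sum>a\<in>{a\<in>A. f a = f x}. poly P (f x))"
  proof (rule sum.mono_neutral_cong_right)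
    show "\<forall>a\<in>A - {a \<in> A. f a = f x}. poly P (f a) = 0"
      using V by (auto simp: P_def poly_prod V_def prod_zero_iff)
  qed (use A in auto)
  moreover have "poly P (f x) \<noteq> 0" using V fx by (auto simp: P_def poly_prod V_def prod_zero_iff)
  moreover have "card {a\<in>A. f a = f x} \<noteq> 0" using A x by auto
  ultimately show False by simp
qed

text \<open>A polynomial that vanishes at all values except \<open>z\<close> would sum to zero over
  \<open>A\<close>, but over \<open>B\<close> to its value at \<open>z\<close> times the
  multiplicity of \<open>z\<close>. The orders include 0, so every polynomial may serve as a
  test.\<close>

lemma power_sums_eq_image:
  fixes f :: "'a \<Rightarrow> complex" and g :: "'b \<Rightarrow> complex"
  assumes A: "finite A" and B: "finite B" and ps: "\<And>k. (\<Sum>a\<in>A. f a ^ k) = (\<Sum>b\<in>B. g b ^ k)"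
  shows "g ` B \<subseteq> f ` A"
proof (rule subsetI, rule ccontr)
  fix z assume z: "z \<in> g ` B" "z \<notin> f ` A"
  define V where "V = f ` A \<union> g ` B - {z}"
  define P where "P = (\<Prod>v\<in>V. [:- v, 1:])"
  have V: "finite V" using A B by (simp add: V_def)
  have "(\<Sum>a\<in>A. poly P (f a)) = (\<Sum>b\<in>B. poly P (g b))"
    unfolding sum_poly_eq_power_sums by (simp add: ps)
  moreover have "(\<Sum>a\<in>A. poly P (f a)) = 0"
    using V z by (intro sum.neutral) (force simp: P_def poly_prod V_def prod_zero_iff)
  moreover have "(\<Sum>b\<in>B. poly P (g b)) = (\<Sum>b\<in>{b\<in>B. g b = z}. poly P z)"
  proof (rule sum.mono_neutral_cong_right)
    show "\<forall>b\<in>B - {b \<in> B. g b = z}. poly P (g b) = 0"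
      using V by (auto simp: P_def poly_prod V_def prod_zero_iff)
  qed (use B in auto)
  moreover have "poly P z \<noteq> 0" using V by (auto simp: P_def poly_prod V_def prod_zero_iff)
  moreover have "card {b\<in>B. g b = z} \<noteq> 0" using B z by auto
  ultimately show False by simp
qed

lemma bounded_family_convergent_subseq:
  fixes h :: "nat \<Rightarrow> nat \<Rightarrow> complex"
  assumes "\<And>m i. i < N \<Longrightarrow> norm (h m i) \<le> B"
  shows "\<exists>r. strict_mono r \<and> (\<forall>i<N. convergent (\<lambda>m. h (r m) i))"
  using assms
proof (induction N)
  case 0
  show ?case by (rule exI[of _ id]) (auto simp: strict_mono_def)
next
  case (Suc N)
  then obtain r where r: "strict_mono r" "\<And>i. i < N \<Longrightarrow> convergent (\<lambda>m. h (r m) i)" by auto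
  have "bounded (range (\<lambda>m. h (r m) N))"
    using Suc.prems by (intro boundedI[of _ B]) auto
  then obtain l s where s: "strict_mono s" "((\<lambda>m. h (r m) N) \<circ> s) \<longlonglongrightarrow> l"
    using bounded_imp_convergent_subsequence by blast
  have "convergent (\<lambda>m. h ((r \<circ> s) m) i)" if "i < Suc N" for i
  proof (cases "i = N")
    case True
    then show ?thesis using s(2) by (auto simp: convergent_def o_def)
  next
    case False
    then have "convergent (\<lambda>m. h (r m) i)" using r that by simp
    from convergent_subseq_convergent[OF this s(1)] show ?thesis by (simp add: o_def)
  qed
  then show ?case using r s by (intro exI[of _ "r \<circ> s"] conjI strict_mono_o) simp_all
qed

text \<open>By compactness: tuples of maximum norm 1 whose power sums tend to zero would accumulate
  at a tuple with vanishing power sums, which is zero by \<open>power_sums_zero\<close>, although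
  the maximum norm stays 1.\<close>

lemma power_sums_lower_bound:
  "\<exists>c>0. \<forall>f :: nat \<Rightarrow> complex. (\<forall>i<N. norm (f i) \<le> 1) \<longrightarrow> (\<exists>i<N. norm (f i) = 1) \<longrightarrow>
     (\<exists>k\<in>{1..N}. c \<le> norm (\<Sum>i<N. f i ^ k))"
proof (rule ccontr)
  assume *: "\<not> ?thesis"
  have "\<exists>f :: nat \<Rightarrow> complex. (\<forall>i<N. norm (f i) \<le> 1) \<and> (\<exists>i<N. norm (f i) = 1) \<and>
     (\<forall>k\<in>{1..N}. norm (\<Sum>i<N. f i ^ k) < inverse (real (Suc m)))" for m
    using * by (metis inverse_positive_iff_positive linorder_not_le of_nat_0_less_iff zero_less_Suc)
  then obtain h :: "nat \<Rightarrow> nat \<Rightarrow> complex" where h: "\<And>m i. i < N \<Longrightarrow> norm (h m i) \<le> 1"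
    "\<And>m. \<exists>i<N. norm (h m i) = 1" "\<And>m k. k \<in> {1..N} \<Longrightarrow> norm (\<Sum>i<N. h m i ^ k) < inverse (real (Suc m))"
    by metis
  obtain r where r: "strict_mono r" "\<And>i. i < N \<Longrightarrow> convergent (\<lambda>m. h (r m) i)"
    using bounded_family_convergent_subseq[of N h 1] h(1) by blast
  define g where "g i = lim (\<lambda>m. h (r m) i)" for i
  have g: "(\<lambda>m. h (r m) i) \<longlonglongrightarrow> g i" if "i < N" for i
    using r(2)[OF that] by (simp add: g_def convergent_LIMSEQ_iff)
  have "(\<Sum>i<N. g i ^ k) = 0" if k: "k \<in> {1..N}" for k
  proof -
    have "(\<lambda>m. \<Sum>i<N. h (r m) i ^ k) \<longlonglongrightarrow> (\<Sum>i<N. g i ^ k)"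
      by (intro tendsto_sum tendsto_power g) simp
    moreover have "(\<lambda>m. \<Sum>i<N. h (r m) i ^ k) \<longlonglongrightarrow> 0"
    proof (rule Lim_null_comparison[OF always_eventually], rule allI)
      show "norm (\<Sum>i<N. h (r m) i ^ k) \<le> inverse (real (Suc (r m)))" for m
        using h(3)[OF k, of "r m"] by simp
      show "(\<lambda>m. inverse (real (Suc (r m)))) \<longlonglongrightarrow> 0"
        using LIMSEQ_subseq_LIMSEQ[OF LIMSEQ_inverse_real_of_nat r(1)] by (simp add: o_def)
    qed
    ultimately show ?thesis by (rule LIMSEQ_unique)
  qed
  then have g0: "g i = 0" if "i < N" for i using power_sums_zero[of "{..<N}" g i] that by simp
  have "(\<lambda>m. \<Sum>i<N. norm (h (r m) i)) \<longlonglongrightarrow> (\<Sum>i<N. norm (g i))"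
    by (intro tendsto_sum tendsto_norm g) simp
  moreover have "(\<Sum>i<N. norm (h (r m) i)) \<ge> 1" for m
  proof -
    obtain i where "i < N" "norm (h (r m) i) = 1" using h(2) by blast
    then show ?thesis using member_le_sum[of i "{..<N}" "\<lambda>i. norm (h (r m) i)"] by simp
  qed
  ultimately have "(\<Sum>i<N. norm (g i)) \<ge> 1" by (intro LIMSEQ_le_const) auto
  then show False using g0 by simp
qed

text \<open>Division by the largest modulus reduces the claim to
  \<open>power_sums_lower_bound\<close>. A bound for power sums over a fibre, which are single
  valued, thereby becomes a bound for each branch.\<close>

lemma power_sums_bound:
  "\<exists>C>0. \<forall>(A :: 'a set) (f :: 'a \<Rightarrow> complex) \<mu>. finite A \<longrightarrow> card A = N \<longrightarrow> \<mu> \<ge> 0 \<longrightarrow>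
     (\<forall>k\<in>{1..N}. norm (\<Sum>a\<in>A. f a ^ k) \<le> \<mu> ^ k) \<longrightarrow> (\<forall>a\<in>A. norm (f a) \<le> C * \<mu>)"
proof -
  obtain c0 where c0: "c0 > 0" "\<And>f :: nat \<Rightarrow> complex. (\<And>i. i < N \<Longrightarrow> norm (f i) \<le> 1) \<Longrightarrow> (\<exists>i<N. norm (f i) = 1) \<Longrightarrow>
     (\<exists>k\<in>{1..N}. c0 \<le> norm (\<Sum>i<N. f i ^ k))"
    using power_sums_lower_bound[of N] by blast
  \<comment> \<open>The cap 1 gives \<open>c ^ k \<le> c\<close>, so
    \<open>c * m ^ k \<le> \<mu> ^ k\<close> implies \<open>c * m \<le> \<mu>\<close> whichever
    order \<open>k\<close> is supplied.\<close>
  define c where "c = min c0 1"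
  have c: "c > 0" "c \<le> 1" "c \<le> c0" using c0 by (auto simp: c_def)
  have "norm (f a) \<le> inverse c * \<mu>"
    if A: "finite (A :: 'a set)" "card A = N" and \<mu>: "\<mu> \<ge> 0"
      and ps: "\<And>k. k \<in> {1..N} \<Longrightarrow> norm (\<Sum>a\<in>A. f a ^ k) \<le> \<mu> ^ k" and a: "a \<in> A"
    for A and f :: "'a \<Rightarrow> complex" and \<mu> a
  proof -
    define m where "m = Max ((\<lambda>a. norm (f a)) ` A)"
    have m: "\<And>b. b \<in> A \<Longrightarrow> norm (f b) \<le> m" using A by (auto simp: m_def)
    have "m \<in> (\<lambda>a. norm (f a)) ` A" unfolding m_def using A a by (intro Max_in) auto
    then obtain b where b: "b \<in> A" "norm (f b) = m" by auto
    have "c * m \<le> \<mu>"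
    proof (cases "m = 0")
      case False
      then have m0: "m > 0" using b norm_ge_zero by (metis less_eq_real_def)
      obtain e where e: "bij_betw e {..<N} A"
        using ex_bij_betw_nat_finite[OF A(1)] A(2) by (auto simp: atLeast0LessThan)
      define g where "g i = f (e i) / of_real m" for i
      have "norm (g i) \<le> 1" if "i < N" for i
        using m[of "e i"] e that m0 by (auto simp: g_def norm_divide bij_betw_def)
      moreover have "\<exists>i<N. norm (g i) = 1"
      proof -
        obtain i where "i < N" "e i = b" using e b by (auto simp: bij_betw_def image_iff)
        then show ?thesis using b m0 by (auto simp: g_def norm_divide)
      qed
      ultimately obtain k where k: "k \<in> {1..N}" "c0 \<le> norm (\<Sum>i<N. g i ^ k)" using c0(2) by blast
      have "(\<Sum>i<N. g i ^ k) = (\<Sum>i<N. f (e i) ^ k) / of_real m ^ k"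
        by (simp add: g_def power_divide sum_divide_distrib)
      also have "(\<Sum>i<N. f (e i) ^ k) = (\<Sum>a\<in>A. f a ^ k)" by (rule sum.reindex_bij_betw[OF e])
      finally have "c \<le> norm (\<Sum>a\<in>A. f a ^ k) / m ^ k"
        using k(2) m0 c(3) by (simp add: norm_divide norm_power)
      then have "c * m ^ k \<le> norm (\<Sum>a\<in>A. f a ^ k)" using m0 by (simp add: pos_le_divide_eq)
      also have "\<dots> \<le> \<mu> ^ k" by (rule ps[OF k(1)])
      finally have *: "c * m ^ k \<le> \<mu> ^ k" .
      have "c ^ k \<le> c" using c k(1) power_decreasing[of 1 k c] by auto
      then have "(c * m) ^ k \<le> \<mu> ^ k"
        using order_trans[OF mult_right_mono[of "c ^ k" c "m ^ k"] *] m0 by (simp add: power_mult_distrib)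
      then show ?thesis using power_mono_iff[of "c * m" \<mu> k] k(1) \<mu> c m0 by auto
    qed (use \<mu> in simp)
    then have "m \<le> inverse c * \<mu>" using c(1) by (simp add: field_simps)
    then show ?thesis using m[OF a] by simp
  qed
  then show ?thesis using c(1) by (intro exI[of _ "inverse c"]) auto
qed

section \<open>Branched covers and traces along lines\<close>

text \<open>Boundedness of sublevel sets is properness, and the zero set of \<open>\<Delta>\<close>
  on the target contains all critical values. The clause
  \<open>\<exists>x. \<Delta> (y x) \<noteq> 0\<close> excludes the zero polynomial and at the same
  time provides a good value with non-empty fibre.\<close>

definition proper_cover :: "(complex ^ 'n::finite \<Rightarrow> complex ^ 'n) \<Rightarrow> (complex ^ 'n \<Rightarrow> complex) \<Rightarrow> bool" where
  "proper_cover y \<Delta> \<longleftrightarrow> mpoly_map y \<and> (\<forall>B. bounded {x. norm (y x) \<le> B}) \<and> mpoly \<Delta> \<and>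
     (\<exists>x. \<Delta> (y x) \<noteq> 0) \<and> (\<forall>x v. \<Delta> (y x) \<noteq> 0 \<longrightarrow> jac y x v = 0 \<longrightarrow> v = 0)"

lemma proper_cover_regular: "proper_cover y \<Delta> \<Longrightarrow> \<Delta> Y \<noteq> 0 \<Longrightarrow> regular_value y Y"
  by (auto simp: proper_cover_def regular_value_def)

lemma line_zeros_finite:
  assumes "mpoly \<Delta>" "\<Delta> (Y + t0 *s v) \<noteq> 0"
  shows "finite {t. \<Delta> (Y + t *s v) = 0}"
proof -
  obtain q where q: "\<And>t. \<Delta> (Y + t *s v) = poly q t" using mpoly_line[OF assms(1)] by blast
  then have "q \<noteq> 0" using assms(2) by auto
  then show ?thesis using poly_roots_finite[of q] by (simp add: q)
qed

lemma connected_Compl_finite: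
  fixes D :: "complex set"
  assumes "finite D" "open S" "connected S"
  shows "connected (S - D)"
  using assms by (intro connected_open_diff_countable) (auto simp: countable_finite)

text \<open>The complex line through \<open>Y\<close> and \<open>Y'\<close> meets
  \<open>\<Delta> = 0\<close> in finitely many parameters. The plane minus a finite set is
  connected, so the locally constant cardinality is constant.\<close>

lemma proper_cover_card:
  assumes pc: "proper_cover y \<Delta>" and Y: "\<Delta> Y \<noteq> 0" "\<Delta> Y' \<noteq> 0"
  shows "card (y -` {Y}) = card (y -` {Y'})"
proof -
  define v where "v = Y' - Y"
  define D where "D = {t. \<Delta> (Y + t *s v) = 0}"
  have "finite D" unfolding D_def
    by (rule line_zeros_finite[of _ _ 0]) (use pc Y in \<open>auto simp: proper_cover_def\<close>)
  then have conn: "connected (UNIV - D)" by (intro connected_Compl_finite) auto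
  have "(\<lambda>t. card (y -` {Y + t *s v})) constant_on (UNIV - D)"
  proof (rule locally_constant_imp_constant[OF conn])
    fix a assume a: "a \<in> UNIV - D"
    have "regular_value y (Y + a *s v)" using proper_cover_regular[OF pc] a by (auto simp: D_def)
    then have ev: "\<forall>\<^sub>F Z in nhds (Y + a *s v). card (y -` {Z}) = card (y -` {Y + a *s v})"
      using pc by (intro regular_fibre_card) (auto simp: proper_cover_def)
    then obtain W where W: "open W" "Y + a *s v \<in> W" "\<And>Z. Z \<in> W \<Longrightarrow> card (y -` {Z}) = card (y -` {Y + a *s v})"
      unfolding eventually_nhds by blast
    have "open ((\<lambda>t. Y + t *s v) -` W)" by (rule open_vimage[OF W(1) continuous_on_line])
    then have "openin (top_of_set (UNIV - D)) ((UNIV - D) \<inter> (\<lambda>t. Y + t *s v) -` W)"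
      by (rule openin_open_Int)
    then show "\<exists>T. openin (top_of_set (UNIV - D)) T \<and> a \<in> T \<and>
       (\<forall>x\<in>T. card (y -` {Y + x *s v}) = card (y -` {Y + a *s v}))"
    proof (intro exI conjI ballI)
      show "a \<in> (UNIV - D) \<inter> (\<lambda>t. Y + t *s v) -` W" using a W(2) by blast
      show "card (y -` {Y + x *s v}) = card (y -` {Y + a *s v})"
        if "x \<in> (UNIV - D) \<inter> (\<lambda>t. Y + t *s v) -` W" for x
        by (rule W(3)) (use that in blast)
    qed
  qed
  then obtain c where c: "\<And>t. t \<in> UNIV - D \<Longrightarrow> card (y -` {Y + t *s v}) = c" by (auto simp: constant_on_def)
  have "0 \<in> UNIV - D" "1 \<in> UNIV - D" using Y by (auto simp: D_def v_def)
  from c[OF this(1)] c[OF this(2)] show ?thesis by (simp add: v_def)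
qed

lemma mpoly_bounded:
  assumes "mpoly w" "bounded S"
  shows "\<exists>M>0. \<forall>x\<in>S. norm (w x) \<le> M"
proof -
  have "compact (closure S)" using assms(2) by simp
  then have "compact (w ` closure S)"
    by (intro compact_continuous_image mpoly_continuous assms)
  then have "bounded (w ` S)" using closure_subset by (blast intro: bounded_subset compact_imp_bounded)
  then show ?thesis unfolding bounded_pos by auto
qed

lemma proper_cover_tr_bounded:
  assumes pc: "proper_cover y \<Delta>" and w: "mpoly w"
  shows "\<exists>M. \<forall>Y. norm Y \<le> B \<longrightarrow> \<Delta> Y \<noteq> 0 \<longrightarrow> norm (tr y w Y) \<le> M"
proof -
  obtain x0 where x0: "\<Delta> (y x0) \<noteq> 0" using pc by (auto simp: proper_cover_def)
  have "bounded {x. norm (y x) \<le> B}" using pc by (auto simp: proper_cover_def)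
  then obtain M where M: "M > 0" "\<And>x. norm (y x) \<le> B \<Longrightarrow> norm (w x) \<le> M"
    using mpoly_bounded[OF w] by blast
  have "norm (tr y w Y) \<le> card (y -` {y x0}) * M" if Y: "norm Y \<le> B" "\<Delta> Y \<noteq> 0" for Y
  proof -
    have "norm (tr y w Y) \<le> of_nat (card (y -` {Y})) * M"
      unfolding tr_def by (rule sum_norm_bound) (use M Y in auto)
    then show ?thesis using proper_cover_card[OF pc Y(2) x0] by simp
  qed
  then show ?thesis by blast
qed

lemma tr_line_holomorphic:
  assumes pc: "proper_cover y \<Delta>" and w: "mpoly w"
  shows "(\<lambda>t. tr y w (Y + t *s v)) holomorphic_on (UNIV - {t. \<Delta> (Y + t *s v) = 0})"
proof (unfold holomorphic_on_def, rule ballI)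
  fix t assume "t \<in> UNIV - {t. \<Delta> (Y + t *s v) = 0}"
  then have reg: "regular_value y (Y + t *s v)" using proper_cover_regular[OF pc] by auto
  have inv: "\<exists>\<xi>. jac y x \<xi> = v" if "x \<in> y -` {Y + t *s v}" for x
  proof -
    have "\<And>v. jac y x v = 0 \<Longrightarrow> v = 0" using reg that by (auto simp: regular_value_def)
    then have "inj (jac y x)" using linear_injective_0[OF jac_linear] by blast
    then have "surj (jac y x)" using linear_injective_imp_surjective[OF jac_linear] by blast
    then show ?thesis by (metis surjD)
  qed
  obtain \<xi> where "\<And>x. x \<in> y -` {Y + t *s v} \<Longrightarrow> jac y x (\<xi> x) = v" using inv by metis
  from tr_differentiable(2)[OF _ _ reg w this] pc obtain d where
    "((\<lambda>s. tr y w (Y + t *s v + s *s v)) has_field_derivative d) (at 0)"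
    by (auto simp: proper_cover_def)
  then have "((\<lambda>s. tr y w (Y + (t + s) *s v)) has_field_derivative d) (at 0)"
    by (simp add: vector_sadd_rdistrib add.assoc)
  then have "((\<lambda>t. tr y w (Y + t *s v)) has_field_derivative d) (at t)"
    using DERIV_at_within_shift[of "\<lambda>t. tr y w (Y + t *s v)" d t 0 UNIV] by (simp add: o_def vector_sadd_rdistrib add.assoc)
  then show "(\<lambda>t. tr y w (Y + t *s v)) field_differentiable at t within UNIV - {t. \<Delta> (Y + t *s v) = 0}"
    by (auto simp: field_differentiable_def intro: has_field_derivative_at_within)
qed

text \<open>Removable singularities: near the excluded parameters the trace is bounded, since nearby
  fibres stay in a bounded set and have a fixed number of points.\<close>

lemma tr_line_extends:
  assumes pc: "proper_cover y \<Delta>" and w: "mpoly w" and nz: "\<Delta> (Y + t0 *s v) \<noteq> 0"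
  shows "\<exists>h. h holomorphic_on UNIV \<and> (\<forall>t. \<Delta> (Y + t *s v) \<noteq> 0 \<longrightarrow> h t = tr y w (Y + t *s v))"
proof -
  define D where "D = {t. \<Delta> (Y + t *s v) = 0}"
  have fin: "finite D" unfolding D_def
    by (rule line_zeros_finite[of \<Delta> Y t0 v]) (use pc nz in \<open>auto simp: proper_cover_def\<close>)
  have "(\<lambda>t. tr y w (Y + t *s v)) \<in> O[at z](\<lambda>_. 1)" if "z \<in> D" for z
  proof -
    obtain M where M: "\<And>Z. norm Z \<le> norm (Y + z *s v) + 1 \<Longrightarrow> \<Delta> Z \<noteq> 0 \<Longrightarrow> norm (tr y w Z) \<le> M"
      using proper_cover_tr_bounded[OF pc w] by blast
    have "isCont (\<lambda>t. norm (Y + t *s v)) z"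
      using continuous_on_line[of UNIV Y v] by (intro continuous_norm) (simp add: continuous_on_eq_continuous_at)
    then have "\<forall>\<^sub>F t in at z. norm (Y + t *s v) < norm (Y + z *s v) + 1"
      unfolding isCont_def by (rule order_tendstoD) simp
    moreover have "\<forall>\<^sub>F t in at z. t \<notin> D"
      using islimpt_finite[OF fin, of z] by (simp add: islimpt_iff_eventually)
    ultimately have "\<forall>\<^sub>F t in at z. norm (tr y w (Y + t *s v)) \<le> M * norm (1 :: complex)"
      by eventually_elim (use M in \<open>auto simp: D_def\<close>)
    then show ?thesis by (rule bigoI)
  qed
  then obtain h where "h holomorphic_on UNIV" "\<And>z. z \<in> UNIV - D \<Longrightarrow> h z = tr y w (Y + z *s v)"
    using removable_singularities[OF fin, of UNIV "\<lambda>t. tr y w (Y + t *s v)"]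
      tr_line_holomorphic[OF pc w, of Y v] by (auto simp: D_def)
  then show ?thesis by (auto simp: D_def)
qed

lemma proper_cover_open: "proper_cover y \<Delta> \<Longrightarrow> open {Y. \<Delta> Y \<noteq> 0}"
  by (intro open_Collect_neq mpoly_continuous continuous_on_const) (auto simp: proper_cover_def)

text \<open>A circle about \<open>Y0\<close> in a suitable complex line avoids the discriminant, and
  so does a neighbourhood of it, on which the trace is uniformly continuous. The maximum principle
  on the parallel discs through \<open>Y\<close> and \<open>Y'\<close> carries the estimate to their
  centres. The Cauchy form expresses a continuous extension to \<open>Y0\<close> without naming its
  value.\<close>

lemma tr_uniformly_close:
  fixes y :: "complex ^ 'n::finite \<Rightarrow> complex ^ 'n"
  assumes pc: "proper_cover y \<Delta>" and w: "mpoly w" and \<epsilon>: "\<epsilon> > 0"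
  shows "\<exists>\<delta>>0. \<forall>Y\<in>ball Y0 \<delta>. \<forall>Y'\<in>ball Y0 \<delta>. \<Delta> Y \<noteq> 0 \<longrightarrow> \<Delta> Y' \<noteq> 0 \<longrightarrow> norm (tr y w Y - tr y w Y') \<le> \<epsilon>"
proof -
  obtain x0 where x0: "\<Delta> (y x0) \<noteq> 0" using pc by (auto simp: proper_cover_def)
  have \<Delta>: "mpoly \<Delta>" using pc by (auto simp: proper_cover_def)
  define v where "v = y x0 - Y0"
  have fin: "finite {t. \<Delta> (Y0 + t *s v) = 0}"
    by (rule line_zeros_finite[OF \<Delta>, of _ 1]) (use x0 in \<open>simp add: v_def\<close>)
  have "infinite {0<..<1::real}" by simp
  then obtain r where r: "r > 0" "r \<notin> norm ` {t. \<Delta> (Y0 + t *s v) = 0}"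
    using fin by (metis finite_imageI finite_subset greaterThanLessThan_iff subsetI)
  define C where "C = (\<lambda>t. Y0 + t *s v) ` sphere 0 r"
  have "compact C" unfolding C_def by (intro compact_continuous_image continuous_on_line compact_sphere)
  moreover have "C \<subseteq> {Y. \<Delta> Y \<noteq> 0}" using r by (auto simp: C_def)
  ultimately obtain e where e: "e > 0" "(\<Union>c\<in>C. cball c e) \<subseteq> {Y. \<Delta> Y \<noteq> 0}"
    using compact_subset_open_imp_cball_epsilon_subset[OF _ proper_cover_open[OF pc]] by blast
  define K where "K = {c + z |c z. c \<in> C \<and> z \<in> cball 0 e}"
  have K: "compact K" unfolding K_def by (rule compact_sums[OF \<open>compact C\<close> compact_cball])
  have K\<Delta>: "\<Delta> Z \<noteq> 0" if Z: "Z \<in> K" for Z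
  proof -
    obtain c z where "c \<in> C" "Z = c + z" "norm z \<le> e" using Z by (auto simp: K_def)
    then have "Z \<in> cball c e" by (simp add: dist_norm)
    then show ?thesis using e(2) \<open>c \<in> C\<close> by blast
  qed
  have "continuous_on K (tr y w)"
  proof (intro continuous_at_imp_continuous_on ballI)
    fix Z assume "Z \<in> K"
    then show "isCont (tr y w) Z"
      using proper_cover_regular[OF pc K\<Delta>] pc by (intro tr_differentiable(1) w) (auto simp: proper_cover_def)
  qed
  then have "uniformly_continuous_on K (tr y w)" using K by (rule compact_uniformly_continuous)
  then obtain d where d: "d > 0" "\<And>Z Z'. Z \<in> K \<Longrightarrow> Z' \<in> K \<Longrightarrow> dist Z' Z < d \<Longrightarrow> dist (tr y w Z') (tr y w Z) < \<epsilon>"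
    unfolding uniformly_continuous_on_def using \<epsilon> by meson
  define \<delta> where "\<delta> = min e (d/2)"
  have "norm (tr y w Y - tr y w Y') \<le> \<epsilon>"
    if Y: "Y \<in> ball Y0 \<delta>" "Y' \<in> ball Y0 \<delta>" "\<Delta> Y \<noteq> 0" "\<Delta> Y' \<noteq> 0" for Y Y'
  proof -
    obtain h where h: "h holomorphic_on UNIV" "\<And>t. \<Delta> (Y + t *s v) \<noteq> 0 \<Longrightarrow> h t = tr y w (Y + t *s v)"
      using tr_line_extends[OF pc w, of Y 0 v] Y(3) by auto
    obtain h' where h': "h' holomorphic_on UNIV" "\<And>t. \<Delta> (Y' + t *s v) \<noteq> 0 \<Longrightarrow> h' t = tr y w (Y' + t *s v)"
      using tr_line_extends[OF pc w, of Y' 0 v] Y(4) by auto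
    have mem: "Z + t *s v \<in> K" if "Z \<in> ball Y0 \<delta>" "norm t = r" for Z t
    proof -
      have "Z + t *s v = (Y0 + t *s v) + (Z - Y0)" by simp
      moreover have "Y0 + t *s v \<in> C" using that by (auto simp: C_def)
      moreover have "Z - Y0 \<in> cball 0 e" using that by (auto simp: \<delta>_def dist_norm norm_minus_commute)
      ultimately show ?thesis unfolding K_def by blast
    qed
    have "norm ((\<lambda>t. h t - h' t) 0) \<le> \<epsilon>"
    proof (rule maximum_modulus_frontier[of "\<lambda>t. h t - h' t" "ball 0 r"])
      show "(\<lambda>t. h t - h' t) holomorphic_on interior (ball 0 r)"
        using h(1) h'(1) by (intro holomorphic_on_diff) (auto intro: holomorphic_on_subset)
      show "continuous_on (closure (ball 0 r)) (\<lambda>t. h t - h' t)"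
        using h(1) h'(1) by (intro continuous_on_diff) (auto intro: holomorphic_on_imp_continuous_on holomorphic_on_subset)
      show "bounded (ball 0 r)" by simp
      show "0 \<in> ball (0::complex) r" using r by simp
      fix t :: complex assume "t \<in> frontier (ball 0 r)"
      then have t: "norm t = r" using r by simp
      have "dist (Y + t *s v) (Y' + t *s v) < d"
      proof -
        have "dist Y Y' < d" using Y by (auto simp: \<delta>_def intro: dist_triangle_half_r)
        then show ?thesis by (simp add: dist_norm)
      qed
      then have "dist (tr y w (Y + t *s v)) (tr y w (Y' + t *s v)) < \<epsilon>"
        using d(2) mem[OF Y(1) t] mem[OF Y(2) t] by blast
      moreover have "h t = tr y w (Y + t *s v)" "h' t = tr y w (Y' + t *s v)"
        using h(2) h'(2) K\<Delta> mem[OF Y(1) t] mem[OF Y(2) t] by auto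
      ultimately show "norm (h t - h' t) \<le> \<epsilon>" by (simp add: dist_norm)
    qed
    moreover have "h 0 = tr y w Y" "h' 0 = tr y w Y'" using h(2)[of 0] h'(2)[of 0] Y by auto
    ultimately show ?thesis by simp
  qed
  moreover have "\<delta> > 0" using e d by (simp add: \<delta>_def)
  ultimately show ?thesis by blast
qed

lemma norm_vector_scalar_mult: "norm (t *s (v :: complex ^ 'n::finite)) = norm t * norm v"
  unfolding norm_vec_def by (simp add: norm_mult L2_set_right_distrib)

lemma mpoly_nonzero_seq:
  assumes "mpoly p" "p y \<noteq> 0"
  shows "\<exists>X. X \<longlonglongrightarrow> x \<and> (\<forall>m. p (X m) \<noteq> 0)"
proof -
  have "\<exists>z\<in>ball x (inverse (real (Suc m))). p z \<noteq> 0" for m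
  proof -
    have "x \<in> ball x (inverse (real (Suc m)))" by (simp del: of_nat_Suc)
    from mpoly_nonzero_dense[OF assms open_ball this] show ?thesis .
  qed
  then obtain X where X: "\<And>m. dist x (X m) < inverse (real (Suc m))" "\<And>m. p (X m) \<noteq> 0"
    unfolding mem_ball[symmetric] by metis
  have "(\<lambda>m. dist (X m) x) \<longlonglongrightarrow> 0"
    by (rule Lim_null_comparison[OF always_eventually LIMSEQ_inverse_real_of_nat])
      (use X in \<open>auto simp: dist_commute less_imp_le\<close>)
  then have "X \<longlonglongrightarrow> x" by (simp add: tendsto_dist_iff[symmetric])
  with X show ?thesis by blast
qed

lemma fibre_values_convergent_subseq:
  assumes pc: "proper_cover y \<Delta>" and w: "mpoly w" and Y: "Y \<longlonglongrightarrow> Y0" "\<And>m. \<Delta> (Y m) \<noteq> 0"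
    and N: "\<And>m. card (y -` {Y m}) = N"
  shows "\<exists>r e \<tau>. strict_mono r \<and> (\<forall>m. bij_betw (e m) {..<N} (y -` {Y m})) \<and>
    (\<forall>i<N. (\<lambda>m. w (e (r m) i)) \<longlonglongrightarrow> \<tau> i)"
proof -
  have y: "mpoly_map y" "\<And>B. bounded {x. norm (y x) \<le> B}" using pc by (auto simp: proper_cover_def)
  have "\<exists>e. bij_betw e {..<N} (y -` {Y m})" for m
    using ex_bij_betw_nat_finite[OF regular_fibre_finite[OF y proper_cover_regular[OF pc Y(2)]], of m] N
    by (simp add: atLeast0LessThan)
  then obtain e where e: "\<And>m. bij_betw (e m) {..<N} (y -` {Y m})" by metis
  obtain B where B: "\<And>m. norm (Y m) \<le> B"
    using convergent_imp_Bseq[OF convergentI[OF Y(1)]] by (auto simp: Bseq_def)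
  obtain M where M: "\<And>x. norm (y x) \<le> B \<Longrightarrow> norm (w x) \<le> M"
    using mpoly_bounded[OF w y(2)[of B]] by auto
  have "norm (w (e m i)) \<le> M" if "i < N" for m i
  proof (rule M)
    have "e m i \<in> y -` {Y m}" using e[of m] that by (auto simp: bij_betw_def)
    then show "norm (y (e m i)) \<le> B" using B[of m] by simp
  qed
  then obtain r where r: "strict_mono r" "\<forall>i<N. convergent (\<lambda>m. w (e (r m) i))"
    using bounded_family_convergent_subseq[of N "\<lambda>m i. w (e m i)" M] by blast
  define \<tau> where "\<tau> i = lim (\<lambda>m. w (e (r m) i))" for i
  have "(\<lambda>m. w (e (r m) i)) \<longlonglongrightarrow> \<tau> i" if "i < N" for i
    using r(2) that by (simp add: \<tau>_def convergent_LIMSEQ_iff)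
  then show ?thesis using r(1) e by (intro exI[of _ r] exI[of _ e] exI[of _ \<tau>]) simp
qed

text \<open>Over a critical value the fibre is so far only known to be compact, so the finiteness is
  found in the limit: along one sequence of good values the values of \<open>w\<close> converge to
  \<open>N\<close> numbers \<open>\<tau> i\<close>, and any other approach to \<open>Y0\<close> has
  the same limiting power sums, hence no new limits.\<close>

lemma fibre_values_finite:
  fixes y :: "complex ^ 'n::finite \<Rightarrow> complex ^ 'n"
  assumes pc: "proper_cover y \<Delta>" and w: "mpoly w"
  shows "finite (w ` (y -` {Y0}))"
proof -
  have y: "mpoly_map y" "\<And>B. bounded {x. norm (y x) \<le> B}" and \<Delta>: "mpoly \<Delta>" using pc by (auto simp: proper_cover_def)
  obtain x0 where x0: "\<Delta> (y x0) \<noteq> 0" using pc by (auto simp: proper_cover_def)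
  define N where "N = card (y -` {y x0})"
  have N: "card (y -` {Y}) = N" if "\<Delta> Y \<noteq> 0" for Y
    using proper_cover_card[OF pc that x0] by (simp add: N_def)
  obtain Y where Y: "Y \<longlonglongrightarrow> Y0" "\<And>m. \<Delta> (Y m) \<noteq> 0" using mpoly_nonzero_seq[OF \<Delta> x0] by blast
  obtain r e \<tau> where r: "strict_mono r" and e: "\<And>m. bij_betw (e m) {..<N} (y -` {Y m})"
    and \<tau>: "\<And>i. i < N \<Longrightarrow> (\<lambda>m. w (e (r m) i)) \<longlonglongrightarrow> \<tau> i"
    using fibre_values_convergent_subseq[OF pc w Y N] Y(2) by blast
  have tr_lim: "(\<lambda>m. tr y (\<lambda>x. w x ^ k) (Z (s m))) \<longlonglongrightarrow> (\<Sum>i<N. \<rho> i ^ k)"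
    if "\<And>m. bij_betw (d m) {..<N} (y -` {Z m})" "\<And>i. i < N \<Longrightarrow> (\<lambda>m. w (d (s m) i)) \<longlonglongrightarrow> \<rho> i"
    for d Z s \<rho> k
  proof -
    have "tr y (\<lambda>x. w x ^ k) (Z m) = (\<Sum>i<N. w (d m i) ^ k)" for m
      unfolding tr_def by (rule sum.reindex_bij_betw[OF that(1), symmetric])
    moreover have "(\<lambda>m. \<Sum>i<N. w (d (s m) i) ^ k) \<longlonglongrightarrow> (\<Sum>i<N. \<rho> i ^ k)"
      by (intro tendsto_sum tendsto_power that(2)) simp
    ultimately show ?thesis by simp
  qed
  have "w x \<in> \<tau> ` {..<N}" if x: "y x = Y0" for x
  proof -
    have "mpoly (\<lambda>x. \<Delta> (y x))" by (rule mpoly_compose[OF \<Delta>]) (use y in \<open>simp add: mpoly_map_def\<close>)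
    then obtain X where X: "X \<longlonglongrightarrow> x" "\<And>m. \<Delta> (y (X m)) \<noteq> 0"
      using mpoly_nonzero_seq[of "\<lambda>x. \<Delta> (y x)" x0 x] x0 by blast
    define Y' where "Y' m = y (X m)" for m
    have ycont: "isCont y x"
      using mpoly_map_continuous[OF y(1), of UNIV] by (simp add: continuous_on_eq_continuous_at)
    have Y': "Y' \<longlonglongrightarrow> Y0" "\<And>m. \<Delta> (Y' m) \<noteq> 0"
      using isCont_tendsto_compose[OF ycont X(1)] X(2) x by (simp_all add: Y'_def[abs_def])
    obtain r' e' \<tau>' where r': "strict_mono r'" and e': "\<And>m. bij_betw (e' m) {..<N} (y -` {Y' m})"
      and \<tau>': "\<And>i. i < N \<Longrightarrow> (\<lambda>m. w (e' (r' m) i)) \<longlonglongrightarrow> \<tau>' i"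
      using fibre_values_convergent_subseq[OF pc w Y' N] Y'(2) by blast
    have "(\<Sum>i<N. \<tau> i ^ k) = (\<Sum>i<N. \<tau>' i ^ k)" for k
    proof -
      have "norm ((\<Sum>i<N. \<tau> i ^ k) - (\<Sum>i<N. \<tau>' i ^ k)) \<le> \<epsilon>" if \<epsilon>: "\<epsilon> > 0" for \<epsilon>
      proof -
        obtain \<delta> where \<delta>: "\<delta> > 0" "\<And>Z Z'. Z \<in> ball Y0 \<delta> \<Longrightarrow> Z' \<in> ball Y0 \<delta> \<Longrightarrow> \<Delta> Z \<noteq> 0 \<Longrightarrow> \<Delta> Z' \<noteq> 0 \<Longrightarrow>
          norm (tr y (\<lambda>x. w x ^ k) Z - tr y (\<lambda>x. w x ^ k) Z') \<le> \<epsilon>"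
          using tr_uniformly_close[OF pc mpoly_power[OF w] \<epsilon>] by metis
        have near: "\<forall>\<^sub>F m in sequentially. Z (s m) \<in> ball Y0 \<delta>"
          if "Z \<longlonglongrightarrow> Y0" "strict_mono s" for Z and s :: "nat \<Rightarrow> nat"
          using LIMSEQ_subseq_LIMSEQ[OF that] \<delta>(1)
          by (auto simp: tendsto_iff o_def dist_commute)
        have "(\<lambda>m. norm (tr y (\<lambda>x. w x ^ k) (Y (r m)) - tr y (\<lambda>x. w x ^ k) (Y' (r' m))))
            \<longlonglongrightarrow> norm ((\<Sum>i<N. \<tau> i ^ k) - (\<Sum>i<N. \<tau>' i ^ k))"
          by (intro tendsto_norm tendsto_diff tr_lim[of e Y r \<tau> k, OF e \<tau>] tr_lim[of e' Y' r' \<tau>' k, OF e' \<tau>'])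
        moreover have "\<forall>\<^sub>F m in sequentially.
            norm (tr y (\<lambda>x. w x ^ k) (Y (r m)) - tr y (\<lambda>x. w x ^ k) (Y' (r' m))) \<le> \<epsilon>"
          using near[OF Y(1) r] near[OF Y'(1) r'] by eventually_elim (rule \<delta>(2), auto simp: Y Y')
        ultimately show ?thesis by (intro tendsto_upperbound) auto
      qed
      then show ?thesis by (metis dense_ge eq_iff_diff_eq_0 norm_le_zero_iff)
    qed
    then have sub: "\<tau>' ` {..<N} \<subseteq> \<tau> ` {..<N}" by (intro power_sums_eq_image) auto
    \<comment> \<open>\<open>X (r' m)\<close> is one of the enumerated points of its fibre, but its
      index varies with \<open>m\<close>. The product over all indices is zero throughout and passes
      to the limit.\<close>
    have "(\<lambda>m. \<Prod>i<N. w (X (r' m)) - w (e' (r' m) i)) \<longlonglongrightarrow> (\<Prod>i<N. w x - \<tau>' i)"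
    proof (intro tendsto_prod tendsto_diff)
      have "isCont w x" using mpoly_continuous[OF w, of UNIV] by (simp add: continuous_on_eq_continuous_at)
      moreover have "(\<lambda>m. X (r' m)) \<longlonglongrightarrow> x" using LIMSEQ_subseq_LIMSEQ[OF X(1) r'] by (simp add: o_def)
      ultimately show "(\<lambda>m. w (X (r' m))) \<longlonglongrightarrow> w x" by (rule isCont_tendsto_compose)
    qed (use \<tau>' in auto)
    moreover have "(\<Prod>i<N. w (X (r' m)) - w (e' (r' m) i)) = 0" for m
    proof -
      have "X (r' m) \<in> y -` {Y' (r' m)}" by (simp add: Y'_def)
      then obtain i where "i < N" "X (r' m) = e' (r' m) i"
        using e'[of "r' m"] unfolding bij_betw_def by (metis imageE lessThan_iff)
      then show ?thesis by (intro prod_zero) auto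
    qed
    ultimately have "(\<lambda>m. 0) \<longlonglongrightarrow> (\<Prod>i<N. w x - \<tau>' i)" by (simp only:)
    then have "(\<Prod>i<N. w x - \<tau>' i) = 0" by (metis LIMSEQ_unique tendsto_const)
    then show ?thesis using sub by auto
  qed
  then have "w ` (y -` {Y0}) \<subseteq> \<tau> ` {..<N}" by auto
  then show ?thesis using finite_subset by blast
qed

text \<open>Off the finite set where the line through \<open>Y0\<close> meets the discriminant, the set of values
  attained on \<open>W\<close> is open and closed.\<close>

lemma value_attained:
  fixes y :: "complex ^ 'n::finite \<Rightarrow> complex ^ 'n"
  assumes y: "mpoly_map y" and \<Delta>: "mpoly \<Delta>" "\<Delta> (y x0) \<noteq> 0"
    and inj: "\<And>x v. \<Delta> (y x) \<noteq> 0 \<Longrightarrow> jac y x v = 0 \<Longrightarrow> v = 0"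
    and W: "open W" "bounded W" and bd: "\<And>x. x \<in> closure W - W \<Longrightarrow> \<epsilon> \<le> dist (y x) Y0"
    and a: "a \<in> W" "dist (y a) Y0 < \<epsilon>"
  shows "\<exists>x\<in>W. y x = Y0"
proof -
  have "open (W \<inter> y -` ball Y0 \<epsilon>)"
    using mpoly_map_continuous[OF y, of UNIV] W by (intro open_Int open_vimage) auto
  moreover have "a \<in> W \<inter> y -` ball Y0 \<epsilon>" using a by (simp add: dist_commute)
  moreover have "mpoly (\<lambda>x. \<Delta> (y x))" by (rule mpoly_compose[OF \<Delta>(1)]) (use y in \<open>simp add: mpoly_map_def\<close>)
  \<comment> \<open>\<open>a\<close> is moved slightly so that its value avoids the discriminant;
    this makes the parameter 1 of the line from \<open>Y0\<close> to \<open>y b\<close> a member of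
    \<open>T\<close>.\<close>
  ultimately obtain b where b: "b \<in> W" "y b \<in> ball Y0 \<epsilon>" "\<Delta> (y b) \<noteq> 0"
    using mpoly_nonzero_dense[of "\<lambda>x. \<Delta> (y x)" x0] \<Delta>(2) by blast
  define v where "v = y b - Y0"
  define L where "L t = Y0 + t *s v" for t
  define S where "S = L -` ball Y0 \<epsilon>"
  define D where "D = {t. \<Delta> (L t) = 0}"
  have L1: "L 1 = y b" by (simp add: L_def v_def)
  have Lcont: "continuous_on UNIV L" unfolding L_def[abs_def] by (rule continuous_on_line)
  have Sopen: "open S" unfolding S_def by (rule open_vimage[OF open_ball Lcont])
  have S0: "0 \<in> S" "1 \<in> S" using b by (auto simp: S_def L1) (auto simp: L_def intro: le_less_trans[OF zero_le_dist])
  have "convex S"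
  proof (rule convexI)
    fix s t and p q :: real assume *: "s \<in> S" "t \<in> S" "0 \<le> p" "0 \<le> q" "p + q = 1"
    have "L (p *\<^sub>R s + q *\<^sub>R t) = p *\<^sub>R L s + q *\<^sub>R L t"
      using *(5) by (simp add: L_def vec_eq_iff algebra_simps flip: scaleR_left.add)
    then show "p *\<^sub>R s + q *\<^sub>R t \<in> S"
      using * convexD[OF convex_ball[of Y0 \<epsilon>], of "L s" "L t" p q] by (simp add: S_def)
  qed
  have finD: "finite D" unfolding D_def L_def
    by (rule line_zeros_finite[of \<Delta> Y0 1 v]) (use \<Delta> b in \<open>auto simp: v_def\<close>)
  have conn: "connected (S - D)" by (rule connected_Compl_finite[OF finD Sopen convex_connected[OF \<open>convex S\<close>]])
  \<comment> \<open>The distance of boundary values from \<open>Y0\<close> takes the place of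
    properness, which is not assumed for \<open>y\<close>: over the ball about \<open>Y0\<close>, a
    preimage in the closure of \<open>W\<close> lies in \<open>W\<close>.\<close>
  have inW: "x \<in> W" if "x \<in> closure W" "y x \<in> ball Y0 \<epsilon>" for x
    using bd[of x] that by (force simp: dist_commute)
  have "compact (y ` closure W)"
    using W by (intro compact_continuous_image mpoly_map_continuous y) simp
  then have cl: "closed (L -` (y ` closure W))"
    by (intro closed_vimage Lcont compact_imp_closed)
  define T where "T = (S - D) \<inter> L -` (y ` closure W)"
  have "closedin (top_of_set (S - D)) T" unfolding T_def by (rule closedin_closed_Int[OF cl])
  moreover have "openin (top_of_set (S - D)) T"
  proof (subst openin_subopen, rule ballI)
    fix t assume t: "t \<in> T"
    then obtain x where x: "x \<in> closure W" "y x = L t" by (auto simp: T_def)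
    then have xW: "x \<in> W" using t by (intro inW) (auto simp: T_def S_def)
    have "\<Delta> (y x) \<noteq> 0" using t x by (simp add: T_def D_def)
    from local_inverse[OF y inj[OF this] W(1) xW]
    obtain U V g where U: "U \<subseteq> W" "open V" "y x \<in> V" "homeomorphism U V y g"
      by blast
    have "open (L -` V)" by (rule open_vimage[OF U(2) Lcont])
    then have "openin (top_of_set (S - D)) ((S - D) \<inter> L -` V)" by (rule openin_open_Int)
    moreover have "(S - D) \<inter> L -` V \<subseteq> T"
    proof
      fix s assume s: "s \<in> (S - D) \<inter> L -` V"
      then have "y (g (L s)) = L s" "g (L s) \<in> U" using U(4) by (auto simp: homeomorphism_def)
      then have "L s \<in> y ` closure W" using U(1) closure_subset by (metis image_eqI subsetD)
      then show "s \<in> T" using s by (simp add: T_def)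
    qed
    moreover have "t \<in> (S - D) \<inter> L -` V" using t x U(3) by (auto simp: T_def)
    ultimately show "\<exists>T'. openin (top_of_set (S - D)) T' \<and> t \<in> T' \<and> T' \<subseteq> T" by blast
  qed
  moreover have "1 \<in> T" using S0 b closure_subset by (auto simp: T_def D_def L1)
  ultimately have T: "T = S - D" using conn unfolding connected_clopen by blast
  \<comment> \<open>The parameter 0 may itself belong to \<open>D\<close>. If it were not attained,
    a whole open set of parameters around it would be missed, but all missed parameters lie in the
    finite set \<open>D\<close>.\<close>
  have "0 \<in> L -` (y ` closure W)"
  proof (rule ccontr)
    assume "0 \<notin> L -` (y ` closure W)"
    then have "0 \<in> S - L -` (y ` closure W)" using S0 by blast
    moreover have "open (S - L -` (y ` closure W))" using Sopen cl by blast
    moreover have "finite (S - L -` (y ` closure W))"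
      by (rule finite_subset[OF _ finD]) (use T in \<open>auto simp: T_def\<close>)
    ultimately show False using finite_imp_not_open by blast
  qed
  then obtain x where x: "x \<in> closure W" "y x = Y0" by (auto simp: L_def)
  moreover have "x \<in> W" using x a(2) by (intro inW) (auto intro: le_less_trans[OF zero_le_dist])
  ultimately show ?thesis by blast
qed

text \<open>The image contains an open set, on which no non-zero polynomial vanishes. Perturbed
  gradients are treated by this criterion, which is local and does not involve sublevel
  sets.\<close>

lemma alg_indep_of_injective:
  assumes y: "mpoly_map y" and inj: "\<And>v. jac y x0 v = 0 \<Longrightarrow> v = 0"
  shows "alg_indep y"
  unfolding alg_indep_def
proof (intro allI impI)
  fix R Y assume R: "mpoly R" "\<forall>x. R (y x) = 0"
  from local_inverse[of y x0 UNIV, OF y inj open_UNIV UNIV_I]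
  obtain U V g where V: "open V" "y x0 \<in> V" "homeomorphism U V y g"
    by blast
  have "R Z = 0" if "Z \<in> V" for Z using V(3) R(2) that unfolding homeomorphism_def by metis
  then show "R Y = 0" using mpoly_nonzero_dense[OF R(1) _ V(1,2)] by blast
qed

subsection \<open>Gradients of polynomials\<close>

lemma mpoly_line_pderiv:
  assumes p: "mpoly p" and q: "\<And>t. p (x + t *s v) = poly q t"
  shows "poly (pderiv q) t = (\<Sum>i\<in>UNIV. partial i p (x + t *s v) * v $ i)"
proof -
  have D: "((\<lambda>t. x + t *s v) has_derivative (\<lambda>t. t *s v)) (at t)"
    by (rule has_derivative_vec_lambda) (auto intro!: derivative_eq_intros)
  have "((\<lambda>t. p (x + t *s v)) has_derivative (\<lambda>s. \<Sum>i\<in>UNIV. partial i p (x + t *s v) * (s *s v) $ i)) (at t)"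
    by (rule has_derivative_compose[OF D mpoly_has_derivative[OF p]])
  also have "(\<lambda>s. \<Sum>i\<in>UNIV. partial i p (x + t *s v) * (s *s v) $ i) = (*) (\<Sum>i\<in>UNIV. partial i p (x + t *s v) * v $ i)"
    by (simp add: fun_eq_iff sum_distrib_left mult_ac)
  finally have "((\<lambda>t. poly q t) has_field_derivative (\<Sum>i\<in>UNIV. partial i p (x + t *s v) * v $ i)) (at t)"
    by (simp add: has_field_derivative_def q)
  then show ?thesis using poly_DERIV DERIV_unique by blast
qed

text \<open>The divisibility \<open>monom 1 k dvd s - [:poly s 0:]\<close> says that
  \<open>s\<close> is constant modulo \<open>t ^ k\<close>, a property that polynomials preserve. It
  drives the induction in \<open>gradient_relation_partial\<close>.\<close>

lemma mpoly_compose_curve: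
  assumes "mpoly P" and \<phi>: "\<And>t j. \<phi> t $ j = poly (q j) t"
  shows "\<exists>s. (\<forall>t. P (\<phi> t) = poly s t) \<and>
    (\<forall>k. (\<forall>j. monom 1 k dvd q j - [:poly (q j) 0:]) \<longrightarrow> monom 1 k dvd s - [:poly s 0:])"
  using assms(1)
proof (induction rule: mpoly_induct)
  case (const c)
  show ?case by (rule exI[of _ "[:c:]"]) simp
next
  case (shift P j)
  then obtain s where s: "\<And>t. P (\<phi> t) = poly s t"
    "\<And>k. (\<forall>j. monom 1 k dvd q j - [:poly (q j) 0:]) \<Longrightarrow> monom 1 k dvd s - [:poly s 0:]" by blast
  have "q j * s - [:poly (q j * s) 0:] = q j * (s - [:poly s 0:]) + [:poly s 0:] * (q j - [:poly (q j) 0:])"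
    by (simp add: algebra_simps)
  then have "monom 1 k dvd q j * s - [:poly (q j * s) 0:]" if "\<forall>j. monom 1 k dvd q j - [:poly (q j) 0:]" for k
    using s(2)[OF that] that by (simp only: dvd_add dvd_mult)
  then show ?case using s(1) by (intro exI[of _ "q j * s"]) (simp add: \<phi>)
next
  case (add P Q)
  then obtain s s' where s: "\<And>t. P (\<phi> t) = poly s t" "\<And>t. Q (\<phi> t) = poly s' t"
    "\<And>k. (\<forall>j. monom 1 k dvd q j - [:poly (q j) 0:]) \<Longrightarrow> monom 1 k dvd s - [:poly s 0:]"
    "\<And>k. (\<forall>j. monom 1 k dvd q j - [:poly (q j) 0:]) \<Longrightarrow> monom 1 k dvd s' - [:poly s' 0:]" by blast
  have "(s + s') - [:poly (s + s') 0:] = (s - [:poly s 0:]) + (s' - [:poly s' 0:])" by simp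
  then have "monom 1 k dvd (s + s') - [:poly (s + s') 0:]" if "\<forall>j. monom 1 k dvd q j - [:poly (q j) 0:]" for k
    using s(3)[OF that] s(4)[OF that] by (simp only: dvd_add)
  then show ?case using s(1,2) by (intro exI[of _ "s + s'"]) simp
qed

lemma gradient_mpoly_map: "mpoly F \<Longrightarrow> mpoly_map (gradient F)"
  by (simp add: mpoly_map_def gradient_def mpoly_partial)

text \<open>Gordan--Noether: if \<open>R\<close> vanishes on the image of \<open>gradient F\<close>, then \<open>gradient F\<close> is constant on
  the line through \<open>x\<close> in direction \<open>gradient R (gradient F x)\<close>.\<close>

lemma gradient_relation_partial:
  fixes F :: "complex ^ 'n::finite \<Rightarrow> complex"
  assumes F: "mpoly F" and bdd: "\<And>B. bounded {x. norm (gradient F x) \<le> B}"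
    and R: "mpoly R" and rel: "\<And>x. R (gradient F x) = 0"
  shows "partial k R (gradient F x) = 0"
proof -
  define y where "y = gradient F"
  have ymap: "mpoly_map y" and yi: "y x $ i = partial i F x" for x i
    using gradient_mpoly_map[OF F] by (auto simp: y_def gradient_def)
  have ycomp: "mpoly (\<lambda>x. y x $ i)" for i using ymap by (simp add: mpoly_map_def)
  have sym: "partial i (\<lambda>x. y x $ j) = partial j (\<lambda>x. y x $ i)" for i j
    unfolding yi using partial_commute[OF F] by simp
  \<comment> \<open>Symmetry of the Hessian exchanges the two indices, so the chain rule for
    \<open>R (y x) = 0\<close> says that every component of \<open>y\<close> has derivative zero in
    the direction of the gradient of \<open>R\<close> at \<open>y x\<close>.\<close>
  have key: "(\<Sum>i\<in>UNIV. partial i R (y x) * partial i (\<lambda>x. y x $ j) x) = 0" for x j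
  proof -
    have "(\<lambda>x. R (y x)) = (\<lambda>x. 0)" using rel by (simp add: y_def)
    then have "0 = partial j (\<lambda>x. R (y x)) x" by simp
    also have "\<dots> = (\<Sum>i\<in>UNIV. partial i R (y x) * partial j (\<lambda>x. y x $ i) x)"
      by (rule mpoly_compose_has_derivative[OF R ycomp])
    finally show ?thesis by (simp add: sym[of _ j])
  qed
  define h where "h = (\<chi> i. partial i R (y x))"
  define \<phi> where "\<phi> t = y (x + t *s h)" for t
  obtain q where q: "\<And>j t. \<phi> t $ j = poly (q j) t"
    using mpoly_line[OF ycomp] unfolding \<phi>_def by metis
  \<comment> \<open>The direction annihilated at \<open>x + t *s h\<close> is the gradient of
    \<open>R\<close> at \<open>\<phi> t\<close>, whereas the line has direction \<open>h\<close>. If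
    \<open>\<phi>\<close> is constant modulo \<open>t ^ k\<close>, the two directions agree modulo
    \<open>t ^ k\<close>; the derivative of \<open>\<phi>\<close> is then divisible by
    \<open>t ^ k\<close>, and \<open>\<phi>\<close> is constant modulo one power more.\<close>
  have dvd: "monom 1 k dvd q j - [:poly (q j) 0:]" for k j
  proof (induction k arbitrary: j)
    case (Suc k)
    have "\<forall>i. \<exists>s. (\<forall>t. partial i R (\<phi> t) = poly s t) \<and> monom 1 k dvd s - [:poly s 0:]"
      using mpoly_compose_curve[OF mpoly_partial[OF R] q] Suc.IH by blast
    from choice[OF this] obtain s where s: "\<And>i t. partial i R (\<phi> t) = poly (s i) t"
      "\<And>i. monom 1 k dvd s i - [:poly (s i) 0:]" by blast
    have "\<forall>i. \<exists>b. \<forall>t. partial i (\<lambda>x. y x $ j) (x + t *s h) = poly b t"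
      using mpoly_line[OF mpoly_partial[OF ycomp]] by blast
    from choice[OF this] obtain b where b: "\<And>i t. partial i (\<lambda>x. y x $ j) (x + t *s h) = poly (b i) t"
      by blast
    have s0: "poly (s i) 0 = h $ i" for i
      using s(1)[of i 0] by (simp add: \<phi>_def h_def)
    have "poly (pderiv (q j)) t = poly (\<Sum>i\<in>UNIV. ([:poly (s i) 0:] - s i) * b i) t" for t
    proof -
      have "poly (pderiv (q j)) t = (\<Sum>i\<in>UNIV. partial i (\<lambda>x. y x $ j) (x + t *s h) * h $ i)"
        by (rule mpoly_line_pderiv[OF ycomp]) (use q in \<open>simp add: \<phi>_def\<close>)
      also have "\<dots> = (\<Sum>i\<in>UNIV. poly (b i) t * h $ i) - (\<Sum>i\<in>UNIV. poly (s i) t * poly (b i) t)"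
        using key[of "x + t *s h" j] by (simp add: b s(1)[symmetric] \<phi>_def)
      also have "\<dots> = poly (\<Sum>i\<in>UNIV. ([:poly (s i) 0:] - s i) * b i) t"
        by (simp add: poly_sum s0 sum_subtractf algebra_simps)
      finally show ?thesis .
    qed
    then have "pderiv (q j) = (\<Sum>i\<in>UNIV. ([:poly (s i) 0:] - s i) * b i)"
      by (simp add: poly_eq_poly_eq_iff[symmetric] fun_eq_iff)
    moreover have "monom 1 k dvd [:poly (s i) 0:] - s i" for i
      using s(2)[of i] by (subst dvd_diff_commute)
    ultimately have "monom 1 k dvd pderiv (q j)" by (auto intro!: dvd_sum)
    then have "coeff (q j) (Suc n) = 0" if "n < k" for n
      using that by (auto simp: monom_1_dvd_iff' coeff_pderiv simp del: of_nat_Suc)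
    then show ?case
      by (auto simp: monom_1_dvd_iff' poly_0_coeff_0 coeff_pCons split: nat.split)
  qed (simp add: one_pCons[symmetric] monom_0)
  have const: "\<phi> t = y x" for t
  proof -
    have "coeff (q j) (Suc n) = 0" for j n
      using dvd[of "Suc (Suc n)" j] by (auto simp: monom_1_dvd_iff' coeff_pCons)
    then have "q j = [:poly (q j) 0:]" for j
      by (auto simp: poly_eq_iff poly_0_coeff_0 coeff_pCons split: nat.split)
    then have "poly (q j) t = poly (q j) 0" for j by (metis poly_pCons poly_0 mult_zero_right add.right_neutral)
    then have "\<phi> t $ j = \<phi> 0 $ j" for j by (simp add: q)
    then show ?thesis by (simp add: vec_eq_iff) (simp add: \<phi>_def)
  qed
  have "h = 0"
  proof (rule ccontr)
    assume "h \<noteq> 0"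
    obtain B where B: "\<And>z. norm (y z) \<le> norm (y x) \<Longrightarrow> norm z \<le> B"
      using bdd[of "norm (y x)"] by (auto simp: bounded_iff y_def)
    \<comment> \<open>Large enough for \<open>x + t *s h\<close> to leave the ball of radius
      \<open>B\<close>, although \<open>y\<close> takes the same value there as at
      \<open>x\<close>.\<close>
    define t :: complex where "t = of_real ((\<bar>B\<bar> + norm x + 1) / norm h)"
    have "norm (x + t *s h) \<le> B" using const[of t] by (intro B) (simp add: \<phi>_def)
    moreover have "norm (t *s h) = \<bar>B\<bar> + norm x + 1"
      unfolding norm_vector_scalar_mult t_def norm_of_real using \<open>h \<noteq> 0\<close> by (simp add: abs_divide)
    ultimately show False using norm_triangle_ineq4[of "x + t *s h" x] by simp
  qed
  then show ?thesis by (simp add: h_def vec_eq_iff y_def)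
qed

text \<open>By \<open>gradient_relation_partial\<close> the partial derivatives of \<open>R\<close>
  of every order vanish at the image point \<open>c\<close>, so the Taylor expansion of
  \<open>R\<close> at \<open>c\<close> is zero. The induction runs over its coefficients on the line
  from \<open>c\<close> to \<open>Y\<close>, for all relations \<open>S\<close> at once.\<close>

lemma gradient_alg_indep:
  fixes F :: "complex ^ 'n::finite \<Rightarrow> complex"
  assumes F: "mpoly F" and bdd: "\<And>B. bounded {x. norm (gradient F x) \<le> B}"
  shows "alg_indep (gradient F)"
  unfolding alg_indep_def
proof (intro allI impI)
  fix R Y assume R: "mpoly R" "\<forall>x. R (gradient F x) = 0"
  define c where "c = gradient F 0"
  define v where "v = Y - c"
  have coeff0: "coeff q k = 0"
    if "mpoly S" "\<forall>x. S (gradient F x) = 0" "\<And>t. S (c + t *s v) = poly q t" for S q k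
    using that
  proof (induction k arbitrary: S q)
    case 0
    then have "poly q 0 = 0" by (metis c_def add.right_neutral vector_smult_lzero)
    then show ?case by (simp add: poly_0_coeff_0)
  next
    case (Suc k)
    have "\<forall>i. \<exists>a. \<forall>t. partial i S (c + t *s v) = poly a t"
      using mpoly_line[OF mpoly_partial[OF Suc.prems(1)]] by blast
    from choice[OF this] obtain a where a: "\<And>i t. partial i S (c + t *s v) = poly (a i) t" by blast
    have "poly (pderiv q) t = poly (\<Sum>i\<in>UNIV. smult (v $ i) (a i)) t" for t
      using mpoly_line_pderiv[OF Suc.prems(1,3), of t] by (simp add: a poly_sum mult.commute)
    then have "pderiv q = (\<Sum>i\<in>UNIV. smult (v $ i) (a i))"
      by (simp add: poly_eq_poly_eq_iff[symmetric] fun_eq_iff)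
    moreover have "coeff (a i) k = 0" for i
      using gradient_relation_partial[OF F bdd Suc.prems(1)] Suc.prems(2)
      by (intro Suc.IH[OF mpoly_partial[OF Suc.prems(1)] _ a]) auto
    ultimately have "coeff (pderiv q) k = 0" by (simp add: coeff_sum)
    then show ?case by (simp add: coeff_pderiv del: of_nat_Suc)
  qed
  obtain q where q: "\<And>t. R (c + t *s v) = poly q t" using mpoly_line[OF R(1)] by metis
  have "q = 0" using coeff0[OF R q] by (simp add: poly_eq_iff)
  then show "R Y = 0" using q[of 1] by (simp add: v_def)
qed

lemma gradient_proper_cover:
  fixes F :: "complex ^ 'n::finite \<Rightarrow> complex"
  assumes F: "mpoly F" and bdd: "\<And>B. bounded {x. norm (gradient F x) \<le> B}"
  shows "\<exists>\<Delta>. proper_cover (gradient F) \<Delta>"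
proof -
  have m: "mpoly_map (gradient F)" by (rule gradient_mpoly_map[OF F])
  then have "\<And>i. mpoly (\<lambda>x. gradient F x $ i)" by (simp add: mpoly_map_def)
  from discriminant_ex[OF this gradient_alg_indep[OF F bdd]] show ?thesis
    unfolding proper_cover_def using m bdd by blast
qed

subsection \<open>Quasihomogeneous polynomials\<close>

lemma norm_le_sum_components: "norm (v :: complex ^ 'n::finite) \<le> (\<Sum>i\<in>UNIV. norm (v $ i))"
  unfolding norm_vec_def by (rule L2_set_le_sum) simp

lemma powr_tendsto_0_at_right: "0 < e \<Longrightarrow> ((\<lambda>s::real. s powr e) \<longlongrightarrow> 0) (at_right 0)"
  by (rule tendsto_zero_powrI[OF tendsto_ident_at tendsto_const])
    (auto simp: eventually_at_right_field intro: exI[of _ 1])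

definition wscale :: "real ^ 'n::finite \<Rightarrow> real \<Rightarrow> complex ^ 'n \<Rightarrow> complex ^ 'n" where
  "wscale l s x = (\<chi> i. of_real (s powr (l $ i)) * x $ i)"

lemma wscale_nth [simp]: "wscale l s x $ i = of_real (s powr (l $ i)) * x $ i"
  by (simp add: wscale_def)

lemma norm_wscale_nth: "norm (wscale l s x $ i) = s powr (l $ i) * norm (x $ i)"
  by (simp add: norm_mult)

lemma wscale_wscale: "s > 0 \<Longrightarrow> t > 0 \<Longrightarrow> wscale l s (wscale l t x) = wscale l (s * t) x"
  by (simp add: vec_eq_iff powr_mult)

lemma wscale_one: "wscale l 1 x = x"
  by (simp add: vec_eq_iff)

lemma monom_at_wscale:
  assumes "s > 0"
  shows "monom_at a (wscale l s x) = of_real (s powr weighted_deg l a) * monom_at a x"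
proof -
  have "(\<Prod>i\<in>UNIV. complex_of_real (s powr (l $ i)) ^ a i) = of_real (\<Prod>i\<in>UNIV. s powr (real (a i) * l $ i))"
    unfolding of_real_power[symmetric] of_real_prod[symmetric] using assms by (simp add: powr_power mult.commute)
  also have "(\<Prod>i\<in>UNIV. s powr (real (a i) * l $ i)) = s powr weighted_deg l a"
    unfolding weighted_deg_def using assms by (simp add: powr_sum)
  finally show ?thesis by (simp add: monom_at_def power_mult_distrib prod.distrib)
qed

lemma partial_wscale:
  assumes "mpoly p"
  shows "partial k (\<lambda>x. p (wscale l s x)) x = of_real (s powr (l $ k)) * partial k p (wscale l s x)"
proof -
  have "mpoly (\<lambda>x. wscale l s x $ i)" for i by (simp add: mpoly_mult mpoly_coord mpoly_const)
  from mpoly_compose_has_derivative[OF assms this]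
  have "partial k (\<lambda>x. p (wscale l s x)) x = (\<Sum>i\<in>UNIV. partial i p (wscale l s x) * partial k (\<lambda>x. wscale l s x $ i) x)" .
  also have "\<dots> = (\<Sum>i\<in>UNIV. if i = k then partial i p (wscale l s x) * of_real (s powr (l $ k)) else 0)"
    by (intro sum.cong refl) (auto simp: partial_scale mpoly_coord partial_coord)
  finally show ?thesis by (simp add: mult.commute)
qed

text \<open>The weighted unit sphere. The maximum norm suits \<open>wscale\<close>, which acts on
  each modulus separately: a non-zero \<open>x\<close> is normalised by the largest
  \<open>norm (x $ i) powr (1 / l $ i)\<close>.\<close>

definition unit_box :: "complex ^ 'n::finite \<Rightarrow> bool" where
  "unit_box z \<longleftrightarrow> (\<forall>i. norm (z $ i) \<le> 1) \<and> (\<exists>i. norm (z $ i) = 1)"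

lemma wscale_normalise:
  fixes x :: "complex ^ 'n::finite"
  assumes l: "\<And>i. 0 < l $ i" and x: "x \<noteq> 0"
  shows "\<exists>s>0. \<exists>z. unit_box z \<and> x = wscale l s z"
proof -
  define r where "r i = norm (x $ i) powr (1 / l $ i)" for i
  define s where "s = Max (range r)"
  have r: "r i \<le> s" for i by (simp add: s_def)
  have "s \<in> range r" unfolding s_def by (rule Max_in) auto
  then obtain k where k: "s = r k" by auto
  obtain i where "x $ i \<noteq> 0" using x by (auto simp: vec_eq_iff)
  then have "r i > 0" by (simp add: r_def)
  then have s: "s > 0" using r[of i] by simp
  have rp: "r i powr (l $ i) = norm (x $ i)" for i
    using l[of i] by (auto simp: r_def powr_powr)
  define z where "z = wscale l (1 / s) x"
  have zn: "norm (z $ i) = norm (x $ i) / s powr (l $ i)" for i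
    unfolding z_def norm_wscale_nth using s by (simp add: powr_divide)
  have "norm (z $ i) \<le> 1" for i
  proof -
    have "norm (x $ i) \<le> s powr (l $ i)"
      using powr_mono2[of "l $ i" "r i" s] r[of i] l[of i] by (simp add: rp less_imp_le) (simp add: r_def)
    then show ?thesis using s by (simp add: zn)
  qed
  moreover have "norm (z $ k) = 1"
  proof -
    have "s powr (l $ k) > 0" using s by simp
    moreover have "s powr (l $ k) = norm (x $ k)" using rp[of k] k by simp
    ultimately show ?thesis by (simp add: zn)
  qed
  moreover have "x = wscale l s z" using s by (simp add: z_def wscale_wscale wscale_one)
  ultimately show ?thesis using s unfolding unit_box_def by blast
qed

lemma compact_unit_box: "compact {z :: complex ^ 'n::finite. unit_box z}"
proof -
  have "{z :: complex ^ 'n. unit_box z} = (\<Inter>i. {z. norm (z $ i) \<le> 1}) \<inter> (\<Union>i. {z. norm (z $ i) = 1})"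
    by (auto simp: unit_box_def)
  moreover have "closed ((\<Inter>i. {z :: complex ^ 'n. norm (z $ i) \<le> 1}) \<inter> (\<Union>i. {z. norm (z $ i) = 1}))"
    by (intro closed_Int closed_INT closed_UN ballI closed_Collect_le closed_Collect_eq continuous_intros) simp
  moreover have "bounded {z :: complex ^ 'n. unit_box z}"
  proof (rule boundedI)
    fix z :: "complex ^ 'n" assume "z \<in> {z. unit_box z}"
    then have "(\<Sum>i\<in>UNIV. norm (z $ i)) \<le> (\<Sum>i\<in>(UNIV::'n set). 1)" by (intro sum_mono) (auto simp: unit_box_def)
    then show "norm z \<le> CARD('n)" using L2_set_le_sum[of UNIV "\<lambda>i. norm (z $ i)"]
      by (simp add: norm_vec_def)
  qed
  ultimately show ?thesis by (simp add: compact_eq_bounded_closed)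
qed

definition qhomogeneous :: "(complex ^ 'n::finite \<Rightarrow> complex) \<Rightarrow> real ^ 'n \<Rightarrow> bool" where
  "qhomogeneous F l \<longleftrightarrow> (\<forall>s>0. \<forall>x. F (wscale l s x) = of_real s * F x)"

lemma qhomogeneous_partial:
  assumes F: "mpoly F" and hom: "qhomogeneous F l" and s: "s > 0"
  shows "partial k F (wscale l s x) = of_real (s powr (1 - l $ k)) * partial k F x"
proof -
  have "(\<lambda>x. F (wscale l s x)) = (\<lambda>x. of_real s * F x)" using hom s by (auto simp: qhomogeneous_def)
  then have "of_real (s powr (l $ k)) * partial k F (wscale l s x) = of_real s * partial k F x"
    using partial_wscale[OF F, of k l s x] partial_scale[OF F, of k "of_real s"] by simp
  moreover have "complex_of_real s = of_real (s powr (l $ k)) * of_real (s powr (1 - l $ k))"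
    unfolding of_real_mult[symmetric] using s by (simp flip: powr_add)
  ultimately have "of_real (s powr (l $ k)) * partial k F (wscale l s x)
      = of_real (s powr (l $ k)) * (of_real (s powr (1 - l $ k)) * partial k F x)" by (simp only: mult.assoc)
  then show ?thesis using s by simp
qed

lemma qhomogeneous_euler:
  assumes F: "mpoly F" and hom: "qhomogeneous F l"
  shows "(\<Sum>i\<in>UNIV. of_real (l $ i) * x $ i * partial i F x) = F x"
proof -
  have "((\<lambda>s. wscale l s x) has_derivative (\<lambda>h. \<chi> i. of_real (h * l $ i) * x $ i)) (at 1)"
    by (rule has_derivative_vec_lambda) (auto intro!: derivative_eq_intros simp: scaleR_conv_of_real)
  from has_derivative_compose[OF this mpoly_has_derivative[OF F]]
  have "((\<lambda>s. F (wscale l s x)) has_derivative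
     (\<lambda>h. \<Sum>i\<in>UNIV. partial i F x * (of_real (h * l $ i) * x $ i))) (at 1)"
    by (simp add: wscale_one)
  moreover have "((\<lambda>s. F (wscale l s x)) has_derivative (\<lambda>h. of_real h * F x)) (at 1)"
  proof (rule has_derivative_transform_within_open[of "\<lambda>s. of_real s * F x" _ 1 UNIV "{0<..}"])
    show "((\<lambda>s. of_real s * F x) has_derivative (\<lambda>h. of_real h * F x)) (at 1)"
      by (auto intro!: derivative_eq_intros)
  qed (use hom in \<open>auto simp: qhomogeneous_def\<close>)
  ultimately have "(\<lambda>h::real. \<Sum>i\<in>UNIV. partial i F x * (of_real (h * l $ i) * x $ i)) = (\<lambda>h. of_real h * F x)"
    by (rule has_derivative_unique)
  from fun_cong[OF this, of 1] show ?thesis by (simp add: mult_ac)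
qed

text \<open>Compactness keeps the gradient away from zero on the weighted sphere, so some component
  is bounded below there. Which \<open>j\<close> this is depends on the point, and each component
  scales with its own exponent.\<close>

lemma gradient_lower_bound:
  fixes F :: "complex ^ 'n::finite \<Rightarrow> complex"
  assumes F: "mpoly F" and hom: "qhomogeneous F l" and iso: "\<And>x. gradient F x = 0 \<Longrightarrow> x = 0"
  shows "\<exists>c>0. \<forall>s>0. \<forall>z. unit_box z \<longrightarrow> (\<exists>j. c * s powr (1 - l $ j) \<le> norm (partial j F (wscale l s z)))"
proof -
  have cont: "continuous_on {z. unit_box z} (\<lambda>z. norm (gradient F z))"
    by (intro continuous_on_norm mpoly_map_continuous gradient_mpoly_map F)
  have ne: "(1 :: complex ^ 'n) \<in> {z. unit_box z}" by (simp add: unit_box_def)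
  obtain z0 :: "complex ^ 'n" where z0: "unit_box z0" "\<And>z. unit_box z \<Longrightarrow> norm (gradient F z0) \<le> norm (gradient F z)"
    using continuous_attains_inf[OF compact_unit_box _ cont] ne by blast
  have "z0 \<noteq> 0" using z0(1) by (auto simp: unit_box_def)
  then have g: "norm (gradient F z0) > 0" using iso by auto
  define c where "c = norm (gradient F z0) / CARD('n)"
  have "\<exists>j. c \<le> norm (partial j F z)" if z: "unit_box z" for z
  proof (rule ccontr)
    assume "\<not> ?thesis"
    then have "(\<Sum>j\<in>UNIV. norm (gradient F z $ j)) < (\<Sum>j\<in>(UNIV :: 'n set). c)"
      by (intro sum_strict_mono) (auto simp: gradient_def not_le)
    moreover have "norm (gradient F z) \<le> (\<Sum>j\<in>UNIV. norm (gradient F z $ j))"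
      by (rule norm_le_sum_components)
    ultimately show False using z0(2)[OF z] by (simp add: c_def)
  qed
  moreover have "norm (partial j F (wscale l s z)) = s powr (1 - l $ j) * norm (partial j F z)" if "s > 0" for s j z
    using qhomogeneous_partial[OF F hom that] by (simp add: norm_mult)
  ultimately have "\<exists>j. c * s powr (1 - l $ j) \<le> norm (partial j F (wscale l s z))" if "s > 0" "unit_box z" for s z
    using that by (metis mult.commute mult_left_mono powr_ge_zero)
  moreover have "c > 0" using g by (simp add: c_def)
  ultimately show ?thesis by blast
qed

text \<open>Every exponent \<open>1 - l $ j\<close> is positive, so a bounded component bounds the
  scaling parameter \<open>s\<close>, whichever \<open>j\<close> is concerned. This is the
  properness of the gradient.\<close>

lemma gradient_bounded_sublevel:
  fixes F :: "complex ^ 'n::finite \<Rightarrow> complex"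
  assumes F: "mpoly F" and hom: "qhomogeneous F l" and iso: "\<And>x. gradient F x = 0 \<Longrightarrow> x = 0"
    and l: "\<And>i. 0 < l $ i" "\<And>i. l $ i < 1"
  shows "bounded {x. norm (gradient F x) \<le> B}"
proof -
  obtain c where c: "c > 0" "\<And>s z. s > 0 \<Longrightarrow> unit_box z \<Longrightarrow> \<exists>j. c * s powr (1 - l $ j) \<le> norm (partial j F (wscale l s z))"
    using gradient_lower_bound[OF F hom iso] by metis
  define R where "R = (\<Sum>j\<in>UNIV. (\<bar>B\<bar> / c) powr (1 / (1 - l $ j)))"
  define M where "M = (\<Sum>i\<in>UNIV. R powr (l $ i))"
  have "norm x \<le> M" if x: "norm (gradient F x) \<le> B" for x
  proof (cases "x = 0")
    case True
    then show ?thesis by (simp add: M_def sum_nonneg)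
  next
    case False
    obtain s z where s: "s > 0" "unit_box z" "x = wscale l s z" using wscale_normalise[OF l(1) False] by blast
    obtain j where j: "c * s powr (1 - l $ j) \<le> norm (partial j F x)" using c(2)[OF s(1,2)] s(3) by auto
    also have "\<dots> \<le> norm (gradient F x)" using Finite_Cartesian_Product.norm_nth_le[of "gradient F x" j] by (simp add: gradient_def)
    finally have "c * s powr (1 - l $ j) \<le> \<bar>B\<bar>" using x by simp
    then have "s powr (1 - l $ j) \<le> \<bar>B\<bar> / c" using c(1) by (simp add: field_simps)
    then have "(s powr (1 - l $ j)) powr (1 / (1 - l $ j)) \<le> (\<bar>B\<bar> / c) powr (1 / (1 - l $ j))"
      using l(2)[of j] by (intro powr_mono2) auto
    then have "s \<le> (\<bar>B\<bar> / c) powr (1 / (1 - l $ j))" using l(2)[of j] s(1) by (simp add: powr_powr)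
    also have "\<dots> \<le> R" unfolding R_def by (rule member_le_sum) auto
    finally have sR: "s \<le> R" .
    have "norm x \<le> (\<Sum>i\<in>UNIV. norm (x $ i))" by (rule norm_le_sum_components)
    also have "\<dots> \<le> M" unfolding M_def
    proof (rule sum_mono)
      fix i
      have "norm (x $ i) = s powr (l $ i) * norm (z $ i)" unfolding s(3) by (rule norm_wscale_nth)
      also have "\<dots> \<le> s powr (l $ i)" using s(2) by (simp add: unit_box_def mult_left_le)
      also have "\<dots> \<le> R powr (l $ i)" using sR s(1) l(1)[of i] by (intro powr_mono2) auto
      finally show "norm (x $ i) \<le> R powr (l $ i)" .
    qed
    finally show ?thesis .
  qed
  then show ?thesis by (auto simp: bounded_iff)
qed

text \<open>Properness made quantitative: rescaling by \<open>1 / s\<close> turns the hypothesis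
  into a bound for the whole gradient at scale 1, and the resulting bound for the point is scaled
  back.\<close>

lemma gradient_fibre_growth:
  fixes F :: "complex ^ 'n::finite \<Rightarrow> complex"
  assumes F: "mpoly F" and hom: "qhomogeneous F l" and iso: "\<And>x. gradient F x = 0 \<Longrightarrow> x = 0"
    and l: "\<And>i. 0 < l $ i" "\<And>i. l $ i < 1"
  shows "\<exists>C>0. \<forall>s>0. \<forall>x. (\<forall>i. norm (partial i F x) \<le> B * s powr (1 - l $ i)) \<longrightarrow> (\<forall>i. norm (x $ i) \<le> C * s powr (l $ i))"
proof -
  obtain C where C: "C > 0" "\<And>x. norm (gradient F x) \<le> real CARD('n) * B \<Longrightarrow> norm x \<le> C"
    using gradient_bounded_sublevel[OF F hom iso l, of "real CARD('n) * B"] unfolding bounded_pos by auto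
  have "norm (x $ i) \<le> C * s powr (l $ i)"
    if s: "s > 0" and x: "\<And>i. norm (partial i F x) \<le> B * s powr (1 - l $ i)" for s x i
  proof -
    define z where "z = wscale l (1 / s) x"
    have "norm (gradient F z) \<le> (\<Sum>i\<in>UNIV. norm (gradient F z $ i))"
      by (rule norm_le_sum_components)
    also have "\<dots> \<le> (\<Sum>i\<in>(UNIV::'n set). B)"
    proof (rule sum_mono)
      fix i
      have "norm (gradient F z $ i) = (1 / s) powr (1 - l $ i) * norm (partial i F x)"
        using qhomogeneous_partial[OF F hom, of "1/s"] s by (simp add: gradient_def z_def norm_mult)
      also have "\<dots> \<le> (1 / s) powr (1 - l $ i) * (B * s powr (1 - l $ i))"
        by (intro mult_left_mono x) simp
      also have "\<dots> = B" using s by (simp add: powr_divide)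
      finally show "norm (gradient F z $ i) \<le> B" .
    qed
    finally have "norm z \<le> C" by (intro C) simp
    then have "norm (z $ i) \<le> C" using Finite_Cartesian_Product.norm_nth_le[of z i] by simp
    moreover have "norm (z $ i) = norm (x $ i) / s powr (l $ i)"
      unfolding z_def norm_wscale_nth using s by (simp add: powr_divide)
    ultimately show ?thesis using s by (simp add: field_simps)
  qed
  then show ?thesis using C(1) by blast
qed

section \<open>Growth of polynomials in one variable\<close>

lemma poly_growth_upper:
  fixes P :: "complex poly"
  shows "\<exists>C>0. \<forall>t. norm t \<ge> 1 \<longrightarrow> norm (poly P t) \<le> C * norm t ^ degree P"
proof -
  define C where "C = 1 + (\<Sum>i\<le>degree P. norm (coeff P i))"
  have "norm (poly P t) \<le> C * norm t ^ degree P" if t: "norm t \<ge> 1" for t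
  proof -
    have "norm (poly P t) \<le> (\<Sum>i\<le>degree P. norm (coeff P i * t ^ i))"
      unfolding poly_altdef by (rule norm_sum)
    also have "\<dots> \<le> (\<Sum>i\<le>degree P. norm (coeff P i) * norm t ^ degree P)"
      using t by (intro sum_mono) (auto simp: norm_mult norm_power intro!: mult_left_mono power_increasing)
    also have "\<dots> \<le> C * norm t ^ degree P"
      unfolding C_def by (simp add: distrib_right sum_distrib_right)
    finally show ?thesis .
  qed
  moreover have "C > 0" unfolding C_def by (intro add_pos_nonneg sum_nonneg) auto
  ultimately show ?thesis by blast
qed

text \<open>The reversed polynomial takes the leading coefficient as its value at 0. Continuity
  there, read at \<open>inverse t\<close>, is a lower bound near infinity.\<close>

lemma poly_growth_lower:
  fixes P :: "complex poly"
  assumes "P \<noteq> 0"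
  shows "\<exists>c>0. \<exists>B>0. \<forall>t. norm t \<ge> B \<longrightarrow> c * norm t ^ degree P \<le> norm (poly P t)"
proof -
  define c where "c = norm (lead_coeff P) / 2"
  have c: "c > 0" using assms by (simp add: c_def)
  have "isCont (\<lambda>z. norm (poly (reflect_poly P) z)) 0" by (intro continuous_intros)
  moreover have "c < norm (poly (reflect_poly P) 0)" using assms by (simp add: c_def)
  ultimately have "\<forall>\<^sub>F z in at 0. c < norm (poly (reflect_poly P) z)"
    unfolding isCont_def by (rule order_tendstoD)
  then obtain d where d: "d > 0" "\<And>z. z \<noteq> 0 \<Longrightarrow> norm z < d \<Longrightarrow> c < norm (poly (reflect_poly P) z)"
    unfolding eventually_at by (auto simp: dist_norm)
  have "c * norm t ^ degree P \<le> norm (poly P t)" if t: "norm t \<ge> 2 / d" for t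
  proof -
    have t0: "norm t > 0" using t d(1) by (meson divide_pos_pos less_le_trans zero_less_numeral)
    then have "t \<noteq> 0" by auto
    moreover have "norm (inverse t) < d"
    proof -
      have "1 < d * norm t" using t d(1) by (simp add: field_simps)
      then have "1 / norm t < d" using t0 by (simp add: field_simps)
      then show ?thesis by (simp add: norm_divide inverse_eq_divide)
    qed
    ultimately have "c < norm (poly (reflect_poly P) (inverse t))" by (intro d) auto
    also have "\<dots> = norm (poly P t) / norm t ^ degree P"
      using \<open>t \<noteq> 0\<close> by (simp add: poly_reflect_poly_nz norm_mult norm_power norm_inverse divide_inverse power_inverse mult.commute)
    finally show ?thesis using t0 by (simp add: pos_less_divide_eq less_imp_le)
  qed
  then show ?thesis using c d(1) by (intro exI[of _ c] conjI exI[of _ "2 / d"]) auto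
qed

lemma poly_degree_le_growth:
  fixes P :: "complex poly"
  assumes P: "P \<noteq> 0" and gr: "\<And>t. norm t \<ge> B \<Longrightarrow> norm (poly P t) \<le> C * norm t powr e"
  shows "real (degree P) \<le> e"
proof (rule ccontr)
  assume "\<not> ?thesis"
  then have pos: "real (degree P) - e > 0" by simp
  obtain c B' where c: "c > 0" "B' > 0" "\<And>t. norm t \<ge> B' \<Longrightarrow> c * norm t ^ degree P \<le> norm (poly P t)"
    using poly_growth_lower[OF P] by blast
  have "filterlim (\<lambda>r::real. r powr (real (degree P) - e)) at_top at_top"
    using pos by (rule real_powr_at_top)
  then have "\<forall>\<^sub>F r in at_top. C / c < r powr (real (degree P) - e)"
    by (simp add: filterlim_at_top_dense)
  then have "\<forall>\<^sub>F r in at_top. C / c < r powr (real (degree P) - e) \<and> r > max 1 (max B B')"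
    using eventually_gt_at_top by (rule eventually_conj)
  then obtain r where r: "C / c < r powr (real (degree P) - e)" "r > max 1 (max B B')"
    unfolding eventually_at_top_linorder by blast
  have "c * r ^ degree P \<le> C * r powr e"
    using c(3)[of "of_real r"] gr[of "of_real r"] r(2) by simp
  then have "c * r powr (real (degree P) - e) \<le> C"
    using r(2) by (simp add: powr_diff powr_realpow field_simps)
  then show False using r(1) c(1) by (simp add: field_simps)
qed

lemma poly_degree_less_growth:
  fixes P :: "complex poly"
  assumes P: "P \<noteq> 0" and gr: "\<And>\<delta>. \<delta> > 0 \<Longrightarrow> \<exists>B. \<forall>t. norm t \<ge> B \<longrightarrow> norm (poly P t) \<le> \<delta> * norm t powr e"
  shows "real (degree P) < e"
proof -
  obtain c B' where c: "c > 0" "B' > 0" "\<And>t. norm t \<ge> B' \<Longrightarrow> c * norm t ^ degree P \<le> norm (poly P t)"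
    using poly_growth_lower[OF P] by blast
  obtain B where B: "\<And>t. norm t \<ge> B \<Longrightarrow> norm (poly P t) \<le> c / 2 * norm t powr e"
    using gr[of "c / 2"] c(1) by auto
  obtain r where r: "r \<ge> 1" "r \<ge> B" "r \<ge> B'" by (meson dual_order.trans linorder_linear)
  have "c * r ^ degree P \<le> c / 2 * r powr e"
    using c(3)[of "of_real r"] B[of "of_real r"] r by simp
  then have "r powr real (degree P) \<le> 1 / 2 * r powr e" using c(1) r(1) by (simp add: powr_realpow)
  moreover have "r powr e > 0" using r(1) by simp
  ultimately have "r powr real (degree P) < r powr e" by linarith
  with r(1) show ?thesis using powr_mono[of e "real (degree P)" r] by (meson linorder_not_le)
qed

subsection \<open>The polar curve\<close>

lemma polar_point_ex:
  fixes F :: "complex ^ 'n::finite \<Rightarrow> complex" and i0 :: 'n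
  assumes F: "mpoly F" and hom: "qhomogeneous F l" and iso: "\<And>x. gradient F x = 0 \<Longrightarrow> x = 0"
    and l: "\<And>i. 0 < l $ i" "\<And>i. l $ i < 1" and l0: "\<And>j. j \<noteq> i0 \<Longrightarrow> l $ i0 + l $ j < 1"
  shows "\<exists>a. a $ i0 \<noteq> 0 \<and> (\<forall>j. j \<noteq> i0 \<longrightarrow> partial j F a = 0)"
proof (rule ccontr)
  assume "\<not> ?thesis"
  then have H: "x $ i0 = 0" if "\<And>j. j \<noteq> i0 \<Longrightarrow> partial j F x = 0" for x using that by blast
  define y where "y = gradient F"
  have yi: "y x $ i = partial i F x" for x i by (simp add: y_def gradient_def)
  have ymap: "mpoly_map y" unfolding y_def by (rule gradient_mpoly_map[OF F])
  have bdd: "bounded {x. norm (y x) \<le> B}" for B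
    unfolding y_def by (rule gradient_bounded_sublevel[OF F hom iso l])
  obtain \<Delta> where pc: "proper_cover y \<Delta>"
    using gradient_proper_cover[OF F bdd[unfolded y_def]] unfolding y_def by blast
  have \<Delta>: "mpoly \<Delta>" using pc by (simp add: proper_cover_def)
  obtain x1 where x1: "\<Delta> (y x1) \<noteq> 0" using pc by (auto simp: proper_cover_def)
  have "mpoly (\<lambda>x. \<Delta> (y x))" by (rule mpoly_compose[OF \<Delta>]) (use ymap in \<open>simp add: mpoly_map_def\<close>)
  \<comment> \<open>The line \<open>Y\<close> below passes through \<open>y a\<close>, off the
    discriminant, at the parameter \<open>\<eta> i0\<close>. The final contradiction is
    \<open>a $ i0 = 0\<close>.\<close>
  then obtain a where a: "a $ i0 \<noteq> 0" "\<Delta> (y a) \<noteq> 0"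
    using mpoly_mult_nonzero[OF mpoly_coord[of i0], of "\<lambda>x. \<Delta> (y x)" 1 x1] x1 by auto
  \<comment> \<open>The weight of \<open>y x $ i\<close> under the scaling that gives
    \<open>x $ i\<close> the weight \<open>l $ i\<close>.\<close>
  define m where "m i = 1 - l $ i" for i
  have m: "m i > 0" for i using l(2)[of i] by (simp add: m_def)
  define \<eta> where "\<eta> j = y a $ j" for j
  define v :: "complex ^ 'n" where "v = axis i0 1"
  define Y0 where "Y0 = y a - \<eta> i0 *s v"
  define Y where "Y t = Y0 + t *s v" for t
  have Yi0: "Y t $ i0 = t" for t by (simp add: Y_def Y0_def v_def \<eta>_def)
  have Yj: "Y t $ j = \<eta> j" if "j \<noteq> i0" for t j
    using that by (simp add: Y_def Y0_def v_def \<eta>_def axis_def)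
  have Ya: "Y (\<eta> i0) = y a" by (simp add: Y_def Y0_def)
  define D where "D = {t. \<Delta> (Y t) = 0}"
  have finD: "finite D" unfolding D_def Y_def
    by (rule line_zeros_finite[of \<Delta> Y0 "\<eta> i0" v, OF \<Delta>]) (use Ya a in \<open>simp add: Y_def\<close>)
  obtain RD where RD: "\<And>t. t \<in> D \<Longrightarrow> norm t < RD"
  proof -
    obtain b where "\<And>t. t \<in> D \<Longrightarrow> norm t \<le> b" using finite_imp_bounded[OF finD] by (auto simp: bounded_iff)
    then show ?thesis using that[of "b + 1"] by force
  qed
  define N where "N = card (y -` {y a})"
  have cardN: "card (y -` {Y t}) = N" if "t \<notin> D" for t
    using proper_cover_card[OF pc _ a(2), of "Y t"] that by (simp add: N_def D_def)
  have reg: "regular_value y (Y t)" if "t \<notin> D" for t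
    using proper_cover_regular[OF pc] that by (simp add: D_def)
  have finS: "finite (y -` {Y t})" if "t \<notin> D" for t
    by (rule regular_fibre_finite[OF ymap bdd reg[OF that]])
  have N1: "N \<ge> 1" using finS[of "\<eta> i0"] a(2) Ya by (auto simp: N_def D_def card_gt_0_iff Suc_le_eq)
  \<comment> \<open>\<open>z\<close> is the Legendre transform \<open>x \<bullet> y - F\<close>, so \<open>dz = \<Sum>\<^sub>i x\<^sub>i dy\<^sub>i\<close> and \<open>z' = x\<^sub>i\<^sub>0\<close> along the fibres.\<close>
  define z where "z x = (\<Sum>i\<in>UNIV. of_real (m i) * x $ i * y x $ i)" for x
  have ycomp: "mpoly (\<lambda>x. y x $ i)" for i using ymap by (simp add: mpoly_map_def)
  have z: "mpoly z" unfolding z_def[abs_def] by (intro mpoly_sum mpoly_mult mpoly_const mpoly_coord ycomp)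
  have zF: "z = (\<lambda>x. (\<Sum>i\<in>UNIV. x $ i * y x $ i) - F x)"
  proof
    fix x
    have "z x = (\<Sum>i\<in>UNIV. x $ i * y x $ i) - (\<Sum>i\<in>UNIV. of_real (l $ i) * x $ i * partial i F x)"
      unfolding z_def sum_subtractf[symmetric] by (intro sum.cong refl) (simp add: m_def yi algebra_simps)
    then show "z x = (\<Sum>i\<in>UNIV. x $ i * y x $ i) - F x" by (simp only: qhomogeneous_euler[OF F hom])
  qed
  have dz: "partial k z x = (\<Sum>i\<in>UNIV. x $ i * partial k (\<lambda>x. y x $ i) x)" for k x
  proof -
    have "partial k z x = (\<Sum>i\<in>UNIV. partial k (\<lambda>x. x $ i * y x $ i) x) - partial k F x"
      unfolding zF by (subst partial_diff) (auto intro!: mpoly_sum mpoly_mult mpoly_coord ycomp F simp: partial_sum mpoly_mult mpoly_coord ycomp)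
    also have "(\<Sum>i\<in>UNIV. partial k (\<lambda>x. x $ i * y x $ i) x)
      = (\<Sum>i\<in>UNIV. (if k = i then 1 else 0) * y x $ i) + (\<Sum>i\<in>UNIV. x $ i * partial k (\<lambda>x. y x $ i) x)"
      unfolding sum.distrib[symmetric] by (simp add: partial_mult mpoly_coord ycomp partial_coord)
    also have "(\<Sum>i\<in>UNIV. (if k = i then 1 else 0) * y x $ i) = y x $ k"
      by (subst sum.remove[of _ k]) auto
    finally show ?thesis by (simp add: yi)
  qed
  define p where "p k t = tr y (\<lambda>x. z x ^ k) (Y t)" for k t
  have p_deriv: "(p k has_field_derivative (\<Sum>x\<in>y -` {Y t}. of_nat k * z x ^ (k - 1) * x $ i0)) (at t)"
    if t: "t \<notin> D" for k t
  proof -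
    have "\<exists>\<xi>. jac y x \<xi> = v" if "x \<in> y -` {Y t}" for x
    proof -
      have "\<And>v. jac y x v = 0 \<Longrightarrow> v = 0" using reg[OF t] that by (auto simp: regular_value_def)
      then have "inj (jac y x)" using linear_injective_0[OF jac_linear] by blast
      then have "surj (jac y x)" using linear_injective_imp_surjective[OF jac_linear] by blast
      then show ?thesis by (metis surjD)
    qed
    then have "\<forall>x\<in>y -` {Y t}. \<exists>\<xi>. jac y x \<xi> = v" by blast
    from bchoice[OF this] obtain \<xi> where \<xi>: "\<And>x. x \<in> y -` {Y t} \<Longrightarrow> jac y x (\<xi> x) = v" by blast
    have pz: "partial j (\<lambda>x. z x ^ k) x = of_nat k * z x ^ (k - 1) * partial j z x" for j x
    proof (induction k)
      case (Suc k)
      have "partial j (\<lambda>x. z x ^ Suc k) x = partial j z x * z x ^ k + z x * partial j (\<lambda>x. z x ^ k) x"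
        using partial_mult[OF z mpoly_power[OF z, of k], of j] by simp
      then show ?case using Suc by (cases k) (auto simp: algebra_simps)
    qed simp
    have "(\<Sum>j\<in>UNIV. partial j (\<lambda>x. z x ^ k) x * \<xi> x $ j) = of_nat k * z x ^ (k - 1) * x $ i0"
      if x: "x \<in> y -` {Y t}" for x
    proof -
      have "(\<Sum>j\<in>UNIV. partial j z x * \<xi> x $ j)
        = (\<Sum>j\<in>UNIV. \<Sum>i\<in>UNIV. x $ i * (partial j (\<lambda>x. y x $ i) x * \<xi> x $ j))"
        by (simp add: dz sum_distrib_right mult.assoc)
      also have "\<dots> = (\<Sum>i\<in>UNIV. x $ i * jac y x (\<xi> x) $ i)"
        by (subst sum.swap) (simp add: jac_def sum_distrib_left)
      also have "\<dots> = x $ i0" unfolding \<xi>[OF x] v_def by (subst sum.remove[of _ i0]) (auto simp: axis_def)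
      finally show ?thesis by (simp add: pz mult.assoc flip: sum_distrib_left)
    qed
    then have "((\<lambda>s. tr y (\<lambda>x. z x ^ k) (Y t + s *s v)) has_field_derivative
      (\<Sum>x\<in>y -` {Y t}. of_nat k * z x ^ (k - 1) * x $ i0)) (at 0)"
      using tr_differentiable(2)[of y "Y t" "\<lambda>x. z x ^ k" \<xi> v, OF ymap bdd reg[OF t] mpoly_power[OF z] \<xi>] by simp
    then have "((\<lambda>s. p k (t + s)) has_field_derivative (\<Sum>x\<in>y -` {Y t}. of_nat k * z x ^ (k - 1) * x $ i0)) (at 0)"
      by (simp add: p_def Y_def vector_sadd_rdistrib add.assoc)
    then show ?thesis
      using DERIV_at_within_shift[of "p k" _ t 0 UNIV] by (simp add: o_def)
  qed
  \<comment> \<open>\<open>l $ j / m i0\<close> bounds the growth exponent of \<open>x $ j\<close>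
    in \<open>t\<close>, and it is below 1 exactly when \<open>l $ i0 + l $ j < 1\<close>. The extra
    entry 1/2 makes the maximum positive, and keeps it defined when \<open>i0\<close> is the only
    index.\<close>
  define L where "L = insert (1/2) ((\<lambda>j. l $ j / m i0) ` (UNIV - {i0}))"
  define \<theta> where "\<theta> = Max L"
  have \<theta>: "\<theta> < 1" "\<theta> > 0" "\<And>j. j \<noteq> i0 \<Longrightarrow> l $ j / m i0 \<le> \<theta>"
  proof -
    have fin: "finite L" by (simp add: L_def)
    have lj: "l $ j / m i0 < 1" if "j \<noteq> i0" for j using l0[OF that] m[of i0] by (simp add: m_def)
    have "q < 1" if "q \<in> L" for q using that lj by (auto simp: L_def)
    then show "\<theta> < 1" unfolding \<theta>_def using fin by (subst Max_less_iff) (auto simp: L_def)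
    have "1/2 \<le> \<theta>" unfolding \<theta>_def using fin by (intro Max_ge) (auto simp: L_def)
    then show "\<theta> > 0" by simp
    show "l $ j / m i0 \<le> \<theta>" if "j \<noteq> i0" for j
      unfolding \<theta>_def using fin that by (intro Max_ge) (auto simp: L_def)
  qed
  \<comment> \<open>The part of \<open>z\<close> that comes from the coordinates
    \<open>\<eta> j\<close>, constant along the line. It is the value of
    \<open>z - m t dz/dt\<close> and grows no faster than the \<open>x $ j\<close> with
    \<open>j \<noteq> i0\<close>.\<close>
  define \<zeta> where "\<zeta> x = (\<Sum>j\<in>UNIV - {i0}. of_real (m j) * \<eta> j * x $ j)" for x
  have z_split: "of_real (m i0) * t * x $ i0 = z x - \<zeta> x" if "x \<in> y -` {Y t}" for x t
  proof -
    have yx: "y x = Y t" using that by simp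
    have "z x = of_real (m i0) * x $ i0 * t + (\<Sum>j\<in>UNIV - {i0}. of_real (m j) * x $ j * \<eta> j)"
      unfolding z_def yx by (subst sum.remove[of _ i0]) (auto simp: Yi0 Yj intro!: sum.cong)
    then show ?thesis by (simp add: \<zeta>_def mult_ac)
  qed
  \<comment> \<open>The scale \<open>s\<close> with \<open>s powr m i0 = norm t\<close>: rescaled by
    it, the moving coordinate has modulus 1 and the fixed ones tend to zero.\<close>
  define rad where "rad t = norm t powr (1 / m i0)" for t :: complex
  have rad: "rad t \<ge> 1" "rad t powr m i0 = norm t" if "norm t \<ge> 1" for t
    using that m[of i0] by (auto simp: rad_def powr_powr ge_one_powr_ge_zero)
  define E where "E = 1 + norm (y a)"
  have E: "norm (\<eta> j) \<le> E" "E \<ge> 1" for j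
    using Finite_Cartesian_Product.norm_nth_le[of "y a" j] by (auto simp: E_def \<eta>_def)
  have y_bound: "norm (partial i F x) \<le> E * rad t powr (1 - l $ i)"
    if t: "norm t \<ge> 1" and x: "x \<in> y -` {Y t}" for t x i
  proof (cases "i = i0")
    case True
    have "partial i F x = t" using x True Yi0[of t] yi[of x i0] by simp
    then show ?thesis using rad[OF t] E(2) t True by (simp add: m_def mult_right_mono[of 1 E "norm t", simplified])
  next
    case False
    then have "partial i F x = \<eta> i" using x Yj[of i t] yi[of x i] by simp
    moreover have "1 \<le> rad t powr (1 - l $ i)" using rad(1)[OF t] m[of i] by (simp add: m_def ge_one_powr_ge_zero)
    ultimately show ?thesis using E(1)[of i] E(2) mult_mono[of "norm (\<eta> i)" E 1 "rad t powr (1 - l $ i)"] by simp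
  qed
  obtain C0 where C0: "C0 > 0" "\<And>s x i. s > 0 \<Longrightarrow> (\<And>i. norm (partial i F x) \<le> E * s powr (1 - l $ i)) \<Longrightarrow> norm (x $ i) \<le> C0 * s powr (l $ i)"
    using gradient_fibre_growth[OF F hom iso l, of E] by blast
  have x_bound: "norm (x $ i) \<le> C0 * rad t powr (l $ i)" if t: "norm t \<ge> 1" and x: "x \<in> y -` {Y t}" for t x i
    by (rule C0(2)) (use rad(1)[OF t] y_bound[OF t x] in auto)
  define C1 where "C1 = 1 + (\<Sum>j\<in>UNIV - {i0}. m j * E * C0)"
  have C1: "C1 > 0" unfolding C1_def using m E C0 by (intro add_pos_nonneg sum_nonneg mult_nonneg_nonneg) (auto intro: less_imp_le order_trans[of 0 1 E])
  have \<zeta>_bound: "norm (\<zeta> x) \<le> C1 * norm t powr \<theta>" if t: "norm t \<ge> 1" and x: "x \<in> y -` {Y t}" for t x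
  proof -
    have "norm (\<zeta> x) \<le> (\<Sum>j\<in>UNIV - {i0}. norm (of_real (m j) * \<eta> j * x $ j))"
      unfolding \<zeta>_def by (rule norm_sum)
    also have "\<dots> \<le> (\<Sum>j\<in>UNIV - {i0}. m j * E * C0 * norm t powr \<theta>)"
    proof (rule sum_mono)
      fix j assume j: "j \<in> UNIV - {i0}"
      have "rad t powr (l $ j) = norm t powr (l $ j / m i0)" by (simp add: rad_def powr_powr)
      also have "\<dots> \<le> norm t powr \<theta>" using t \<theta>(3)[of j] j by (intro powr_mono) auto
      finally have "norm (x $ j) \<le> C0 * norm t powr \<theta>"
        using x_bound[OF t x, of j] C0(1) mult_left_mono[of "rad t powr (l $ j)" "norm t powr \<theta>" C0] by linarith
      then have "m j * norm (\<eta> j) * norm (x $ j) \<le> m j * E * (C0 * norm t powr \<theta>)"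
        using m[of j] E by (intro mult_mono) (auto intro: less_imp_le order_trans[of 0 1 E])
      then show "norm (of_real (m j) * \<eta> j * x $ j) \<le> m j * E * C0 * norm t powr \<theta>"
        using m[of j] by (simp add: norm_mult mult.assoc)
    qed
    also have "\<dots> \<le> C1 * norm t powr \<theta>" unfolding C1_def by (simp add: sum_distrib_right distrib_right)
    finally show ?thesis .
  qed
  \<comment> \<open>Rescaled points of the fibres over \<open>t \<rightarrow> \<infinity>\<close> accumulate at the polar curve, where \<open>z\<close> vanishes by \<open>H\<close>.\<close>
  have z_small: "\<exists>B. \<forall>t. norm t \<ge> B \<longrightarrow> (\<forall>x\<in>y -` {Y t}. norm (z x) \<le> \<delta> * norm t powr (1 / m i0))"
    if \<delta>: "\<delta> > 0" for \<delta>
  proof (rule ccontr)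
    assume "\<not> ?thesis"
    then have "\<forall>n. \<exists>t x. norm t \<ge> real n + 1 \<and> x \<in> y -` {Y t} \<and> norm (z x) > \<delta> * norm t powr (1 / m i0)"
      by (metis not_le)
    from choice[OF this] obtain T where "\<forall>n. \<exists>x. norm (T n) \<ge> real n + 1 \<and> x \<in> y -` {Y (T n)} \<and> norm (z x) > \<delta> * norm (T n) powr (1 / m i0)" ..
    from choice[OF this] obtain X where TX: "\<And>n. norm (T n) \<ge> real n + 1" "\<And>n. X n \<in> y -` {Y (T n)}"
      "\<And>n. norm (z (X n)) > \<delta> * norm (T n) powr (1 / m i0)"
      by blast
    have T1: "norm (T n) \<ge> 1" for n using TX(1)[of n] by simp
    define s where "s n = rad (T n)" for n
    have s: "s n \<ge> 1" "s n > 0" for n using rad(1)[OF T1] by (auto simp: s_def intro: less_le_trans[of 0 1])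
    define W where "W n = wscale l (1 / s n) (X n)" for n
    have XW: "X n = wscale l (s n) (W n)" for n using s[of n] by (simp add: W_def wscale_wscale wscale_one)
    have pW: "partial i F (X n) = of_real (s n powr (1 - l $ i)) * partial i F (W n)" for i n
      unfolding XW by (rule qhomogeneous_partial[OF F hom s(2)])
    have zW: "z (X n) = of_real (s n) * z (W n)" for n
    proof -
      have "of_real (m i) * X n $ i * y (X n) $ i = of_real (s n) * (of_real (m i) * W n $ i * y (W n) $ i)" for i
      proof -
        have "complex_of_real (s n) = of_real (s n powr (l $ i)) * of_real (s n powr (1 - l $ i))"
          unfolding of_real_mult[symmetric] using s(2)[of n] by (simp flip: powr_add)
        then show ?thesis unfolding yi pW by (simp add: XW mult_ac)
      qed
      then show ?thesis by (simp only: z_def sum_distrib_left)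
    qed
    have "norm (W n $ i) \<le> C0" for n i
      using x_bound[OF T1 TX(2), of n i] s(2)[of n] by (simp add: XW norm_mult s_def[symmetric])
    then have "norm (W n) \<le> real CARD('n) * C0" for n
      using L2_set_le_sum[of UNIV "\<lambda>i. norm (W n $ i)"] sum_bounded_above[of UNIV "\<lambda>i. norm (W n $ i)" C0]
      unfolding norm_vec_def by force
    then have "bounded (range W)" by (auto simp: bounded_iff)
    then obtain w r where r: "strict_mono (r :: nat \<Rightarrow> nat)" "(W \<circ> r) \<longlonglongrightarrow> w"
      using bounded_imp_convergent_subsequence by blast
    have lim: "(\<lambda>n. q (W (r n))) \<longlonglongrightarrow> q w" if "mpoly q" for q
    proof -
      have "isCont q w" using mpoly_continuous[OF that, of UNIV] by (simp add: continuous_on_eq_continuous_at)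
      from isCont_tendsto_compose[OF this r(2)] show ?thesis by (simp add: o_def)
    qed
    have sinf: "filterlim (\<lambda>n. s (r n)) at_top sequentially"
    proof -
      have "filterlim (\<lambda>n. norm (T n)) at_top sequentially"
      proof (rule filterlim_at_top_mono[OF filterlim_real_sequentially always_eventually], rule allI)
        show "real n \<le> norm (T n)" for n using TX(1)[of n] by simp
      qed
      then have "filterlim (\<lambda>n. s n) at_top sequentially" unfolding s_def rad_def
        using filterlim_compose[OF real_powr_at_top[of "1 / m i0"]] m[of i0] by auto
      then show ?thesis using filterlim_compose[OF _ filterlim_subseq[OF r(1)]] by blast
    qed
    have "partial j F w = 0" if j: "j \<noteq> i0" for j
    proof -
      have bnd: "norm (partial j F (W (r n))) \<le> norm (\<eta> j) * s (r n) powr (- m j)" for n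
      proof -
        have "partial j F (X (r n)) = \<eta> j" using TX(2)[of "r n"] Yj[OF j, of "T (r n)"] yi[of "X (r n)" j] by simp
        then have "\<eta> j = of_real (s (r n) powr m j) * partial j F (W (r n))"
          by (simp add: pW m_def)
        then have "norm (\<eta> j) = s (r n) powr m j * norm (partial j F (W (r n)))"
          by (simp add: norm_mult m_def pW)
        then show ?thesis using s(2)[of "r n"] by (simp add: powr_minus field_simps)
      qed
      have "(\<lambda>n. norm (\<eta> j) * s (r n) powr (- m j)) \<longlonglongrightarrow> norm (\<eta> j) * 0"
        using m[of j] sinf by (intro tendsto_mult tendsto_const tendsto_neg_powr) auto
      then have "(\<lambda>n. norm (\<eta> j) * s (r n) powr (- m j)) \<longlonglongrightarrow> 0" by simp
      from Lim_null_comparison[OF always_eventually[OF allI[OF bnd]] this]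
      have "(\<lambda>n. partial j F (W (r n))) \<longlonglongrightarrow> 0" .
      then show ?thesis using lim[OF mpoly_partial[OF F]] LIMSEQ_unique by blast
    qed
    then have "w $ i0 = 0" "\<And>j. j \<noteq> i0 \<Longrightarrow> y w $ j = 0" using H by (auto simp: yi)
    then have "z w = 0" unfolding z_def by (intro sum.neutral) (metis mult_zero_left mult_zero_right)
    then have "(\<lambda>n. norm (z (W (r n)))) \<longlonglongrightarrow> 0" using tendsto_norm[OF lim[OF z]] by simp
    moreover have "norm (z (W n)) \<ge> \<delta>" for n
      using TX(3)[of n] s(2)[of n] by (simp add: zW norm_mult s_def[symmetric] rad_def[symmetric] mult.commute)
    ultimately have "\<delta> \<le> 0" by (intro LIMSEQ_le_const) auto
    then show False using \<delta> by simp
  qed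
  have notD: "t \<notin> D" if "norm t \<ge> RD" for t using RD[of t] that by auto
  have tr_bound: "norm (tr y (\<lambda>x. g x) (Y t)) \<le> real N * M" if "t \<notin> D" "\<And>x. x \<in> y -` {Y t} \<Longrightarrow> norm (g x) \<le> M" for g t M
    unfolding tr_def using sum_norm_bound[of "y -` {Y t}" g M] that cardN by simp
  have ext: "\<exists>h. h holomorphic_on UNIV \<and> (\<forall>t. t \<notin> D \<longrightarrow> h t = tr y g (Y t))" if "mpoly g" for g
    using tr_line_extends[OF pc that, of Y0 "\<eta> i0" v] a Ya unfolding D_def Y_def by auto
  have p_small: "\<exists>B. \<forall>t. norm t \<ge> B \<longrightarrow> norm (p k t) \<le> \<delta> * norm t powr (real k / m i0)"
    if k: "k \<ge> 1" and \<delta>: "\<delta> > 0" for k \<delta>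
  proof -
    \<comment> \<open>The cap 1 gives \<open>\<epsilon> ^ k \<le> \<epsilon>\<close>, and division
      by \<open>N\<close> allows for the number of points in the fibre.\<close>
    define \<epsilon> where "\<epsilon> = min 1 (\<delta> / N)"
    have \<epsilon>: "\<epsilon> > 0" "\<epsilon> \<le> 1" "real N * \<epsilon> \<le> \<delta>" using \<delta> N1 by (auto simp: \<epsilon>_def min_def field_simps)
    obtain B where B: "\<And>t x. norm t \<ge> B \<Longrightarrow> x \<in> y -` {Y t} \<Longrightarrow> norm (z x) \<le> \<epsilon> * norm t powr (1 / m i0)"
      using z_small[OF \<epsilon>(1)] by blast
    have "norm (p k t) \<le> \<delta> * norm t powr (real k / m i0)" if t: "norm t \<ge> max 1 (max B RD)" for t
    proof -
      have "norm (p k t) \<le> real N * (\<epsilon> * norm t powr (1 / m i0)) ^ k"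
        unfolding p_def using t by (intro tr_bound notD) (auto simp: norm_power intro!: power_mono B)
      also have "\<dots> = real N * \<epsilon> ^ k * norm t powr (real k / m i0)"
      proof -
        have "t \<noteq> 0" using t by auto
        then have "(norm t powr (1 / m i0)) ^ k = norm t powr (real k / m i0)"
          by (subst powr_power) simp_all
        then show ?thesis by (simp only: power_mult_distrib mult.assoc)
      qed
      also have "\<dots> \<le> \<delta> * norm t powr (real k / m i0)"
      proof (rule mult_right_mono)
        have "\<epsilon> ^ k \<le> \<epsilon>" using \<epsilon> k power_decreasing[of 1 k \<epsilon>] by simp
        then show "real N * \<epsilon> ^ k \<le> \<delta>" using \<epsilon>(3) mult_left_mono[of "\<epsilon> ^ k" \<epsilon> "real N"] by simp
      qed simp
      finally show ?thesis .
    qed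
    then show ?thesis by blast
  qed
  have "\<exists>P. \<forall>t. t \<notin> D \<longrightarrow> p k t = poly P t" if k: "k \<ge> 1" for k
  proof -
    obtain h where h: "h holomorphic_on UNIV" "\<And>t. t \<notin> D \<Longrightarrow> h t = p k t"
      using ext[OF mpoly_power[OF z, of k]] unfolding p_def by blast
    obtain B where B: "\<And>t. norm t \<ge> B \<Longrightarrow> norm (p k t) \<le> 1 * norm t powr (real k / m i0)"
      using p_small[OF k, of 1] by auto
    define n where "n = nat \<lceil>real k / m i0\<rceil>"
    have hb: "norm (h t) \<le> 1 * norm t ^ n" if t: "norm t \<ge> max 1 (max B RD)" for t
    proof -
      have t0: "t \<noteq> 0" using t by auto
      have "norm (h t) \<le> norm t powr (real k / m i0)" using h(2)[OF notD, of t] B[of t] t by simp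
      also have "\<dots> \<le> norm t powr real n" using t unfolding n_def by (intro powr_mono real_nat_ceiling_ge) auto
      also have "\<dots> = 1 * norm t ^ n" using t0 by (simp add: powr_realpow)
      finally show ?thesis .
    qed
    have "h t = (\<Sum>i\<le>n. (deriv ^^ i) h 0 / fact i * t ^ i)" for t
      by (rule Liouville_polynomial[OF h(1) hb])
    then have "h t = poly (\<Sum>i\<le>n. monom ((deriv ^^ i) h 0 / fact i) i) t" for t
      by (simp add: poly_sum poly_monom)
    then show ?thesis using h(2) by metis
  qed
  then have "\<forall>k. \<exists>P. k \<ge> 1 \<longrightarrow> (\<forall>t. t \<notin> D \<longrightarrow> p k t = poly P t)" by blast
  from choice[OF this] obtain P where P: "\<And>k t. k \<ge> 1 \<Longrightarrow> t \<notin> D \<Longrightarrow> p k t = poly (P k) t" by blast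
  \<comment> \<open>Power sums of degree at most \<open>\<sigma> * k\<close> bound every branch of
    \<open>z\<close> by a multiple of \<open>norm t powr \<sigma>\<close>, through
    \<open>power_sums_bound\<close>. The maximum is the smallest slope with this property, and some
    \<open>k\<close> attains it.\<close>
  define \<sigma> where "\<sigma> = Max ((\<lambda>k. real (degree (P k)) / real k) ` {1..N})"
  have \<sigma>: "real (degree (P k)) \<le> \<sigma> * real k" if "k \<in> {1..N}" for k
  proof -
    have "real (degree (P k)) / real k \<le> \<sigma>" unfolding \<sigma>_def using that by (intro Max_ge) auto
    then show ?thesis using that by (simp add: field_simps)
  qed
  have "\<sigma> \<in> (\<lambda>k. real (degree (P k)) / real k) ` {1..N}" unfolding \<sigma>_def using N1 by (intro Max_in) auto
  then obtain k where k: "k \<in> {1..N}" "\<sigma> = real (degree (P k)) / real k" by auto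
  have "\<exists>C. \<forall>k t. k \<in> {1..N} \<longrightarrow> norm t \<ge> 1 \<longrightarrow> norm (poly (P k) t) \<le> C * norm t ^ degree (P k)"
  proof -
    have "\<forall>k. \<exists>C>0. \<forall>t. norm t \<ge> 1 \<longrightarrow> norm (poly (P k) t) \<le> C * norm t ^ degree (P k)"
      using poly_growth_upper by blast
    from choice[OF this] obtain C where C: "\<And>k. C k > 0"
      "\<And>k t. norm t \<ge> 1 \<Longrightarrow> norm (poly (P k) t) \<le> C k * norm t ^ degree (P k)" by blast
    have "norm (poly (P k) t) \<le> (\<Sum>k\<in>{1..N}. C k) * norm t ^ degree (P k)" if "k \<in> {1..N}" "norm t \<ge> 1" for k t
    proof -
      have "C k \<le> (\<Sum>k\<in>{1..N}. C k)" using that C(1) by (intro member_le_sum) (auto intro: less_imp_le)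
      then show ?thesis using C(2)[OF that(2), of k] by (meson mult_right_mono norm_ge_zero order_trans zero_le_power)
    qed
    then show ?thesis by blast
  qed
  then obtain C2' where C2': "\<And>k t. k \<in> {1..N} \<Longrightarrow> norm t \<ge> 1 \<Longrightarrow> norm (poly (P k) t) \<le> C2' * norm t ^ degree (P k)" by blast
  \<comment> \<open>At least 1, so that a single factor \<open>C2\<close> is absorbed in
    \<open>C2 ^ k\<close> for every \<open>k \<ge> 1\<close>.\<close>
  define C2 where "C2 = max 1 C2'"
  obtain C3 where C3': "C3 > 0 \<and> (\<forall>(A :: (complex ^ 'n) set) (f :: complex ^ 'n \<Rightarrow> complex) \<mu>. finite A \<longrightarrow> card A = N \<longrightarrow> \<mu> \<ge> 0 \<longrightarrow>
     (\<forall>k\<in>{1..N}. norm (\<Sum>a\<in>A. f a ^ k) \<le> \<mu> ^ k) \<longrightarrow> (\<forall>a\<in>A. norm (f a) \<le> C3 * \<mu>))"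
    using power_sums_bound[of N, where 'a = "complex ^ 'n"] ..
  have C3: "C3 > 0" using C3' by (rule conjunct1)
  have z_bound: "norm (z x) \<le> C3 * C2 * norm t powr \<sigma>" if t: "norm t \<ge> max 1 RD" and x: "x \<in> y -` {Y t}" for t x
  proof -
    have tD: "t \<notin> D" using t by (intro notD) simp
    have t0: "t \<noteq> 0" using t by auto
    have "norm (\<Sum>a\<in>y -` {Y t}. z a ^ k) \<le> (C2 * norm t powr \<sigma>) ^ k" if k: "k \<in> {1..N}" for k
    proof -
      have "norm (\<Sum>a\<in>y -` {Y t}. z a ^ k) = norm (poly (P k) t)" using P[OF _ tD, of k] k by (simp add: p_def tr_def)
      also have "\<dots> \<le> C2 * norm t ^ degree (P k)"
        using C2'[OF k, of t] t mult_right_mono[of C2' C2 "norm t ^ degree (P k)"] by (simp add: C2_def)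
      also have "\<dots> \<le> C2 ^ k * norm t powr (\<sigma> * real k)"
      proof (rule mult_mono)
        have "C2 \<ge> 1" by (simp add: C2_def)
        then show "C2 \<le> C2 ^ k" using k by (intro self_le_power) auto
        have "norm t ^ degree (P k) = norm t powr real (degree (P k))" using t0 by (simp add: powr_realpow)
        also have "\<dots> \<le> norm t powr (\<sigma> * real k)" using t \<sigma>[OF k] by (intro powr_mono) auto
        finally show "norm t ^ degree (P k) \<le> norm t powr (\<sigma> * real k)" .
      qed (auto simp: C2_def)
      also have "\<dots> = (C2 * norm t powr \<sigma>) ^ k" using t0 by (simp add: power_mult_distrib powr_power mult.commute)
      finally show ?thesis .
    qed
    then have "norm (z x) \<le> C3 * (C2 * norm t powr \<sigma>)"
      using C3'[THEN conjunct2, rule_format, of "y -` {Y t}" "C2 * norm t powr \<sigma>" z x] finS[OF tD] cardN[OF tD] x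
      by (simp add: C2_def)
    then show ?thesis by (simp add: mult.assoc)
  qed
  \<comment> \<open>\<open>\<sigma>\<close> is the growth order of \<open>z\<close> on the fibres. If it is attained by the power sum \<open>P k\<close>, then the
    polynomial \<open>Q = m t P' - k P\<close> still has the degree of \<open>P\<close>, since \<open>m deg P \<noteq> k\<close>, whereas \<open>z\<close> enters it only
    to the power \<open>k - 1\<close>.\<close>
  have "\<sigma> \<le> \<theta>"
  proof (cases "P k = 0")
    case True
    then show ?thesis using k \<theta>(2) by simp
  next
    case False
    \<comment> \<open>The strict inequality rules out the resonance \<open>m deg P = k\<close>, at
      which the leading term of \<open>Q\<close> would cancel. It holds because \<open>z\<close> is
      of smaller order than \<open>norm t powr (1 / m i0)\<close>.\<close>
    have "real (degree (P k)) < real k / m i0"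
    proof (rule poly_degree_less_growth[OF False])
      fix \<delta> :: real assume "\<delta> > 0"
      then obtain B where B: "\<And>t. norm t \<ge> B \<Longrightarrow> norm (p k t) \<le> \<delta> * norm t powr (real k / m i0)"
        using p_small[of k \<delta>] k(1) by auto
      have "norm (poly (P k) t) \<le> \<delta> * norm t powr (real k / m i0)" if "norm t \<ge> max B RD" for t
        using B[of t] P[of k t] notD[of t] that k(1) by simp
      then show "\<exists>B. \<forall>t. norm t \<ge> B \<longrightarrow> norm (poly (P k) t) \<le> \<delta> * norm t powr (real k / m i0)" by blast
    qed
    then have ne: "m i0 * real (degree (P k)) - real k \<noteq> 0" using m[of i0] by (simp add: field_simps)
    define Q where "Q = smult (of_real (m i0)) (pCons 0 (pderiv (P k))) - smult (of_nat k) (P k)"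
    have "coeff Q (degree (P k)) = of_real (m i0 * real (degree (P k)) - real k) * lead_coeff (P k)"
      by (cases "degree (P k)") (simp_all add: Q_def coeff_pderiv coeff_pCons algebra_simps split: nat.split)
    also have "\<dots> \<noteq> 0" using ne False by (simp only: mult_eq_0_iff of_real_eq_0_iff leading_coeff_0_iff) simp
    finally have "coeff Q (degree (P k)) \<noteq> 0" .
    then have Q0: "Q \<noteq> 0" and dQ: "degree (P k) \<le> degree Q" by (auto intro: le_degree)
    have Qt: "poly Q t = - of_nat k * (\<Sum>x\<in>y -` {Y t}. z x ^ (k - 1) * \<zeta> x)" if t: "t \<notin> D" for t
    proof -
      have "\<forall>\<^sub>F s in nhds t. p k s = poly (P k) s"
      proof -
        have "open (- D)" using finD by (simp add: finite_imp_closed open_Compl)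
        then have "\<forall>\<^sub>F s in nhds t. s \<in> - D" using t by (intro eventually_nhds_in_open) auto
        then show ?thesis by eventually_elim (use P k(1) in auto)
      qed
      then have "(poly (P k) has_field_derivative (\<Sum>x\<in>y -` {Y t}. of_nat k * z x ^ (k - 1) * x $ i0)) (at t)"
        using p_deriv[OF t, of k] DERIV_cong_ev[OF refl _ refl] by blast
      then have pd: "poly (pderiv (P k)) t = (\<Sum>x\<in>y -` {Y t}. of_nat k * z x ^ (k - 1) * x $ i0)"
        using poly_DERIV DERIV_unique by blast
      have pk: "poly (P k) t = (\<Sum>x\<in>y -` {Y t}. z x ^ k)" using P[OF _ t, of k] k(1) by (simp add: p_def tr_def)
      have "poly Q t = (\<Sum>x\<in>y -` {Y t}. of_nat k * z x ^ (k - 1) * (of_real (m i0) * t * x $ i0) - of_nat k * z x ^ k)"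
        by (simp add: Q_def pd pk sum_distrib_left sum_subtractf mult_ac)
      also have "\<dots> = (\<Sum>x\<in>y -` {Y t}. - of_nat k * (z x ^ (k - 1) * \<zeta> x))"
      proof (rule sum.cong[OF refl])
        fix x assume "x \<in> y -` {Y t}"
        moreover have "z x ^ k = z x ^ (k - 1) * z x" using k(1) by (cases k) auto
        ultimately show "of_nat k * z x ^ (k - 1) * (of_real (m i0) * t * x $ i0) - of_nat k * z x ^ k
          = - of_nat k * (z x ^ (k - 1) * \<zeta> x)"
          by (simp only: z_split) (simp add: algebra_simps)
      qed
      finally show ?thesis by (simp add: sum_distrib_left)
    qed
    \<comment> \<open>Combined with \<open>degree (P k) = \<sigma> * k\<close> and
      \<open>degree (P k) \<le> degree Q\<close>, this leaves
      \<open>\<sigma> \<le> \<theta>\<close>.\<close>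
    have "real (degree Q) \<le> \<sigma> * real (k - 1) + \<theta>"
    proof (rule poly_degree_le_growth[OF Q0])
      fix t :: complex assume t: "max 1 RD \<le> norm t"
      have tD: "t \<notin> D" using t by (intro notD) simp
      have t1: "norm t \<ge> 1" using t by simp
      then have t0: "t \<noteq> 0" by auto
      have "norm (\<Sum>x\<in>y -` {Y t}. z x ^ (k - 1) * \<zeta> x)
        \<le> real N * ((C3 * C2 * norm t powr \<sigma>) ^ (k - 1) * (C1 * norm t powr \<theta>))"
        unfolding cardN[OF tD, symmetric]
        using z_bound[OF t] \<zeta>_bound[OF t1] C3
        by (intro sum_norm_bound) (auto simp: norm_mult norm_power C2_def intro!: mult_mono power_mono)
      also have "\<dots> = real N * (C3 * C2) ^ (k - 1) * C1 * norm t powr (\<sigma> * real (k - 1) + \<theta>)"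
        using t0 by (simp add: power_mult_distrib powr_power powr_add mult_ac)
      finally show "norm (poly Q t) \<le> (real k * (real N * (C3 * C2) ^ (k - 1) * C1)) * norm t powr (\<sigma> * real (k - 1) + \<theta>)"
        unfolding Qt[OF tD] norm_mult norm_minus_cancel norm_of_nat by (simp add: mult_left_mono mult.assoc)
    qed
    moreover have "real (degree (P k)) = \<sigma> * real k" using k by simp
    moreover have "\<sigma> * real k = \<sigma> * real (k - 1) + \<sigma>" using k(1) by (cases k) (auto simp: algebra_simps)
    ultimately show ?thesis using dQ by linarith
  qed
  have x0_bound: "norm (x $ i0) \<le> (C3 * C2 + C1) / m i0 * norm t powr (\<theta> - 1)"
    if t: "norm t \<ge> max 1 RD" and x: "x \<in> y -` {Y t}" for t x
  proof -
    have t1: "norm t \<ge> 1" using t by simp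
    have "norm (z x) \<le> C3 * C2 * norm t powr \<theta>"
    proof -
      have "norm t powr \<sigma> \<le> norm t powr \<theta>" using t1 \<open>\<sigma> \<le> \<theta>\<close> by (intro powr_mono)
      moreover have "C3 * C2 \<ge> 0" using C3 by (simp add: C2_def)
      ultimately show ?thesis using z_bound[OF t x] by (meson mult_left_mono order_trans)
    qed
    moreover have "norm (of_real (m i0) * t * x $ i0) \<le> norm (z x) + norm (\<zeta> x)"
      unfolding z_split[OF x] by (rule norm_triangle_ineq4)
    ultimately have le: "norm (x $ i0) * (m i0 * norm t) \<le> (C3 * C2 + C1) * norm t powr \<theta>"
      using \<zeta>_bound[OF t1 x] m[of i0] by (simp add: norm_mult algebra_simps)
    have "m i0 * norm t > 0" using t1 m[of i0] by (intro mult_pos_pos) auto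
    then have "norm (x $ i0) \<le> (C3 * C2 + C1) * norm t powr \<theta> / (m i0 * norm t)"
      using le by (simp only: pos_le_divide_eq)
    moreover have "norm t powr (\<theta> - 1) = norm t powr \<theta> / norm t" using t1 by (simp add: powr_diff)
    then have "(C3 * C2 + C1) * norm t powr \<theta> / (m i0 * norm t) = (C3 * C2 + C1) / m i0 * norm t powr (\<theta> - 1)"
      by simp
    ultimately show ?thesis by (simp only:)
  qed
  have "(\<Sum>x\<in>y -` {Y (\<eta> i0)}. (x $ i0) ^ k) = 0" if k: "k \<in> {1..card (y -` {Y (\<eta> i0)})}" for k
  proof -
    have k1: "k \<ge> 1" using k by simp
    obtain h where h: "h holomorphic_on UNIV" "\<And>t. t \<notin> D \<Longrightarrow> h t = tr y (\<lambda>x. (x $ i0) ^ k) (Y t)"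
      using ext[OF mpoly_power[OF mpoly_coord[of i0], of k]] by blast
    define K where "K = (C3 * C2 + C1) / m i0"
    have "(h \<longlongrightarrow> 0) at_infinity"
    proof (rule Lim_null_comparison)
      have "norm (h t) \<le> real N * (K * norm t powr (\<theta> - 1)) ^ k" if "norm t \<ge> max 1 RD" for t
        using h(2)[OF notD, of t] that x0_bound[OF that]
        by (simp add: K_def) (intro tr_bound notD, auto simp: norm_power intro!: power_mono)
      then show "\<forall>\<^sub>F t in at_infinity. norm (h t) \<le> real N * (K * norm t powr (\<theta> - 1)) ^ k"
        unfolding eventually_at_infinity by blast
      have "((\<lambda>t::complex. norm t powr (\<theta> - 1)) \<longlongrightarrow> 0) at_infinity"
        using \<theta>(1) by (intro tendsto_neg_powr filterlim_norm_at_top) auto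
      then have "((\<lambda>t::complex. real N * (K * norm t powr (\<theta> - 1)) ^ k) \<longlongrightarrow> real N * (K * 0) ^ k) at_infinity"
        by (intro tendsto_mult tendsto_power tendsto_const)
      moreover have "real N * (K * 0) ^ k = 0" using k1 by (cases k) simp_all
      ultimately show "((\<lambda>t::complex. real N * (K * norm t powr (\<theta> - 1)) ^ k) \<longlongrightarrow> 0) at_infinity"
        by (simp only:)
    qed
    then have "h (\<eta> i0) = 0" by (rule Liouville_weak_0[OF h(1)])
    then show ?thesis using h(2)[of "\<eta> i0"] a(2) by (simp add: D_def Ya tr_def)
  qed
  then have "a $ i0 = 0"
    using power_sums_zero[of "y -` {Y (\<eta> i0)}" "\<lambda>x. x $ i0" a] finS[of "\<eta> i0"] a(2) by (simp add: D_def Ya)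
  with a(1) show False by simp
qed

subsection \<open>Convergent expansions\<close>

lemma partial_local:
  assumes "open U" "x \<in> U" "\<And>z. z \<in> U \<Longrightarrow> f z = g z"
  shows "partial i f x = partial i g x"
proof -
  have line: "x + axis i t = x + t *s axis i 1" for t :: complex by (simp add: vec_eq_iff axis_def)
  have "open ((\<lambda>t. x + t *s axis i 1) -` U)" by (rule open_vimage[OF assms(1) continuous_on_line])
  then have "\<forall>\<^sub>F t in nhds 0. t \<in> (\<lambda>t. x + t *s axis i 1) -` U"
    using assms(2) by (intro eventually_nhds_in_open) auto
  then have "\<forall>\<^sub>F t in nhds 0. f (x + axis i t) = g (x + axis i t)"
    by eventually_elim (use assms(3) in \<open>auto simp: line\<close>)
  then show ?thesis unfolding partial_def by (intro deriv_cong_ev) auto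
qed

lemma mpoly_axis_differentiable:
  assumes "mpoly p"
  shows "(\<lambda>t. p (x + axis i t)) field_differentiable at 0"
proof -
  have line: "x + axis i t = x + t *s axis i 1" for t :: complex by (simp add: vec_eq_iff axis_def)
  obtain q where "\<And>t. p (x + t *s axis i 1) = poly q t" using mpoly_line[OF assms] by blast
  then have "(\<lambda>t. p (x + axis i t)) = poly q" by (auto simp: line)
  then show ?thesis using poly_DERIV field_differentiable_def by metis
qed

lemma partial_add_differentiable:
  assumes "(\<lambda>t. f (x + axis i t)) field_differentiable at 0" "(\<lambda>t. g (x + axis i t)) field_differentiable at 0"
  shows "partial i (\<lambda>z. f z + g z) x = partial i f x + partial i g x"
  unfolding partial_def using assms by (rule deriv_add)

text \<open>The Cauchy estimate on a disc of radius \<open>s ^ l\<^sub>i\<close> bounds the partial derivatives of a germ of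
  weighted order at least \<open>d\<close> without differentiating its expansion termwise.\<close>

lemma expansion_partial_bound:
  fixes g :: "complex ^ 'n::finite \<Rightarrow> complex"
  assumes ex: "has_expansion g c" and l: "\<And>i. 0 < l $ i" and d: "\<And>a. c a \<noteq> 0 \<Longrightarrow> d \<le> weighted_deg l a"
  shows "\<exists>C>0. \<exists>s0>0. \<forall>s x i. 0 < s \<longrightarrow> s < s0 \<longrightarrow> (\<forall>k. norm (x $ k) \<le> s powr (l $ k)) \<longrightarrow>
    (\<lambda>t. g (x + axis i t)) field_differentiable at 0 \<and> norm (partial i g x) \<le> C * s powr (d - l $ i)"
proof -
  obtain U where U: "open U" "0 \<in> U" "\<And>z. z \<in> U \<Longrightarrow> ((\<lambda>a. c a * monom_at a z) has_sum g z) UNIV"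
    using ex unfolding has_expansion_def eventually_nhds by blast
  obtain r where r: "r > 0" "ball 0 r \<subseteq> U" using U(1,2) by (rule openE)
  \<comment> \<open>Coordinates of modulus at most \<open>R\<close> add up to at most
    \<open>r / 2\<close>, so the closed polydisc of radius \<open>R\<close> lies inside the
    ball.\<close>
  define R where "R = r / (2 * real CARD('n))"
  have R: "R > 0" using r(1) by (simp add: R_def)
  have inU: "z \<in> U" if "\<And>k. norm (z $ k) \<le> R" for z
  proof -
    have "norm z \<le> (\<Sum>k\<in>UNIV. norm (z $ k))" by (rule norm_le_sum_components)
    also have "\<dots> \<le> (\<Sum>k\<in>(UNIV :: 'n set). R)" by (intro sum_mono that)
    also have "\<dots> < r" using r(1) by (simp add: R_def)
    finally show ?thesis using r(2) by auto
  qed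
  define z0 :: "complex ^ 'n" where "z0 = (\<chi> k. of_real R)"
  define m where "m a = norm (c a) * (\<Prod>k\<in>UNIV. R ^ a k)" for a
  have "z0 \<in> U" using R by (intro inU) (simp add: z0_def)
  then have "(\<lambda>a. c a * monom_at a z0) summable_on UNIV" using U(3) has_sum_imp_summable by blast
  moreover have "norm (c a * monom_at a z0) = m a" for a
    using R by (simp add: m_def z0_def monom_at_def norm_mult norm_power flip: prod_norm)
  ultimately have m_sum: "m summable_on UNIV"
    using summable_on_iff_abs_summable_on_complex[of "\<lambda>a. c a * monom_at a z0" UNIV] by simp
  define M where "M = 1 + (\<Sum>\<^sub>\<infinity>a. m a)"
  have m0: "m a \<ge> 0" for a using R by (simp add: m_def prod_nonneg)
  have M: "M > 0" using infsum_nonneg[of UNIV m] m0 by (simp add: M_def add_pos_nonneg)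
  \<comment> \<open>Halving \<open>R\<close> leaves room for a disc of radius
    \<open>s powr (l $ i)\<close> about a point whose coordinates are already of that size.\<close>
  define s0 where "s0 = Min (range (\<lambda>k. (R / 2) powr (1 / l $ k)))"
  have s0: "s0 > 0" unfolding s0_def using R by (subst Min_gr_iff) auto
  have s0R: "2 * s0 powr (l $ k) \<le> R" for k
  proof -
    have "s0 \<le> (R / 2) powr (1 / l $ k)" unfolding s0_def by (rule Min_le) auto
    then have "s0 powr (l $ k) \<le> ((R / 2) powr (1 / l $ k)) powr (l $ k)"
      using s0 l[of k] by (intro powr_mono2) auto
    also have "\<dots> = R / 2" using R l[of k] by (simp add: powr_powr)
    finally show ?thesis by simp
  qed
  define C where "C = M * s0 powr (- d)"
  have "(\<lambda>t. g (x + axis i t)) field_differentiable at 0 \<and> norm (partial i g x) \<le> C * s powr (d - l $ i)"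
    if s: "0 < s" "s < s0" and x: "\<And>k. norm (x $ k) \<le> s powr (l $ k)" for s x i
  proof -
    define \<rho> where "\<rho> = s powr (l $ i)"
    have \<rho>: "\<rho> > 0" using s by (simp add: \<rho>_def)
    have le2: "norm ((x + axis i t) $ k) \<le> 2 * s powr (l $ k)" if "t \<in> cball 0 \<rho>" for t k
    proof (cases "k = i")
      case True
      then show ?thesis using x[of k] that norm_triangle_ineq[of "x $ k" t] by (simp add: axis_def \<rho>_def)
    next
      case False
      then have "norm ((x + axis i t) $ k) \<le> s powr (l $ k)" using x[of k] by (simp add: axis_def)
      also have "\<dots> \<le> 2 * s powr (l $ k)" by simp
      finally show ?thesis .
    qed
    have sR: "2 * s powr (l $ k) \<le> R" for k
      using powr_mono2[of "l $ k" s s0] s l[of k] s0R[of k] by simp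
    have tU: "x + axis i t \<in> U" if "t \<in> cball 0 \<rho>" for t
      by (rule inU) (rule order_trans[OF le2[OF that] sR])
    \<comment> \<open>Comparison with the point whose coordinates all equal \<open>R\<close>:
      coordinate \<open>k\<close> shrinks by the factor \<open>(s / s0) powr (l $ k)\<close>, a
      monomial by \<open>s / s0\<close> to its weighted degree, and since \<open>s < s0\<close> that
      exponent may be lowered to the common \<open>d\<close>.\<close>
    have term_le: "norm (c a * monom_at a (x + axis i t)) \<le> (s / s0) powr d * m a" if t: "t \<in> cball 0 \<rho>" for a t
    proof (cases "c a = 0")
      case True
      then show ?thesis using m0[of a] by simp
    next
      case False
      have "norm (monom_at a (x + axis i t)) = (\<Prod>k\<in>UNIV. norm ((x + axis i t) $ k) ^ a k)"
        by (simp add: monom_at_def norm_power flip: prod_norm)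
      also have "\<dots> \<le> (\<Prod>k\<in>UNIV. ((s / s0) powr (l $ k) * R) ^ a k)"
      proof (intro prod_mono conjI power_mono)
        fix k
        have "norm ((x + axis i t) $ k) \<le> 2 * s powr (l $ k)" by (rule le2[OF t])
        also have "\<dots> = (s / s0) powr (l $ k) * (2 * s0 powr (l $ k))" using s by (simp add: powr_divide)
        also have "\<dots> \<le> (s / s0) powr (l $ k) * R" by (intro mult_left_mono s0R) simp
        finally show "norm ((x + axis i t) $ k) \<le> (s / s0) powr (l $ k) * R" .
      qed auto
      also have "\<dots> = (\<Prod>k\<in>UNIV. ((s / s0) powr (l $ k)) ^ a k) * (\<Prod>k\<in>UNIV. R ^ a k)"
        by (simp add: power_mult_distrib prod.distrib)
      also have "(\<Prod>k\<in>UNIV. ((s / s0) powr (l $ k)) ^ a k) = (s / s0) powr weighted_deg l a"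
        using s s0 by (simp add: powr_power weighted_deg_def powr_sum)
      also have "\<dots> * (\<Prod>k\<in>UNIV. R ^ a k) \<le> (s / s0) powr d * (\<Prod>k\<in>UNIV. R ^ a k)"
        using d[OF False] s s0 R by (intro mult_right_mono powr_mono' prod_nonneg) auto
      finally have "norm (c a) * norm (monom_at a (x + axis i t)) \<le> norm (c a) * ((s / s0) powr d * (\<Prod>k\<in>UNIV. R ^ a k))"
        by (intro mult_left_mono) auto
      then show ?thesis by (simp add: norm_mult m_def mult_ac)
    qed
    have sm: "(\<lambda>a. (s / s0) powr d * m a) summable_on UNIV" by (rule summable_on_cmult_right[OF m_sum])
    have lim: "uniform_limit (cball 0 \<rho>) (\<lambda>X t. \<Sum>a\<in>X. c a * monom_at a (x + axis i t)) (\<lambda>t. g (x + axis i t)) (finite_subsets_at_top UNIV)"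
      by (rule Weierstrass_m_test_general'[OF term_le _ sm]) (use U(3) tU in auto)
    have hol: "(\<lambda>t. \<Sum>a\<in>X. c a * monom_at a (x + axis i t)) holomorphic_on S" for X S
    proof -
      have "(\<lambda>z. if k = i then z else 0) holomorphic_on S" for k
        by (cases "k = i") (auto intro!: holomorphic_intros)
      then show ?thesis unfolding monom_at_def axis_def
        by (intro holomorphic_intros) (simp add: holomorphic_intros)
    qed
    have "continuous_on (cball 0 \<rho>) (\<lambda>t. g (x + axis i t)) \<and> (\<lambda>t. g (x + axis i t)) holomorphic_on ball 0 \<rho>"
      by (rule holomorphic_uniform_limit[OF _ lim])
        (use hol in \<open>auto intro!: always_eventually holomorphic_on_imp_continuous_on\<close>)
    then have cont: "continuous_on (cball 0 \<rho>) (\<lambda>t. g (x + axis i t))"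
      and holg: "(\<lambda>t. g (x + axis i t)) holomorphic_on ball 0 \<rho>" by auto
    have bound: "norm (g (x + axis i t)) \<le> (s / s0) powr d * M" if t: "t \<in> cball 0 \<rho>" for t
    proof -
      have "norm (g (x + axis i t)) \<le> (\<Sum>\<^sub>\<infinity>a. (s / s0) powr d * m a)"
        by (rule norm_infsum_le[OF U(3)[OF tU[OF t]] has_sum_infsum[OF sm]]) (rule term_le[OF t])
      also have "\<dots> = (s / s0) powr d * (\<Sum>\<^sub>\<infinity>a. m a)" by (rule infsum_cmult_right[OF m_sum])
      also have "\<dots> \<le> (s / s0) powr d * M" by (intro mult_left_mono) (auto simp: M_def)
      finally show ?thesis .
    qed
    have "norm ((deriv ^^ 1) (\<lambda>t. g (x + axis i t)) 0) \<le> fact 1 * ((s / s0) powr d * M) / \<rho> ^ 1"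
      by (rule Cauchy_inequality[OF holg cont \<rho>]) (use bound in auto)
    also have "\<dots> = C * s powr (d - l $ i)"
      using s s0 by (simp add: C_def \<rho>_def powr_divide powr_diff powr_minus field_simps)
    finally have "norm (partial i g x) \<le> C * s powr (d - l $ i)" by (simp add: partial_def)
    moreover have "(\<lambda>t. g (x + axis i t)) field_differentiable at 0"
      using holg \<rho> by (auto intro: holomorphic_on_imp_differentiable_at)
    ultimately show ?thesis by blast
  qed
  moreover have "C > 0" using M s0 by (simp add: C_def)
  ultimately show ?thesis using s0
    by (intro exI[of _ C] conjI[of "C > 0"] exI[of _ s0] conjI[of "s0 > 0"] allI impI) simp_all
qed

lemma finite_weighted_deg_le:
  assumes l: "\<And>i. 0 < l $ i"
  shows "finite {a :: 'n::finite \<Rightarrow> nat. weighted_deg l a \<le> d}"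
proof -
  define e where "e = Max (range (\<lambda>i. nat \<lceil>d / l $ i\<rceil>))"
  have "a \<in> exp_box e" if a: "weighted_deg l a \<le> d" for a :: "'n \<Rightarrow> nat"
    unfolding exp_box_def
  proof safe
    fix i
    have nonneg: "0 \<le> real (a k) * l $ k" for k using l[of k] by simp
    have "real (a i) * l $ i \<le> weighted_deg l a" unfolding weighted_deg_def
      by (intro member_le_sum) (use nonneg in auto)
    then have "real (a i) \<le> d / l $ i" using a l[of i] by (simp add: pos_le_divide_eq)
    then have "a i \<le> nat \<lceil>d / l $ i\<rceil>" by linarith
    also have "\<dots> \<le> e" unfolding e_def by (rule Max_ge) auto
    finally show "a i \<le> e" .
  qed
  then have "{a :: 'n \<Rightarrow> nat. weighted_deg l a \<le> d} \<subseteq> exp_box e" by blast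
  then show ?thesis using finite_exp_box finite_subset by blast
qed

lemma mpoly_monom_sum: "mpoly (\<lambda>x. \<Sum>a\<in>A. c a * monom_at a x)"
  by (intro mpoly_sum mpoly_mult mpoly_const mpoly_monom)

lemma wscale_tendsto_0:
  assumes l: "\<And>i. 0 < l $ i"
  shows "((\<lambda>s. wscale l s x) \<longlongrightarrow> 0) (at_right 0)"
proof (rule vec_tendstoI)
  fix i
  have "((\<lambda>s::real. s powr (l $ i)) \<longlongrightarrow> 0) (at_right 0)"
    by (rule powr_tendsto_0_at_right[OF l])
  then have "((\<lambda>s. of_real (s powr (l $ i)) * x $ i) \<longlongrightarrow> of_real 0 * x $ i) (at_right 0)"
    by (intro tendsto_intros)
  then show "((\<lambda>s. wscale l s x $ i) \<longlongrightarrow> 0 $ i) (at_right 0)" by simp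
qed

text \<open>With positive weights only finitely many monomials have weighted degree 1, so the germ
  is a polynomial. A zero of its gradient propagates along the whole scaling orbit, which tends to
  the origin; isolatedness there thus becomes global.\<close>

lemma quasihomogeneous_polynomial:
  fixes f0 :: "complex ^ 'n::finite \<Rightarrow> complex"
  assumes wq: "weakly_quasihomogeneous f0 1 l" and sing: "isolated_singularity f0" and l: "\<And>i. 0 < l $ i"
  shows "\<exists>F. mpoly F \<and> qhomogeneous F l \<and> (\<forall>\<^sub>F z in nhds 0. f0 z = F z) \<and> (\<forall>x. gradient F x = 0 \<longrightarrow> x = 0)"
proof -
  obtain c where c: "has_expansion f0 c" using wq by (auto simp: weakly_quasihomogeneous_def holomorphic_germ_def)
  define A where "A = {a. c a \<noteq> 0}"
  have deg: "weighted_deg l a = 1" if "a \<in> A" for a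
    using wq c that unfolding weakly_quasihomogeneous_def appearing_def A_def by blast
  have finA: "finite A" by (rule finite_subset[OF _ finite_weighted_deg_le[OF l, of 1]]) (use deg in auto)
  define F where "F x = (\<Sum>a\<in>A. c a * monom_at a x)" for x
  have F: "mpoly F" unfolding F_def[abs_def] by (rule mpoly_monom_sum)
  have hom: "qhomogeneous F l"
    unfolding qhomogeneous_def F_def by (auto simp: monom_at_wscale deg sum_distrib_left mult_ac)
  have eq: "\<forall>\<^sub>F z in nhds 0. f0 z = F z"
    using c unfolding has_expansion_def
  proof eventually_elim
    case (elim z)
    have "((\<lambda>a. c a * monom_at a z) has_sum F z) UNIV"
      by (rule has_sum_finite_neutralI[OF finA]) (auto simp: F_def A_def)
    then show ?case using elim has_sum_unique by blast
  qed
  have "x = 0" if x: "gradient F x = 0" for x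
  proof (rule ccontr)
    assume "x \<noteq> 0"
    obtain U where U: "open U" "0 \<in> U" "\<And>z. z \<in> U \<Longrightarrow> f0 z = F z" using eq unfolding eventually_nhds by blast
    have "\<forall>\<^sub>F z in nhds 0. z \<in> U \<and> (z \<noteq> 0 \<longrightarrow> gradient f0 z \<noteq> 0)"
      using sing eventually_nhds_in_open[OF U(1,2)]
      by (auto simp: isolated_singularity_def eventually_at_filter intro: eventually_conj)
    then have "\<forall>\<^sub>F s in at_right 0. wscale l s x \<in> U \<and> (wscale l s x \<noteq> 0 \<longrightarrow> gradient f0 (wscale l s x) \<noteq> 0)"
      by (rule eventually_compose_filterlim[OF _ wscale_tendsto_0[OF l]])
    moreover have "\<forall>\<^sub>F s in at_right (0::real). s > 0" by (simp add: eventually_at_right_less)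
    ultimately have "\<forall>\<^sub>F s in at_right (0::real). False"
    proof eventually_elim
      case (elim s)
      have "wscale l s x \<noteq> 0" using \<open>x \<noteq> 0\<close> elim(2) by (simp add: vec_eq_iff)
      moreover have "gradient f0 (wscale l s x) = 0"
      proof -
        have "partial i f0 (wscale l s x) = 0" for i
        proof -
          have "partial i f0 (wscale l s x) = partial i F (wscale l s x)"
            by (rule partial_local[OF U(1) conjunct1[OF elim(1)] U(3)])
          then show ?thesis using qhomogeneous_partial[OF F hom elim(2), of i x] x
            by (simp add: gradient_def vec_eq_iff)
        qed
        then show ?thesis by (simp add: gradient_def vec_eq_iff)
      qed
      ultimately show ?case using elim(1) by blast
    qed
    then show False by simp
  qed
  then show ?thesis using F hom eq by blast
qed

section \<open>Perturbation of the polar points\<close>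

text \<open>In the applications \<open>q a\<close> is a first or second partial derivative of a
  monomial, and \<open>e a\<close> is the excess of its weighted degree over 1.\<close>

lemma perturbation_small:
  assumes A: "finite A" and q: "\<And>a. a \<in> A \<Longrightarrow> mpoly (q a)" and S: "bounded S"
    and e: "\<And>a. a \<in> A \<Longrightarrow> 0 < e a" and \<epsilon>: "\<epsilon> > 0"
  shows "\<forall>\<^sub>F s in at_right (0::real). \<forall>x\<in>S. norm (\<Sum>a\<in>A. c a * of_real (s powr e a) * q a x) \<le> \<epsilon>"
proof -
  have "\<forall>a\<in>A. \<exists>M. \<forall>x\<in>S. norm (q a x) \<le> M" using mpoly_bounded[OF q S] by blast
  from bchoice[OF this] obtain M where M: "\<And>a x. a \<in> A \<Longrightarrow> x \<in> S \<Longrightarrow> norm (q a x) \<le> M a" by blast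
  have "((\<lambda>s::real. s powr e a) \<longlongrightarrow> 0) (at_right 0)" if "a \<in> A" for a
    by (rule powr_tendsto_0_at_right[OF e[OF that]])
  then have "((\<lambda>s::real. \<Sum>a\<in>A. norm (c a) * s powr e a * M a) \<longlongrightarrow> (\<Sum>a\<in>A. norm (c a) * 0 * M a)) (at_right 0)"
    by (intro tendsto_intros)
  then have "\<forall>\<^sub>F s in at_right (0::real). (\<Sum>a\<in>A. norm (c a) * s powr e a * M a) < \<epsilon>"
    using \<epsilon> by (intro order_tendstoD(2)) auto
  then show ?thesis
  proof eventually_elim
    case (elim s)
    show ?case
    proof
      fix x assume x: "x \<in> S"
      have "norm (\<Sum>a\<in>A. c a * of_real (s powr e a) * q a x) \<le> (\<Sum>a\<in>A. norm (c a * of_real (s powr e a) * q a x))"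
        by (rule norm_sum)
      also have "\<dots> \<le> (\<Sum>a\<in>A. norm (c a) * s powr e a * M a)"
        using M[OF _ x] by (intro sum_mono) (auto simp: norm_mult intro!: mult_left_mono)
      finally show "norm (\<Sum>a\<in>A. c a * of_real (s powr e a) * q a x) \<le> \<epsilon>" using elim by simp
    qed
  qed
qed

text \<open>A polar point \<open>a\<close> of \<open>F\<close> has its gradient \<open>Y0\<close> on
  the axis \<open>i0\<close>. Every solution of the perturbed equation with the same right-hand side
  is again polar, with the same remaining partial derivative, so the task is to solve that equation
  in a region where \<open>x $ i0\<close> stays away from 0.\<close>

lemma polar_point_perturbed:
  fixes F :: "complex ^ 'n::finite \<Rightarrow> complex" and i0 :: 'n
  assumes F: "mpoly F" and hom: "qhomogeneous F l" and iso: "\<And>x. gradient F x = 0 \<Longrightarrow> x = 0"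
    and l: "\<And>i. 0 < l $ i" "\<And>i. l $ i < 1" and l0: "\<And>j. j \<noteq> i0 \<Longrightarrow> l $ i0 + l $ j < 1"
    and A: "finite A" "\<And>a. a \<in> A \<Longrightarrow> 0 < e a"
  shows "\<exists>r>0. \<exists>B M. \<forall>\<^sub>F s in at_right (0::real). \<exists>x. r \<le> norm (x $ i0) \<and> norm x \<le> B \<and>
    (\<forall>j. j \<noteq> i0 \<longrightarrow> partial j (\<lambda>x. F x + (\<Sum>a\<in>A. c a * of_real (s powr e a) * monom_at a x)) x = 0) \<and>
    norm (partial i0 (\<lambda>x. F x + (\<Sum>a\<in>A. c a * of_real (s powr e a) * monom_at a x)) x) \<le> M"
proof -
  define G where "G s = (\<lambda>x. F x + (\<Sum>a\<in>A. c a * of_real (s powr e a) * monom_at a x))" for s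
  have Gpoly: "mpoly (G s)" for s
    unfolding G_def by (intro mpoly_add F mpoly_monom_sum)
  have pG: "partial i (G s) = (\<lambda>x. partial i F x + (\<Sum>a\<in>A. c a * of_real (s powr e a) * partial i (monom_at a) x))" for i s
    unfolding G_def using A(1)
    by (simp add: partial_add F mpoly_monom_sum partial_sum partial_scale mpoly_mult mpoly_const mpoly_monom)
  have ppG: "partial k (partial i (G s)) = (\<lambda>x. partial k (partial i F) x +
      (\<Sum>a\<in>A. c a * of_real (s powr e a) * partial k (partial i (monom_at a)) x))" for k i s
  proof -
    have "mpoly (\<lambda>x. \<Sum>a\<in>A. c a * of_real (s powr e a) * partial i (monom_at a) x)"
      by (intro mpoly_sum mpoly_mult mpoly_const mpoly_partial mpoly_monom)
    then show ?thesis unfolding pG using A(1)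
      by (simp add: partial_add mpoly_partial F partial_sum partial_scale mpoly_mult mpoly_const mpoly_monom)
  qed
  define y where "y = gradient F"
  have ymap: "mpoly_map y" unfolding y_def by (rule gradient_mpoly_map[OF F])
  have bdd: "bounded {x. norm (y x) \<le> B}" for B
    unfolding y_def by (rule gradient_bounded_sublevel[OF F hom iso l])
  obtain \<Delta> where pc: "proper_cover y \<Delta>"
    using gradient_proper_cover[OF F bdd[unfolded y_def]] unfolding y_def by blast
  obtain a where a: "a $ i0 \<noteq> 0" "\<And>j. j \<noteq> i0 \<Longrightarrow> partial j F a = 0"
    using polar_point_ex[OF F hom iso l l0] by blast
  define Y0 where "Y0 = y a"
  have fin: "finite ((\<lambda>x. x $ i0) ` (y -` {Y0}))" by (rule fibre_values_finite[OF pc mpoly_coord])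
  have "infinite {0<..<norm (a $ i0)}" using a(1) by simp
  \<comment> \<open>\<open>Y0\<close> may be a critical value, but \<open>x $ i0\<close> takes only
    finitely many values on its fibre. A radius that avoids their moduli, and a \<open>B\<close>
    that exceeds the norms in the fibre, keep the boundary of \<open>W\<close> free of
    solutions.\<close>
  then obtain r where r: "0 < r" "r < norm (a $ i0)" "r \<notin> norm ` ((\<lambda>x. x $ i0) ` (y -` {Y0}))"
    using fin by (metis finite_imageI finite_subset greaterThanLessThan_iff subsetI)
  obtain B where B: "B > 0" "\<And>x. y x = Y0 \<Longrightarrow> norm x < B"
  proof -
    obtain b where b: "b > 0" "\<And>x. norm (y x) \<le> norm Y0 \<Longrightarrow> norm x \<le> b" using bdd[of "norm Y0"] unfolding bounded_pos by auto
    show ?thesis by (rule that[of "b + 1"]) (use b in \<open>force+\<close>)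
  qed
  define W :: "(complex ^ 'n) set" where "W = {x. r < norm (x $ i0) \<and> norm x < B}"
  have W: "open W" "bounded W"
  proof -
    have "W = {x. r < norm (x $ i0)} \<inter> {x. norm x < B}" by (auto simp: W_def)
    then show "open W" by (simp only:) (intro open_Int open_Collect_less continuous_intros)
    show "bounded W" by (rule boundedI[of _ B]) (simp add: W_def)
  qed
  have aW: "a \<in> W" using r B by (simp add: W_def Y0_def)
  have clW: "r \<le> norm (x $ i0)" "norm x \<le> B" if "x \<in> closure W" for x
  proof -
    have "closed ({x. r \<le> norm (x $ i0)} \<inter> {x. norm x \<le> B})"
      by (intro closed_Int closed_Collect_le continuous_intros)
    then have "closure W \<subseteq> {x. r \<le> norm (x $ i0)} \<inter> {x. norm x \<le> B}"
      by (intro closure_minimal) (auto simp: W_def)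
    then show "r \<le> norm (x $ i0)" "norm x \<le> B" using that by auto
  qed
  have bd: "y x \<noteq> Y0" if "x \<in> closure W - W" for x
  proof
    assume yx: "y x = Y0"
    then have "norm (x $ i0) \<noteq> r" using r(3) by force
    then show False using clW[of x] that B(2)[OF yx] by (auto simp: W_def)
  qed
  have "compact (closure W - W)" using W by (intro compact_diff) auto
  then have "compact (y ` (closure W - W))" by (intro compact_continuous_image mpoly_map_continuous ymap)
  moreover have "Y0 \<notin> y ` (closure W - W)" using bd by blast
  \<comment> \<open>A margin of \<open>2 * \<epsilon>\<close> for \<open>y\<close> leaves at least
    \<open>\<epsilon>\<close> for the perturbed gradient, which differs from \<open>y\<close> by at
    most \<open>\<epsilon> / 2\<close> on the closure of \<open>W\<close>.\<close>
  ultimately obtain \<epsilon> where \<epsilon>: "\<epsilon> > 0" "\<And>x. x \<in> closure W - W \<Longrightarrow> 2 * \<epsilon> \<le> dist (y x) Y0"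
  proof -
    assume "compact (y ` (closure W - W))" and "Y0 \<notin> y ` (closure W - W)"
    then have "open (- (y ` (closure W - W)))" "Y0 \<in> - (y ` (closure W - W))"
      by (auto intro: open_Compl compact_imp_closed)
    then obtain d where d: "d > 0" "ball Y0 d \<subseteq> - (y ` (closure W - W))" by (rule openE)
    have "2 * (d / 2) \<le> dist (y x) Y0" if "x \<in> closure W - W" for x
    proof -
      have "y x \<notin> ball Y0 d" using d(2) that by blast
      then show ?thesis by (simp add: dist_commute)
    qed
    then show ?thesis using that[of "d / 2"] d(1) by simp
  qed
  define n where "n = real CARD('n)"
  have n: "n > 0" by (simp add: n_def)
  have near: "\<forall>\<^sub>F s in at_right (0::real). \<forall>x\<in>closure W. dist (gradient (G s) x) (y x) \<le> \<epsilon> / 2"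
  proof -
    have "\<forall>\<^sub>F s in at_right (0::real). \<forall>i. \<forall>x\<in>closure W.
        norm (\<Sum>a\<in>A. c a * of_real (s powr e a) * partial i (monom_at a) x) \<le> \<epsilon> / (2 * n)"
      using \<epsilon>(1) n W(2) by (intro eventually_all_finite perturbation_small A mpoly_partial mpoly_monom) auto
    then show ?thesis
    proof eventually_elim
      case (elim s)
      show ?case
      proof
        fix x assume x: "x \<in> closure W"
        have "dist (gradient (G s) x) (y x) \<le> (\<Sum>i\<in>UNIV. norm ((gradient (G s) x - y x) $ i))"
          unfolding dist_norm by (rule norm_le_sum_components)
        also have "\<dots> \<le> (\<Sum>i\<in>(UNIV::'n set). \<epsilon> / (2 * n))"
          using elim x by (intro sum_mono) (simp add: gradient_def y_def pG)
        finally show "dist (gradient (G s) x) (y x) \<le> \<epsilon> / 2" using n by (simp add: n_def)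
      qed
    qed
  qed
  \<comment> \<open>Boundedness of sublevel sets is not known for the perturbed gradient. Its
    algebraic independence comes from a single point where the Jacobian of \<open>y\<close> is
    injective, since injectivity survives small perturbations.\<close>
  obtain x0 where x0: "\<Delta> (y x0) \<noteq> 0" using pc by (auto simp: proper_cover_def)
  have inj0: "\<And>v. jac y x0 v = 0 \<Longrightarrow> v = 0" using pc x0 by (auto simp: proper_cover_def)
  have "inj (jac y x0)" using linear_injective_0[OF jac_linear] inj0 by blast
  then obtain \<kappa> where \<kappa>: "\<kappa> > 0" "\<And>v. \<kappa> * norm v \<le> norm (jac y x0 v)"
    using linear_inj_bounded_below_pos[OF jac_linear] by blast
  have injG: "\<forall>\<^sub>F s in at_right (0::real). \<forall>v. jac (gradient (G s)) x0 v = 0 \<longrightarrow> v = 0"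
  proof -
    \<comment> \<open>Entries of this size change the image of \<open>v\<close> under the Jacobian
      by at most \<open>\<kappa> / 2 * norm v\<close>, less than the lower bound
      \<open>\<kappa> * norm v\<close> if \<open>v\<close> is not zero.\<close>
    have "\<forall>\<^sub>F s in at_right (0::real). \<forall>j k. \<forall>x\<in>{x0}.
        norm (\<Sum>a\<in>A. c a * of_real (s powr e a) * partial k (partial j (monom_at a)) x) \<le> \<kappa> / (2 * n * n)"
      using \<kappa>(1) n by (intro eventually_all_finite perturbation_small A mpoly_partial mpoly_monom) auto
    then show ?thesis
    proof eventually_elim
      case (elim s)
      show ?case
      proof (intro allI impI)
        fix v assume v: "jac (gradient (G s)) x0 v = 0"
        have comp: "(\<lambda>x. gradient H x $ j) = partial j H" for H :: "complex ^ 'n \<Rightarrow> complex" and j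
          by (simp add: gradient_def fun_eq_iff)
        define D where "D j k = (\<Sum>a\<in>A. c a * of_real (s powr e a) * partial k (partial j (monom_at a)) x0)" for j k
        have jG: "jac (gradient (G s)) x0 v $ j = jac y x0 v $ j + (\<Sum>k\<in>UNIV. D j k * v $ k)" for j
          unfolding jac_def y_def comp ppG D_def by (simp add: distrib_right sum.distrib)
        then have "jac y x0 v $ j = - (\<Sum>k\<in>UNIV. D j k * v $ k)" for j
          using v by (metis add_eq_0_iff2 zero_index)
        moreover have "norm (- (\<Sum>k\<in>UNIV. D j k * v $ k)) \<le> \<kappa> / (2 * n) * norm v" for j
        proof -
          have "norm (- (\<Sum>k\<in>UNIV. D j k * v $ k)) \<le> (\<Sum>k\<in>UNIV. norm (D j k * v $ k))"
            unfolding norm_minus_cancel by (rule norm_sum)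
          also have "\<dots> \<le> (\<Sum>k\<in>(UNIV::'n set). \<kappa> / (2 * n * n) * norm v)"
            unfolding norm_mult using elim \<kappa>(1) n
            by (intro sum_mono mult_mono Finite_Cartesian_Product.norm_nth_le) (auto simp: D_def)
          also have "\<dots> = \<kappa> / (2 * n) * norm v" using n by (simp add: n_def)
          finally show ?thesis .
        qed
        ultimately have "norm (jac y x0 v) \<le> (\<Sum>j\<in>(UNIV::'n set). \<kappa> / (2 * n) * norm v)"
          by (intro order_trans[OF norm_le_sum_components] sum_mono) simp
        also have "\<dots> = \<kappa> / 2 * norm v" using n by (simp add: n_def)
        finally have "\<kappa> * norm v \<le> \<kappa> / 2 * norm v" using \<kappa>(2)[of v] by simp
        then show "v = 0" using \<kappa>(1) by simp
      qed
    qed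
  qed
  have "\<forall>\<^sub>F s in at_right (0::real). \<exists>x\<in>W. gradient (G s) x = Y0"
    using near injG
  proof eventually_elim
    case (elim s)
    define g where "g = gradient (G s)"
    have g: "mpoly_map g" unfolding g_def by (rule gradient_mpoly_map[OF Gpoly])
    have "alg_indep g"
      by (rule alg_indep_of_injective[of g x0, OF g]) (use elim(2) in \<open>simp add: g_def\<close>)
    then obtain \<Delta>' x' where \<Delta>': "mpoly \<Delta>'" "\<Delta>' (g x') \<noteq> 0" "\<forall>x v. \<Delta>' (g x) \<noteq> 0 \<longrightarrow> jac g x v = 0 \<longrightarrow> v = 0"
      using discriminant_ex[of g] g unfolding mpoly_map_def by blast
    have dga: "dist (g a) Y0 < \<epsilon>"
      using elim(1) aW closure_subset[of W] \<epsilon>(1) by (force simp: g_def Y0_def)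
    have "\<exists>x\<in>W. g x = Y0"
    proof (rule value_attained[of g \<Delta>' x', OF g \<Delta>'(1,2) _ W _ aW dga])
      show "v = 0" if "\<Delta>' (g x) \<noteq> 0" "jac g x v = 0" for x v using \<Delta>'(3) that by blast
      fix x assume x: "x \<in> closure W - W"
      have "2 * \<epsilon> \<le> dist (y x) (g x) + dist (g x) Y0"
        using \<epsilon>(2)[OF x] dist_triangle[of "y x" Y0 "g x"] by linarith
      moreover have "dist (g x) (y x) \<le> \<epsilon> / 2" using elim(1) x by (simp add: g_def)
      ultimately show "\<epsilon> \<le> dist (g x) Y0" using \<epsilon>(1) by (simp add: dist_commute)
    qed
    then show ?case by (simp add: g_def)
  qed
  then have "\<forall>\<^sub>F s in at_right (0::real). \<exists>x. r \<le> norm (x $ i0) \<and> norm x \<le> B \<and>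
    (\<forall>j. j \<noteq> i0 \<longrightarrow> partial j (G s) x = 0) \<and> norm (partial i0 (G s) x) \<le> norm Y0"
  proof eventually_elim
    case (elim s)
    then obtain x where x: "x \<in> W" "gradient (G s) x = Y0" by blast
    then have p: "partial j (G s) x = Y0 $ j" for j by (auto simp: gradient_def)
    have "Y0 $ j = 0" if "j \<noteq> i0" for j using a(2)[OF that] by (simp add: Y0_def y_def gradient_def)
    then show ?case using x(1) p Finite_Cartesian_Product.norm_nth_le[of Y0 i0]
      by (intro exI[of _ x]) (auto simp: W_def)
  qed
  then show ?thesis using r(1) unfolding G_def by blast
qed

subsection \<open>The Lojasiewicz exponent\<close>

text \<open>The gradient is at least of order \<open>s powr (1 - l $ j)\<close> with an unknown
  \<open>j\<close>, and \<open>norm z\<close> is at most of order \<open>s powr (l $ i0)\<close>.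
  For \<open>s \<le> 1\<close> the smallest weight is the worst case in both estimates, whence the
  quotient.\<close>

lemma gradient_lower_estimate:
  fixes f F f' :: "complex ^ 'n::finite \<Rightarrow> complex"
  assumes F: "mpoly F" and hom: "qhomogeneous F l" and iso: "\<And>x. gradient F x = 0 \<Longrightarrow> x = 0"
    and l: "\<And>i. 0 < l $ i" "\<And>i. l $ i0 \<le> l $ i" "l $ i0 < 1"
    and f: "\<forall>\<^sub>F z in nhds 0. f z = F z + f' z" and ex: "has_expansion f' c"
    and d: "1 < d" "\<And>a. c a \<noteq> 0 \<Longrightarrow> d \<le> weighted_deg l a"
  shows "\<exists>C>0. \<forall>\<^sub>F z in nhds 0. C * norm z powr ((1 - l $ i0) / l $ i0) \<le> norm (gradient f z)"
proof -
  obtain c0 where c0: "c0 > 0" "\<And>s z. s > 0 \<Longrightarrow> unit_box z \<Longrightarrow> \<exists>j. c0 * s powr (1 - l $ j) \<le> norm (partial j F (wscale l s z))"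
    using gradient_lower_bound[OF F hom iso] by metis
  obtain C s0 where C: "C > 0" "s0 > 0" "\<And>s x i. 0 < s \<Longrightarrow> s < s0 \<Longrightarrow> (\<And>k. norm (x $ k) \<le> s powr (l $ k)) \<Longrightarrow>
    (\<lambda>t. f' (x + axis i t)) field_differentiable at 0 \<and> norm (partial i f' x) \<le> C * s powr (d - l $ i)"
    using expansion_partial_bound[OF ex l(1) d(2)] by metis
  obtain U where U: "open U" "0 \<in> U" "\<And>z. z \<in> U \<Longrightarrow> f z = F z + f' z" using f unfolding eventually_nhds by blast
  \<comment> \<open>Below \<open>s1\<close> the partial derivative of the remainder is at most half
    of the lower bound for that of \<open>F\<close>.\<close>
  define s1 where "s1 = min (min s0 1) ((c0 / (2 * C)) powr (1 / (d - 1)))"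
  have s1: "s1 > 0" "s1 \<le> s0" "s1 \<le> 1" using C c0(1) by (auto simp: s1_def)
  have s1d: "C * s powr (d - 1) \<le> c0 / 2" if "0 < s" "s < s1" for s
  proof -
    have "s powr (d - 1) \<le> ((c0 / (2 * C)) powr (1 / (d - 1))) powr (d - 1)"
      using that d(1) by (intro powr_mono2) (auto simp: s1_def)
    also have "\<dots> = c0 / (2 * C)" using d(1) c0(1) C(1) by (simp add: powr_powr)
    finally show ?thesis using C(1) by (simp add: field_simps)
  qed
  \<comment> \<open>Some coordinate has modulus exactly \<open>s powr (l $ k)\<close>, so
    \<open>norm z < \<delta>\<close> forces \<open>s < s1\<close>.\<close>
  define \<delta> where "\<delta> = Min (range (\<lambda>k. s1 powr (l $ k)))"
  have \<delta>: "\<delta> > 0" unfolding \<delta>_def using s1 by (subst Min_gr_iff) auto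
  define q where "q = (1 - l $ i0) / l $ i0"
  have q: "q > 0" using l(1)[of i0] l(3) by (simp add: q_def)
  define N where "N = real CARD('n)"
  have N: "N > 0" by (simp add: N_def)
  have est: "c0 / 2 * norm z powr q \<le> N powr q * norm (gradient f z)" if z: "norm z < \<delta>" "z \<in> U" for z
  proof (cases "z = 0")
    case True
    then show ?thesis by simp
  next
    case False
    obtain s w where s: "s > 0" "unit_box w" "z = wscale l s w" using wscale_normalise[OF l(1) False] by blast
    have zk: "norm (z $ k) \<le> s powr (l $ k)" for k
      unfolding s(3) norm_wscale_nth using s(2) by (simp add: unit_box_def mult_left_le)
    obtain k where k: "norm (w $ k) = 1" using s(2) by (auto simp: unit_box_def)
    have ss1: "s < s1"
    proof (rule ccontr)
      assume "\<not> s < s1"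
      then have "s1 powr (l $ k) \<le> s powr (l $ k)" using s1 l(1)[of k] by (intro powr_mono2) auto
      also have "\<dots> = norm (z $ k)" unfolding s(3) norm_wscale_nth k by simp
      also have "\<dots> \<le> norm z" by (rule Finite_Cartesian_Product.norm_nth_le)
      also have "\<dots> < \<delta>" by (rule z(1))
      also have "\<dots> \<le> s1 powr (l $ k)" unfolding \<delta>_def by (rule Min_le) auto
      finally show False by simp
    qed
    have s_le1: "s \<le> 1" using ss1 s1 by simp
    obtain j where j: "c0 * s powr (1 - l $ j) \<le> norm (partial j F z)" using c0(2)[OF s(1,2)] s(3) by auto
    have ss0: "s < s0" using ss1 s1(2) by linarith
    have fd: "(\<lambda>t. f' (z + axis j t)) field_differentiable at 0" and fb: "norm (partial j f' z) \<le> C * s powr (d - l $ j)"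
      using C(3)[of s z j, OF s(1) ss0 zk] by auto
    have "partial j f z = partial j (\<lambda>z. F z + f' z) z" by (rule partial_local[OF U(1) z(2) U(3)])
    also have "\<dots> = partial j F z + partial j f' z" by (rule partial_add_differentiable[OF mpoly_axis_differentiable[OF F] fd])
    finally have pf: "partial j f z = partial j F z + partial j f' z" .
    have "s powr (d - l $ j) = s powr (d - 1) * s powr (1 - l $ j)" by (simp flip: powr_add)
    then have "norm (partial j f' z) \<le> c0 / 2 * s powr (1 - l $ j)"
      using fb mult_right_mono[OF s1d[OF s(1) ss1], of "s powr (1 - l $ j)"] by (simp add: mult.assoc)
    then have "c0 / 2 * s powr (1 - l $ j) \<le> norm (partial j f z)"
      using j norm_diff_ineq[of "partial j F z" "partial j f' z"] unfolding pf by linarith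
    also have "\<dots> \<le> norm (gradient f z)"
      using Finite_Cartesian_Product.norm_nth_le[of "gradient f z" j] by (simp add: gradient_def)
    finally have g: "c0 / 2 * s powr (1 - l $ j) \<le> norm (gradient f z)" .
    have "norm z \<le> (\<Sum>k\<in>UNIV. norm (z $ k))" by (rule norm_le_sum_components)
    also have "\<dots> \<le> (\<Sum>k\<in>(UNIV::'n set). s powr (l $ i0))"
    proof (rule sum_mono)
      fix k
      have "s powr (l $ k) \<le> s powr (l $ i0)" using l(2)[of k] s(1) s_le1 by (intro powr_mono') auto
      then show "norm (z $ k) \<le> s powr (l $ i0)" using zk[of k] by simp
    qed
    finally have "norm z \<le> N * s powr (l $ i0)" by (simp add: N_def)
    then have "norm z powr q \<le> (N * s powr (l $ i0)) powr q" using q by (intro powr_mono2) auto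
    also have "\<dots> = N powr q * s powr (1 - l $ i0)"
      using N l(1)[of i0] by (simp add: powr_mult powr_powr q_def)
    also have "\<dots> \<le> N powr q * s powr (1 - l $ j)"
      using l(2)[of j] s(1) s_le1 by (intro mult_left_mono powr_mono') auto
    finally have "c0 / 2 * norm z powr q \<le> c0 / 2 * (N powr q * s powr (1 - l $ j))"
      using c0(1) by (intro mult_left_mono) auto
    also have "\<dots> = N powr q * (c0 / 2 * s powr (1 - l $ j))" by simp
    also have "\<dots> \<le> N powr q * norm (gradient f z)" by (intro mult_left_mono g) simp
    finally show ?thesis .
  qed
  have "\<forall>\<^sub>F z in nhds (0 :: complex ^ 'n). z \<in> ball 0 \<delta> \<inter> U"
    using U \<delta> by (intro eventually_nhds_in_open) auto
  then have "\<forall>\<^sub>F z in nhds 0. c0 / (2 * N powr q) * norm z powr q \<le> norm (gradient f z)"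
  proof eventually_elim
    case (elim z)
    have "N powr q > 0" using N by simp
    then show ?case using est[of z] elim by (simp add: field_simps)
  qed
  then show ?thesis using c0(1) N unfolding q_def[symmetric] by (intro exI[of _ "c0 / (2 * N powr q)"]) auto
qed

lemma wscale_uniform_nhds:
  fixes l :: "real ^ 'n::finite"
  assumes l: "\<And>i. 0 < l $ i" and U: "open U" "0 \<in> U"
  shows "\<forall>\<^sub>F s in at_right 0. \<forall>x. norm x \<le> B \<longrightarrow> wscale l s x \<in> U"
proof -
  obtain \<delta> where \<delta>: "\<delta> > 0" "ball 0 \<delta> \<subseteq> U" using U by (rule openE)
  have "((\<lambda>s::real. s powr (l $ i)) \<longlongrightarrow> 0) (at_right 0)" for i
    by (rule powr_tendsto_0_at_right[OF l])
  then have "((\<lambda>s::real. \<Sum>i\<in>UNIV. s powr (l $ i) * B) \<longlongrightarrow> (\<Sum>i\<in>(UNIV :: 'n set). 0 * B)) (at_right 0)"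
    by (intro tendsto_intros)
  then have "\<forall>\<^sub>F s in at_right (0::real). (\<Sum>i\<in>UNIV. s powr (l $ i) * B) < \<delta>"
    using \<delta>(1) by (intro order_tendstoD(2)) auto
  then show ?thesis
  proof (rule eventually_mono, intro allI impI)
    fix s :: real and x :: "complex ^ 'n"
    assume s: "(\<Sum>i\<in>UNIV. s powr (l $ i) * B) < \<delta>" and x: "norm x \<le> B"
    have "norm (wscale l s x) \<le> (\<Sum>i\<in>UNIV. norm (wscale l s x $ i))" by (rule norm_le_sum_components)
    also have "\<dots> \<le> (\<Sum>i\<in>UNIV. s powr (l $ i) * B)"
      unfolding norm_wscale_nth
      by (intro sum_mono mult_left_mono order_trans[OF Finite_Cartesian_Product.norm_nth_le x]) simp
    finally show "wscale l s x \<in> U" using s \<delta>(2) by auto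
  qed
qed

text \<open>Along \<open>wscale\<close> the germ is \<open>s * G s\<close>, which keeps the finitely
  many terms of \<open>A\<close> exactly, plus a tail of weighted order at least \<open>d\<close>.
  The tail contributes \<open>s powr (d - l $ j)\<close> to the partial derivatives, within the
  target order by the second condition on \<open>d\<close>.\<close>

lemma gradient_upper_points:
  fixes f F f' :: "complex ^ 'n::finite \<Rightarrow> complex"
  assumes F: "mpoly F" and hom: "qhomogeneous F l" and l: "\<And>i. 0 < l $ i"
    and f: "\<forall>\<^sub>F z in nhds 0. f z = F z + f' z" and ex: "has_expansion f' c" and A: "finite A"
    and d: "\<And>a. a \<notin> A \<Longrightarrow> c a \<noteq> 0 \<Longrightarrow> d \<le> weighted_deg l a" "\<And>i. 1 - l $ i0 \<le> d - l $ i"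
    and pts: "\<forall>\<^sub>F s in at_right (0::real). \<exists>x. r \<le> norm (x $ i0) \<and> norm x \<le> B \<and>
      (\<forall>j. s powr (1 - l $ j) * norm (partial j (\<lambda>x. F x +
        (\<Sum>a\<in>A. c a * of_real (s powr (weighted_deg l a - 1)) * monom_at a x)) x) \<le> M * s powr (1 - l $ i0))"
  shows "\<exists>M. \<forall>\<^sub>F s in at_right (0::real). \<exists>x. r \<le> norm (x $ i0) \<and> norm x \<le> B \<and>
    norm (gradient f (wscale l s x)) \<le> M * s powr (1 - l $ i0)"
proof -
  define G where "G s = (\<lambda>x. F x + (\<Sum>a\<in>A. c a * of_real (s powr (weighted_deg l a - 1)) * monom_at a x))" for s
  define T where "T x = (\<Sum>a\<in>A. c a * monom_at a x)" for x
  define H where "H x = F x + T x" for x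
  have Gpoly: "mpoly (G s)" for s unfolding G_def by (intro mpoly_add F mpoly_monom_sum)
  have Hpoly: "mpoly H" unfolding H_def[abs_def] T_def by (intro mpoly_add F mpoly_monom_sum)
  have HG: "H (wscale l s x) = of_real s * G s x" if "s > 0" for s x
  proof -
    have "complex_of_real (s powr weighted_deg l a) = of_real s * of_real (s powr (weighted_deg l a - 1))" for a
      unfolding of_real_mult[symmetric] using that by (simp add: powr_diff)
    then show ?thesis using hom that
      by (simp add: H_def T_def G_def qhomogeneous_def monom_at_wscale distrib_left sum_distrib_left mult_ac)
  qed
  have pH: "norm (partial j H (wscale l s x)) = s powr (1 - l $ j) * norm (partial j (G s) x)" if s: "s > 0" for j s x
  proof -
    have "(\<lambda>x. H (wscale l s x)) = (\<lambda>x. of_real s * G s x)" using HG[OF s] by auto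
    then have "of_real (s powr (l $ j)) * partial j H (wscale l s x) = of_real s * partial j (G s) x"
      using partial_wscale[OF Hpoly, of j l s x] partial_scale[OF Gpoly, of j "of_real s"] by simp
    then have "norm (complex_of_real (s powr (l $ j)) * partial j H (wscale l s x)) = norm (of_real s * partial j (G s) x)"
      by simp
    then show ?thesis using s by (simp add: norm_mult powr_diff field_simps)
  qed
  define h where "h x = f' x - T x" for x
  define c' where "c' a = (if a \<in> A then 0 else c a)" for a
  have exh: "has_expansion h c'"
    using ex unfolding has_expansion_def
  proof eventually_elim
    case (elim z)
    have "((\<lambda>a. if a \<in> A then - (c a * monom_at a z) else 0) has_sum - T z) UNIV"
      by (rule has_sum_finite_neutralI[OF A]) (auto simp: T_def sum_negf)
    from has_sum_add[OF elim this]
    have "((\<lambda>a. c a * monom_at a z + (if a \<in> A then - (c a * monom_at a z) else 0)) has_sum h z) UNIV"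
      by (simp add: h_def)
    moreover have "(\<lambda>a. c a * monom_at a z + (if a \<in> A then - (c a * monom_at a z) else 0)) = (\<lambda>a. c' a * monom_at a z)"
      by (auto simp: c'_def)
    ultimately show ?case by simp
  qed
  have d': "d \<le> weighted_deg l a" if "c' a \<noteq> 0" for a
    using that d(1) by (auto simp: c'_def split: if_splits)
  obtain C s0 where C: "C > 0" "s0 > 0" "\<And>s x i. 0 < s \<Longrightarrow> s < s0 \<Longrightarrow> (\<And>k. norm (x $ k) \<le> s powr (l $ k)) \<Longrightarrow>
    (\<lambda>t. h (x + axis i t)) field_differentiable at 0 \<and> norm (partial i h x) \<le> C * s powr (d - l $ i)"
    using expansion_partial_bound[OF exh l d'] by metis
  \<comment> \<open>A point with \<open>norm x \<le> B\<close> may lie outside the unit polydisc.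
    Enlarging the scale from \<open>s\<close> to \<open>\<kappa> * s\<close> corrects this in all
    coordinates, since \<open>B \<le> \<kappa> powr (l $ k)\<close>.\<close>
  define \<kappa> where "\<kappa> = Max (range (\<lambda>k. (max B 1) powr (1 / l $ k)))"
  have \<kappa>_ge: "(max B 1) powr (1 / l $ k) \<le> \<kappa>" for k unfolding \<kappa>_def by (rule Max_ge) auto
  have \<kappa>: "\<kappa> > 0" using \<kappa>_ge[of i0] by (rule less_le_trans[rotated]) (auto simp: max_def)
  have \<kappa>B: "B \<le> \<kappa> powr (l $ k)" for k
  proof -
    have "((max B 1) powr (1 / l $ k)) powr (l $ k) \<le> \<kappa> powr (l $ k)"
      using l[of k] by (intro powr_mono2 \<kappa>_ge) auto
    then show ?thesis using l[of k] by (simp add: powr_powr)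
  qed
  define K where "K = (\<Sum>j\<in>UNIV. \<kappa> powr (d - l $ j))"
  define M' where "M' = real CARD('n) * (M + C * K)"
  obtain U where U: "open U" "0 \<in> U" "\<And>z. z \<in> U \<Longrightarrow> f z = F z + f' z" using f unfolding eventually_nhds by blast
  have ev: "\<forall>\<^sub>F s in at_right (0::real). 0 < s \<and> s < min 1 (s0 / \<kappa>)"
    using C(2) \<kappa> by (intro eventually_at_rightI[of 0 "min 1 (s0 / \<kappa>)"]) auto
  have "\<forall>\<^sub>F s in at_right (0::real). \<exists>x. r \<le> norm (x $ i0) \<and> norm x \<le> B \<and>
    norm (gradient f (wscale l s x)) \<le> M' * s powr (1 - l $ i0)"
    using pts[folded G_def] ev wscale_uniform_nhds[OF l U(1,2), of B]
  proof eventually_elim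
    case (elim s)
    then obtain x where x: "r \<le> norm (x $ i0)" "norm x \<le> B"
      "\<And>j. s powr (1 - l $ j) * norm (partial j (G s) x) \<le> M * s powr (1 - l $ i0)" by blast
    have s: "0 < s" "s < 1" "\<kappa> * s < s0" "0 < \<kappa> * s" using elim(2) \<kappa> by (auto simp: field_simps)
    define z where "z = wscale l s x"
    have zU: "z \<in> U" using elim(3) x(2) by (simp add: z_def)
    have zk: "norm (z $ k) \<le> (\<kappa> * s) powr (l $ k)" for k
    proof -
      have "norm (x $ k) \<le> B" using Finite_Cartesian_Product.norm_nth_le[of x k] x(2) by linarith
      then have "norm (x $ k) \<le> \<kappa> powr (l $ k)" using \<kappa>B[of k] by linarith
      then have "s powr (l $ k) * norm (x $ k) \<le> s powr (l $ k) * \<kappa> powr (l $ k)" by (intro mult_left_mono) auto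
      then show ?thesis using s(1) \<kappa> unfolding z_def norm_wscale_nth by (simp add: powr_mult mult.commute)
    qed
    have pj: "norm (partial j f z) \<le> (M + C * K) * s powr (1 - l $ i0)" for j
    proof -
      have fd: "(\<lambda>t. h (z + axis j t)) field_differentiable at 0"
        and fb: "norm (partial j h z) \<le> C * (\<kappa> * s) powr (d - l $ j)"
        using C(3)[of "\<kappa> * s" z j, OF s(4,3) zk] by auto
      have "partial j f z = partial j (\<lambda>z. H z + h z) z"
        by (rule partial_local[OF U(1) zU]) (simp add: U(3) H_def h_def)
      also have "\<dots> = partial j H z + partial j h z"
        by (rule partial_add_differentiable[OF mpoly_axis_differentiable[OF Hpoly] fd])
      finally have "norm (partial j f z) \<le> norm (partial j H z) + norm (partial j h z)"
        using norm_triangle_ineq by simp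
      moreover have "norm (partial j H z) \<le> M * s powr (1 - l $ i0)"
        using x(3)[of j] pH[OF s(1), of j x] by (simp add: z_def)
      moreover have "norm (partial j h z) \<le> C * K * s powr (1 - l $ i0)"
      proof -
        have "(\<kappa> * s) powr (d - l $ j) = \<kappa> powr (d - l $ j) * s powr (d - l $ j)"
          using s(1) \<kappa> by (simp add: powr_mult)
        also have "\<dots> \<le> K * s powr (1 - l $ i0)"
        proof (rule mult_mono)
          show "\<kappa> powr (d - l $ j) \<le> K" unfolding K_def by (rule member_le_sum) auto
          show "s powr (d - l $ j) \<le> s powr (1 - l $ i0)" using d(2)[of j] s by (intro powr_mono') auto
          show "0 \<le> K" unfolding K_def by (rule sum_nonneg) simp
        qed simp
        finally have "C * (\<kappa> * s) powr (d - l $ j) \<le> C * (K * s powr (1 - l $ i0))"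
          using C(1) by (intro mult_left_mono) auto
        then show ?thesis using fb by (simp add: mult.assoc)
      qed
      ultimately show ?thesis by (simp add: distrib_right)
    qed
    have "norm (gradient f z) \<le> (\<Sum>j\<in>UNIV. norm (gradient f z $ j))" by (rule norm_le_sum_components)
    also have "\<dots> \<le> (\<Sum>j\<in>(UNIV::'n set). (M + C * K) * s powr (1 - l $ i0))"
      using pj by (intro sum_mono) (simp add: gradient_def)
    also have "\<dots> = M' * s powr (1 - l $ i0)" by (simp add: M'_def)
    finally show ?case using x(1,2) by (auto simp: z_def)
  qed
  then show ?thesis by blast
qed

lemma polar_points:
  fixes f F f' :: "complex ^ 'n::finite \<Rightarrow> complex"
  assumes F: "mpoly F" and hom: "qhomogeneous F l" and iso: "\<And>x. gradient F x = 0 \<Longrightarrow> x = 0"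
    and l: "\<And>i. 0 < l $ i" "\<And>i. l $ i0 \<le> l $ i" "\<And>i. l $ i \<le> 1 / 2"
    and f: "\<forall>\<^sub>F z in nhds 0. f z = F z + f' z" and ex: "has_expansion f' c"
    and d: "\<And>a. c a \<noteq> 0 \<Longrightarrow> 1 < weighted_deg l a"
  shows "\<exists>r>0. \<exists>B M. \<forall>\<^sub>F s in at_right (0::real). \<exists>x. r \<le> norm (x $ i0) \<and> norm x \<le> B \<and>
    norm (gradient f (wscale l s x)) \<le> M * s powr (1 - l $ i0)"
proof (cases "l $ i0 < 1 / 2")
  case True
  \<comment> \<open>Monomials of weight above 2 contribute partial derivatives of order at most
    \<open>s powr (2 - l $ i)\<close>, within the allowed \<open>s powr (1 - l $ i0)\<close>. The
    others are finite in number and become the polynomial perturbation.\<close>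
  define A where "A = {a. c a \<noteq> 0 \<and> weighted_deg l a \<le> 2}"
  have A: "finite A" unfolding A_def by (rule finite_subset[OF _ finite_weighted_deg_le[OF l(1), of 2]]) auto
  have l1: "l $ i < 1" for i using l(3)[of i] by simp
  have l0: "l $ i0 + l $ j < 1" for j using True l(3)[of j] by simp
  have e: "0 < weighted_deg l a - 1" if "a \<in> A" for a using that d[of a] by (simp add: A_def)
  obtain r B M where r: "r > 0" and ev: "\<forall>\<^sub>F s in at_right (0::real). \<exists>x. r \<le> norm (x $ i0) \<and> norm x \<le> B \<and>
    (\<forall>j. j \<noteq> i0 \<longrightarrow> partial j (\<lambda>x. F x + (\<Sum>a\<in>A. c a * of_real (s powr (weighted_deg l a - 1)) * monom_at a x)) x = 0) \<and>
    norm (partial i0 (\<lambda>x. F x + (\<Sum>a\<in>A. c a * of_real (s powr (weighted_deg l a - 1)) * monom_at a x)) x) \<le> M"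
    using polar_point_perturbed[where F = F and l = l and ?i0.0 = i0 and A = A and c = c
      and e = "\<lambda>a. weighted_deg l a - 1", OF F hom iso l(1) l1 l0 A e] by blast
  have "\<exists>M. \<forall>\<^sub>F s in at_right (0::real). \<exists>x. r \<le> norm (x $ i0) \<and> norm x \<le> B \<and>
    norm (gradient f (wscale l s x)) \<le> M * s powr (1 - l $ i0)"
  proof (rule gradient_upper_points[OF F hom l(1) f ex A, of 2])
    show "2 \<le> weighted_deg l a" if "a \<notin> A" "c a \<noteq> 0" for a using that by (simp add: A_def)
    show "1 - l $ i0 \<le> 2 - l $ i" for i using l1[of i] l(1)[of i0] by linarith
    show "\<forall>\<^sub>F s in at_right (0::real). \<exists>x. r \<le> norm (x $ i0) \<and> norm x \<le> B \<and>
      (\<forall>j. s powr (1 - l $ j) * norm (partial j (\<lambda>x. F x +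
        (\<Sum>a\<in>A. c a * of_real (s powr (weighted_deg l a - 1)) * monom_at a x)) x) \<le> M * s powr (1 - l $ i0))"
      using ev
    proof eventually_elim
      case (elim s)
      define p where "p j = partial j (\<lambda>x. F x + (\<Sum>a\<in>A. c a * of_real (s powr (weighted_deg l a - 1)) * monom_at a x))" for j
      obtain x where x: "r \<le> norm (x $ i0)" "norm x \<le> B" "\<And>j. j \<noteq> i0 \<Longrightarrow> p j x = 0" "norm (p i0 x) \<le> M"
        using elim unfolding p_def by blast
      have "0 \<le> M" using norm_ge_zero[of "p i0 x"] x(4) by linarith
      then have "s powr (1 - l $ j) * norm (p j x) \<le> M * s powr (1 - l $ i0)" for j
        using x(3,4) by (cases "j = i0") (auto simp: mult.commute[of M] intro!: mult_left_mono)
      then show ?case using x(1,2) unfolding p_def by blast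
    qed
  qed
  then show ?thesis using r by blast
next
  case False
  then have half: "l $ i = 1 / 2" for i using l(2)[of i] l(3)[of i] by linarith
  \<comment> \<open>As all weights are 1/2, every partial derivative scales with the exponent
    \<open>1 - l $ i0\<close>, so a fixed vector with \<open>x $ i0\<close> non-zero serves. The
    whole of \<open>f'\<close> then counts as tail, with \<open>d = 1\<close>.\<close>
  define x :: "complex ^ 'n" where "x = (\<chi> i. 1)"
  define M where "M = (\<Sum>j\<in>UNIV. norm (partial j F x))"
  have "\<exists>M. \<forall>\<^sub>F s in at_right (0::real). \<exists>y. 1 \<le> norm (y $ i0) \<and> norm y \<le> norm x \<and>
    norm (gradient f (wscale l s y)) \<le> M * s powr (1 - l $ i0)"
  proof (rule gradient_upper_points[OF F hom l(1) f ex finite.emptyI, of 1])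
    show "1 \<le> weighted_deg l a" if "c a \<noteq> 0" for a using d[OF that] by simp
    show "1 - l $ i0 \<le> 1 - l $ i" for i by (simp add: half)
    have "s powr (1 - l $ j) * norm (partial j F x) \<le> M * s powr (1 - l $ i0)" for s j
    proof -
      have "norm (partial j F x) \<le> M" unfolding M_def by (rule member_le_sum) auto
      then show ?thesis by (simp add: half mult.commute[of M] mult_left_mono)
    qed
    then show "\<forall>\<^sub>F s in at_right (0::real). \<exists>y. 1 \<le> norm (y $ i0) \<and> norm y \<le> norm x \<and>
      (\<forall>j. s powr (1 - l $ j) * norm (partial j (\<lambda>x. F x +
        (\<Sum>a\<in>{}. c a * of_real (s powr (weighted_deg l a - 1)) * monom_at a x)) y) \<le> M * s powr (1 - l $ i0))"
      by (intro always_eventually allI exI[of _ x]) (auto simp: x_def)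
  qed
  then show ?thesis by (intro exI[of _ 1]) auto
qed

text \<open>At \<open>wscale l s x\<close> the norm is at least \<open>s powr (l $ i0) * r\<close>
  and the gradient at most of order \<open>s powr (1 - l $ i0)\<close>. For smaller \<open>q\<close>
  the inequality would fail as \<open>s\<close> tends to 0.\<close>

lemma exponent_ge:
  fixes f :: "complex ^ 'n::finite \<Rightarrow> complex"
  assumes l: "\<And>i. 0 < l $ i" and r: "r > 0"
    and pts: "\<forall>\<^sub>F s in at_right (0::real). \<exists>x. r \<le> norm (x $ i0) \<and> norm x \<le> B \<and>
      norm (gradient f (wscale l s x)) \<le> M * s powr (1 - l $ i0)"
    and q: "q > 0" and C: "C > 0" "\<forall>\<^sub>F z in nhds 0. C * norm z powr q \<le> norm (gradient f z)"
  shows "(1 - l $ i0) / l $ i0 \<le> q"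
proof (rule ccontr)
  assume "\<not> (1 - l $ i0) / l $ i0 \<le> q"
  then have gap: "0 < 1 - l $ i0 - l $ i0 * q" using l[of i0] by (simp add: field_simps)
  obtain U where U: "open U" "0 \<in> U" "\<And>z. z \<in> U \<Longrightarrow> C * norm z powr q \<le> norm (gradient f z)"
    using C(2) unfolding eventually_nhds by blast
  have "((\<lambda>s::real. s powr (1 - l $ i0 - l $ i0 * q)) \<longlongrightarrow> 0) (at_right 0)"
    by (rule powr_tendsto_0_at_right[OF gap])
  then have "((\<lambda>s::real. M * s powr (1 - l $ i0 - l $ i0 * q)) \<longlongrightarrow> M * 0) (at_right 0)"
    by (intro tendsto_intros)
  then have "\<forall>\<^sub>F s in at_right (0::real). M * s powr (1 - l $ i0 - l $ i0 * q) < C * r powr q"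
    using C(1) r by (intro order_tendstoD(2)) auto
  moreover have "\<forall>\<^sub>F s in at_right (0::real). s > 0" by (simp add: eventually_at_right_less)
  ultimately have "\<forall>\<^sub>F s in at_right (0::real). False"
    using pts wscale_uniform_nhds[OF l U(1,2), of B]
  proof eventually_elim
    case (elim s)
    then obtain x where x: "r \<le> norm (x $ i0)" "norm x \<le> B"
      "norm (gradient f (wscale l s x)) \<le> M * s powr (1 - l $ i0)" by blast
    have "s powr (l $ i0) * r \<le> norm (wscale l s x $ i0)"
      unfolding norm_wscale_nth by (intro mult_left_mono x) simp
    also have "\<dots> \<le> norm (wscale l s x)" by (rule Finite_Cartesian_Product.norm_nth_le)
    finally have "(s powr (l $ i0) * r) powr q \<le> norm (wscale l s x) powr q" using r q by (intro powr_mono2) auto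
    then have "C * (s powr (l $ i0) * r) powr q \<le> C * norm (wscale l s x) powr q" using C(1) by simp
    also have "\<dots> \<le> M * s powr (1 - l $ i0)" using U(3)[of "wscale l s x"] x(2,3) elim(4) by force
    finally have "C * r powr q * s powr (l $ i0 * q) \<le> M * s powr (1 - l $ i0)"
      using r by (simp add: powr_mult powr_powr mult_ac)
    also have "M * s powr (1 - l $ i0) = M * s powr (1 - l $ i0 - l $ i0 * q) * s powr (l $ i0 * q)"
      by (simp flip: powr_add)
    finally have "C * r powr q \<le> M * s powr (1 - l $ i0 - l $ i0 * q)" using elim(2) by simp
    then show ?case using elim(1) by simp
  qed
  then show False by simp
qed

theorem theorem3:
  fixes f :: "complex ^ 'n::finite \<Rightarrow> complex" and l :: "real ^ 'n" and w :: "'n \<Rightarrow> real"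
  assumes "semiquasihomogeneous f 1 l"
    and "\<And>i. w i = 1 / l $ i"
  shows "lojasiewicz_exponent f = ereal (MAX i\<in>UNIV. w i - 1)"
proof -
  have l: "0 < l $ i" "l $ i \<le> 1 / 2" "l $ i \<in> \<rat>" for i
    using assms(1) by (auto simp: semiquasihomogeneous_def)
  obtain f0 f' where f': "\<forall>\<^sub>F z in nhds 0. f z = f0 z + f' z" "weakly_quasihomogeneous f0 1 l"
      "isolated_singularity f0" "holomorphic_germ f'" "\<And>a. a \<in> appearing f' \<Longrightarrow> weighted_deg l a > 1"
    using assms(1) unfolding semiquasihomogeneous_def by blast
  obtain F where F: "mpoly F" "qhomogeneous F l" "\<forall>\<^sub>F z in nhds 0. f0 z = F z" "\<And>x. gradient F x = 0 \<Longrightarrow> x = 0"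
    using quasihomogeneous_polynomial[OF f'(2,3) l(1)] by blast
  obtain c where c: "has_expansion f' c" using f'(4) by (auto simp: holomorphic_germ_def)
  have deg: "1 < weighted_deg l a" if "c a \<noteq> 0" for a
    using f'(5) c that by (auto simp: appearing_def)
  have f: "\<forall>\<^sub>F z in nhds 0. f z = F z + f' z" using f'(1) F(3) by eventually_elim simp
  obtain i0 where i0: "\<And>i. l $ i0 \<le> l $ i"
  proof -
    have "Min (range (\<lambda>i. l $ i)) \<in> range (\<lambda>i. l $ i)" by (rule Min_in) auto
    then obtain i0 where i0: "Min (range (\<lambda>i. l $ i)) = l $ i0" by (rule imageE)
    show ?thesis by (rule that[of i0], unfold i0[symmetric], rule Min_le) auto
  qed
  define q0 where "q0 = (1 - l $ i0) / l $ i0"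
  \<comment> \<open>Rationality of the weights enters here: \<open>q0\<close> itself belongs to the
    exponents over which the infimum is taken.\<close>
  have q0: "q0 > 0" "q0 \<in> \<rat>" using l[of i0] by (auto simp: q0_def)
  have "(MAX i\<in>UNIV. w i - 1) = q0"
  proof (rule Max_eqI)
    have "w i0 - 1 = q0" using l(1)[of i0] by (simp add: assms(2) q0_def field_simps)
    then show "q0 \<in> range (\<lambda>i. w i - 1)" by force
    fix y assume "y \<in> range (\<lambda>i. w i - 1)"
    then obtain i where "y = w i - 1" by blast
    moreover have "1 / l $ i \<le> 1 / l $ i0" using i0[of i] l(1)[of i0] by (intro divide_left_mono) auto
    ultimately show "y \<le> q0" using l(1)[of i0] by (simp add: assms(2) q0_def diff_divide_distrib)
  qed simp
  moreover have "lojasiewicz_exponent f = ereal q0"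
    unfolding lojasiewicz_exponent_def lojasiewicz_map_def
  proof (rule antisym)
    \<comment> \<open>Only finitely many monomials have weighted degree at most 2, so the degrees of
      the remainder have a lower bound \<open>d > 1\<close>. The inserted 2 accounts for all other
      monomials and for an empty \<open>D\<close>.\<close>
    define D where "D = weighted_deg l ` {a. c a \<noteq> 0 \<and> weighted_deg l a \<le> 2}"
    have D: "finite D" unfolding D_def
      by (intro finite_imageI finite_subset[OF _ finite_weighted_deg_le[OF l(1), of 2]]) auto
    define d where "d = Min (insert 2 D)"
    have d1: "1 < d" unfolding d_def using D deg by (subst Min_gr_iff) (auto simp: D_def)
    have d: "d \<le> weighted_deg l a" if "c a \<noteq> 0" for a
    proof (cases "weighted_deg l a \<le> 2")
      case True
      then show ?thesis unfolding d_def using D that by (intro Min_le) (auto simp: D_def)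
    next
      case False
      moreover have "d \<le> 2" unfolding d_def using D by (intro Min_le) auto
      ultimately show ?thesis by simp
    qed
    have "l $ i0 < 1" using l(2)[of i0] by simp
    from gradient_lower_estimate[OF F(1,2,4) l(1) i0 this f c d1 d]
    show "(INF q\<in>{q::real. q \<in> \<rat> \<and> q > 0 \<and> (\<exists>C>0. \<forall>\<^sub>F z in nhds 0. C * norm z powr q \<le> norm (gradient f z))}. ereal q) \<le> ereal q0"
      using q0 by (intro INF_lower) (simp add: q0_def)
    obtain r B M where "r > 0" "\<forall>\<^sub>F s in at_right (0::real). \<exists>x. r \<le> norm (x $ i0) \<and> norm x \<le> B \<and>
      norm (gradient f (wscale l s x)) \<le> M * s powr (1 - l $ i0)"
      using polar_points[OF F(1,2,4) l(1) i0 l(2) f c deg] by blast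
    from exponent_ge[OF l(1) this]
    show "ereal q0 \<le> (INF q\<in>{q::real. q \<in> \<rat> \<and> q > 0 \<and> (\<exists>C>0. \<forall>\<^sub>F z in nhds 0. C * norm z powr q \<le> norm (gradient f z))}. ereal q)"
      by (intro INF_greatest) (auto simp: q0_def)
  qed
  ultimately show ?thesis by simp
qed

end
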